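(* Fix $\alpha,\beta\in(0,1)$, $c_0>0$ and $\gamma\ge 1$. Let $p_n\ge n$ with $p_n/n\to\gamma$, $r_n=n^{1-\beta}$, $\delta_n=n^{-\alpha}$, and write $p=p_n$, $r=r_n$, $\delta=\delta_n$. Let $D^*=D^*_n\in\mathbb{R}^{r\times r}$ be a positive semi-definite matrix. Given vectors $X_1,\dots,X_n\in\mathbb{R}^p$, consider testing $H_0^{(n)}:X_i\stackrel{iid}{\sim}N(0,I_p)$ versus the alternative $H_1^{(n)}:(X_i\mid Q)\stackrel{iid}{\sim}N(0,I_p+QD^*Q')$, where $Q$ is uniformly distributed over the Stiefel manifold $\mathbb{S}(p,r)$. If $\alpha+\beta>1$ and $\|D^*\|\le c_0\frac{\delta}{1-\delta}$, then as $n\to\infty$, the sum of Type I and Type II errors of any test tends to $1$ (i.e. the infimum over all tests of the sum of Type I and Type II errors tends to $1$).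
   Context: $\mathbb{S}(p,r)=\{Q\in\mathbb{R}^{p\times r}:Q'Q=I_r\}$ is the Stiefel manifold; "uniform" means the law invariant under left multiplication by orthogonal $p\times p$ matrices. $r_n=n^{1-\beta}$ is understood as rounded to an integer. $\|D^*\|$ is the spectral norm. Under $H_1^{(n)}$ the law of the data is the mixture over $Q$ (one $Q$ is drawn, common to all $i$). The Type I error of a test is its rejection probability under $H_0^{(n)}$; the Type II error is its acceptance probability under $H_1^{(n)}$. *)

theory Defs
  imports "HOL-Probability.Probability" "Jordan_Normal_Form.Gauss_Jordan_Elimination"
    "Jordan_Normal_Form.Determinant"
begin

no_notation vec_nth (infixl "$" 90)

text \<open>Dimensions vary with the sample size, so vectors and matrices are those of
  \<^theory>\<open>Jordan_Normal_Form.Matrix\<close>, with the Borel sigma-algebra and Lebesgue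
  measure transported through the entries.\<close>

definition borel_vec :: "nat \<Rightarrow> real vec measure" where
  "borel_vec p = vimage_algebra (carrier_vec p) (\<lambda>v. \<lambda>i\<in>{..<p}. v $ i) (\<Pi>\<^sub>M i\<in>{..<p}. borel)"

definition lborel_vec :: "nat \<Rightarrow> real vec measure" where
  "lborel_vec p = distr (\<Pi>\<^sub>M i\<in>{..<p}. lborel) (borel_vec p) (Matrix.vec p)"

definition borel_mat :: "nat \<Rightarrow> nat \<Rightarrow> real mat measure" where
  "borel_mat p r = vimage_algebra (carrier_mat p r)
     (\<lambda>A. \<lambda>ij\<in>{..<p} \<times> {..<r}. A $$ ij) (\<Pi>\<^sub>M ij\<in>{..<p} \<times> {..<r}. borel)"

definition pos_semidef :: "real mat \<Rightarrow> bool" where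
  "pos_semidef A \<longleftrightarrow> square_mat A \<and> transpose_mat A = A \<and>
     (\<forall>v\<in>carrier_vec (dim_row A). 0 \<le> v \<bullet> (A *\<^sub>v v))"

text \<open>The spectral norm is the operator norm induced by the Euclidean norm.\<close>

definition spectral_norm :: "real mat \<Rightarrow> real" where
  "spectral_norm A =
     (SUP v\<in>{v \<in> carrier_vec (dim_col A). v \<bullet> v \<le> 1}. sqrt ((A *\<^sub>v v) \<bullet> (A *\<^sub>v v)))"

text \<open>The centred normal law with covariance matrix \<open>S\<close>, via its Lebesgue density; meant for
  symmetric positive definite \<open>S\<close>, for which \<^const>\<open>mat_inverse\<close> does not return
  \<^const>\<open>None\<close>.\<close>

definition normal_vec :: "real mat \<Rightarrow> real vec measure" where
  "normal_vec S = density (lborel_vec (dim_row S))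
     (\<lambda>x. ennreal (exp (- (x \<bullet> (the (mat_inverse S) *\<^sub>v x)) / 2) /
                   sqrt ((2 * pi) ^ dim_row S * Determinant.det S)))"

definition stiefel :: "nat \<Rightarrow> nat \<Rightarrow> real mat set" where
  "stiefel p r = {Q \<in> carrier_mat p r. transpose_mat Q * Q = 1\<^sub>m r}"

definition uniform_stiefel :: "nat \<Rightarrow> nat \<Rightarrow> real mat measure \<Rightarrow> bool" where
  "uniform_stiefel p r \<nu> \<longleftrightarrow> prob_space \<nu> \<and>
     sets \<nu> = sets (restrict_space (borel_mat p r) (stiefel p r)) \<and>
     (\<forall>U\<in>carrier_mat p p. transpose_mat U * U = 1\<^sub>m p \<longrightarrow> distr \<nu> \<nu> (\<lambda>Q. U * Q) = \<nu>)"

text \<open>Law of an i.i.d. sample \<open>X\<^sub>0, \<dots>, X\<^bsub>n-1\<^esub>\<close> from \<open>N(0, S)\<close>.\<close>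

definition normal_sample :: "nat \<Rightarrow> real mat \<Rightarrow> (nat \<Rightarrow> real vec) measure" where
  "normal_sample n S = (\<Pi>\<^sub>M i\<in>{..<n}. normal_vec S)"

definition null_law :: "nat \<Rightarrow> nat \<Rightarrow> (nat \<Rightarrow> real vec) measure" where
  "null_law n p = normal_sample n (1\<^sub>m p)"

definition alt_law ::
    "nat \<Rightarrow> nat \<Rightarrow> real mat \<Rightarrow> real mat measure \<Rightarrow> (nat \<Rightarrow> real vec) measure" where
  "alt_law n p D \<nu> = \<nu> \<bind> (\<lambda>Q. normal_sample n (1\<^sub>m p + Q * D * transpose_mat Q))"

text \<open>A possibly randomized test: \<open>\<phi> x\<close> is the probability of rejecting the null hypothesis
  when the data are \<open>x\<close>. Non-randomized tests are the indicators of rejection regions.\<close>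

definition tests :: "nat \<Rightarrow> nat \<Rightarrow> ((nat \<Rightarrow> real vec) \<Rightarrow> real) set" where
  "tests n p = {\<phi> \<in> borel_measurable (\<Pi>\<^sub>M i\<in>{..<n}. borel_vec p). \<forall>x. 0 \<le> \<phi> x \<and> \<phi> x \<le> 1}"

definition type_I_error ::
    "(nat \<Rightarrow> real vec) measure \<Rightarrow> ((nat \<Rightarrow> real vec) \<Rightarrow> real) \<Rightarrow> real" where
  "type_I_error P0 \<phi> = (\<integral>x. \<phi> x \<partial>P0)"

definition type_II_error ::
    "(nat \<Rightarrow> real vec) measure \<Rightarrow> ((nat \<Rightarrow> real vec) \<Rightarrow> real) \<Rightarrow> real" where
  "type_II_error P1 \<phi> = (\<integral>x. (1 - \<phi> x) \<partial>P1)"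

end

theory Submission
  imports Defs "Jordan_Normal_Form.Schur_Decomposition"
begin

no_notation inner (infix "\<bullet>" 70)

text \<open>The second-moment method: it suffices that the likelihood ratio of the mixture against
  the null law has second moment \<open>1 + o(1)\<close>. With \<open>A = QD\<^sup>*Q'\<close> and an independent copy
  \<open>B = R D\<^sup>* R'\<close>, a Gaussian integral evaluates the second moment to the expectation of
  \<open>det (I - AB)\<close> to the power \<open>-n/2\<close>. The eigenvalues of \<open>AB\<close> are nonnegative, so
  \<open>det (I - AB) \<ge> 1 - tr (AB)\<close>, and \<open>tr (AB)\<close> is at most the squared norm of \<open>D\<^sup>*\<close> times the
  sum of the \<open>r\<^sup>2\<close> squared entries of \<open>Q'R\<close>. Convexity of the exponential decouples these
  entries, at the cost of a factor \<open>r\<^sup>2\<close> in the exponent. Each entry is a coordinate of a uniform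
  unit vector, of order \<open>p\<^sup>-\<^sup>1\<^sup>/\<^sup>2\<close> and sub-Gaussian, so that everything is governed by
  \<open>n (\<parallel>D\<^sup>*\<parallel> r)\<^sup>2 / p\<close>, which tends to \<open>0\<close> because \<open>\<alpha> + \<beta> > 1\<close>.\<close>

section \<open>Linear algebra and Gaussian integrals\<close>

text \<open>Two obstacles shape the proof. First, \<open>alt_law\<close> is a \<open>bind\<close>,
  which can be turned into a mixture density only if the conditional densities are jointly
  measurable in \<open>Q\<close> and the data. Second, the second moment need not be finite. With A
  = QDQ' and I - G the inverse of I + A, and likewise A' and G' for the second copy, the product of
  two likelihood ratios is integrable against the null when I - (G + G') is positive definite. It is
  enough that G and G' both lie below I/2, which holds once the norm of D is below 1. The entries of
  Q'R are dependent, so the exponential of their sum of squares does not factor. Jensen's inequality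
  needs no joint law: it leaves single entries, and left invariance controls those. The loss is
  affordable: an entry has square of order 1/p and receives the exponent p (\<epsilon> r)^2, where
  \<epsilon> bounds the norm of D, and \<epsilon> r has order n^(1 - \<alpha> - \<beta>) +
  n^(-\<alpha>). All bounds are explicit for each n and uniform over tests, so the limit is taken
  only at the end, for a single real sequence.\<close>

definition mat_trace :: "'a :: comm_ring_1 mat \<Rightarrow> 'a" where
  "mat_trace A = (\<Sum>i<dim_row A. A $$ (i, i))"

lemma mat_mult_index:
  assumes "A \<in> carrier_mat n k" "B \<in> carrier_mat k m" "i < n" "j < m"
  shows "(A * B) $$ (i, j) = (\<Sum>l<k. A $$ (i, l) * B $$ (l, j))"
  using assms by (auto simp: scalar_prod_def lessThan_atLeast0 intro!: sum.cong)

lemma mult_mat_vec_index: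
  assumes "A \<in> carrier_mat n k" "v \<in> carrier_vec k" "i < n"
  shows "(A *\<^sub>v v) $ i = (\<Sum>l<k. A $$ (i, l) * v $ l)"
  using assms by (auto simp: scalar_prod_def lessThan_atLeast0 intro!: sum.cong)

lemma scalar_prod_sum:
  assumes "w \<in> carrier_vec n"
  shows "v \<bullet> w = (\<Sum>i<n. v $ i * w $ i)"
  using assms by (auto simp: scalar_prod_def lessThan_atLeast0)

lemma mat_trace_mult_commute:
  assumes "A \<in> carrier_mat n m" "B \<in> carrier_mat m n"
  shows "mat_trace (A * B) = mat_trace (B * A)"
proof -
  have "mat_trace (A * B) = (\<Sum>i<n. \<Sum>l<m. A $$ (i, l) * B $$ (l, i))"
    using assms by (auto simp: mat_trace_def mat_mult_index simp del: index_mult_mat(1) intro!: sum.cong)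
  also have "\<dots> = (\<Sum>l<m. \<Sum>i<n. B $$ (l, i) * A $$ (i, l))"
    by (subst sum.swap) (simp add: mult.commute)
  also have "\<dots> = mat_trace (B * A)"
    using assms by (auto simp: mat_trace_def mat_mult_index simp del: index_mult_mat(1) intro!: sum.cong)
  finally show ?thesis .
qed

lemma scalar_prod_self_nonneg: "0 \<le> v \<bullet> (v :: real vec)"
  by (auto simp: scalar_prod_def intro!: sum_nonneg)

lemma scalar_prod_self_eq_0:
  assumes "v \<in> carrier_vec n" "v \<bullet> (v :: real vec) = 0"
  shows "v = 0\<^sub>v n"
proof (rule eq_vecI)
  fix i assume "i < dim_vec (0\<^sub>v n :: real vec)"
  then have "i < n" by simp
  have "(\<Sum>i<n. v $ i * v $ i) = 0" using assms scalar_prod_sum by metis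
  then have "v $ i * v $ i = 0"
    using \<open>i < n\<close> by (subst (asm) sum_nonneg_eq_0_iff) auto
  then show "v $ i = 0\<^sub>v n $ i" using \<open>i < n\<close> by simp
qed (use assms in auto)

lemma scalar_prod_mult_mat_vec_transpose:
  assumes "A \<in> carrier_mat n m" "v \<in> carrier_vec n" "w \<in> carrier_vec m"
  shows "v \<bullet> (A *\<^sub>v w) = (transpose_mat A *\<^sub>v v) \<bullet> (w :: 'a :: comm_ring_1 vec)"
proof -
  have "v \<bullet> (A *\<^sub>v w) = (\<Sum>i<n. \<Sum>l<m. v $ i * (A $$ (i, l) * w $ l))"
    using assms by (subst scalar_prod_sum[of _ n]) (auto simp: mult_mat_vec_index sum_distrib_left simp del: index_mult_mat_vec)
  also have "\<dots> = (\<Sum>l<m. \<Sum>i<n. A $$ (i, l) * v $ i * w $ l)"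
    by (subst sum.swap) (simp add: mult_ac)
  also have "\<dots> = (transpose_mat A *\<^sub>v v) \<bullet> w"
    using assms by (subst scalar_prod_sum[of _ m]) 
      (auto simp: mult_mat_vec_index[of _ m n] sum_distrib_right simp del: index_mult_mat_vec intro!: sum.cong)
  finally show ?thesis .
qed

lemma symmetric_scalar_prod:
  assumes "A \<in> carrier_mat n n" "transpose_mat A = A" "v \<in> carrier_vec n" "w \<in> carrier_vec n"
  shows "v \<bullet> (A *\<^sub>v w) = w \<bullet> (A *\<^sub>v (v :: 'a :: comm_ring_1 vec))"
proof -
  have "v \<bullet> (A *\<^sub>v w) = (A *\<^sub>v v) \<bullet> w"
    using scalar_prod_mult_mat_vec_transpose[OF assms(1,3,4)] assms(2) by simp
  also have "\<dots> = w \<bullet> (A *\<^sub>v v)"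
    using assms by (intro comm_scalar_prod[of _ n]) auto
  finally show ?thesis .
qed

text \<open>A zero of a nonnegative quadratic form is a minimum, so moving from x in the direction
  -Ax cannot lower the form. The first-order change is -2t times the squared length of Ax, which
  must therefore vanish.\<close>

lemma pos_semidef_kernel:
  assumes A: "A \<in> carrier_mat n n" "pos_semidef A" and x: "x \<in> carrier_vec n"
    and 0: "x \<bullet> (A *\<^sub>v x) = 0"
  shows "A *\<^sub>v x = 0\<^sub>v n"
proof -
  define y where "y = A *\<^sub>v x"
  have y: "y \<in> carrier_vec n" using A x by (auto simp: y_def)
  have sym: "transpose_mat A = A" and psd: "\<And>v. v \<in> carrier_vec n \<Longrightarrow> 0 \<le> v \<bullet> (A *\<^sub>v v)"
    using A by (auto simp: pos_semidef_def)
  define c d where "c = y \<bullet> y" and "d = y \<bullet> (A *\<^sub>v y)"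
  have d: "d \<ge> 0" using psd[OF y] by (simp add: d_def)
  have c: "c \<ge> 0" by (simp add: c_def scalar_prod_self_nonneg)
  have xy: "x \<bullet> (A *\<^sub>v y) = c"
    using symmetric_scalar_prod[OF A(1) sym x y] by (simp add: c_def y_def)
  have quad: "0 \<le> - 2 * t * c + t * t * d" for t
  proof -
    have "0 \<le> (x - t \<cdot>\<^sub>v y) \<bullet> (A *\<^sub>v (x - t \<cdot>\<^sub>v y))"
      by (rule psd) (use x y in auto)
    also have "A *\<^sub>v (x - t \<cdot>\<^sub>v y) = y - t \<cdot>\<^sub>v (A *\<^sub>v y)"
      using A x y by (simp add: mult_minus_distrib_mat_vec mult_mat_vec y_def)
    also have "(x - t \<cdot>\<^sub>v y) \<bullet> (y - t \<cdot>\<^sub>v (A *\<^sub>v y)) = x \<bullet> y - t * (x \<bullet> (A *\<^sub>v y)) - t * (y \<bullet> y) + t * t * (y \<bullet> (A *\<^sub>v y))"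
      using A x y by (simp add: minus_scalar_prod_distrib[of _ n] scalar_prod_minus_distrib[of _ n] algebra_simps)
    also have "\<dots> = - 2 * t * c + t * t * d"
      using 0 xy by (simp add: y_def[symmetric] c_def d_def)
    finally show ?thesis .
  qed
  have "c \<le> 0"
  proof (rule ccontr)
    assume "\<not> c \<le> 0"
    \<comment> \<open>Any t strictly between 0 and 2c/d makes the quadratic negative; the 1 in the
      denominator covers d = 0.\<close>
    define t where "t = c / (d + 1)"
    have t: "t > 0" using \<open>\<not> c \<le> 0\<close> d by (auto simp: t_def)
    have "t * (d + 1) = c" using d by (simp add: t_def)
    then have "t * (t * (d+1)) = t * c" by simp
    with quad[of t] have "t * c + t * t \<le> 0" by (simp add: algebra_simps)
    moreover have "t * c > 0" "t * t > 0" using t \<open>\<not> c \<le> 0\<close> by auto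
    ultimately show False by linarith
  qed
  with c have "c = 0" by simp
  then show ?thesis using scalar_prod_self_eq_0[OF y] by (simp add: c_def y_def)
qed

lemma map_vec_Re_mult_mat_vec:
  assumes "A \<in> carrier_mat n n" "v \<in> carrier_vec n"
  shows "map_vec Re (map_mat of_real A *\<^sub>v v) = A *\<^sub>v map_vec Re v"
    "map_vec Im (map_mat of_real A *\<^sub>v v) = A *\<^sub>v map_vec Im v"
  using assms by (auto intro!: eq_vecI sum.cong simp: scalar_prod_def)

text \<open>Put w = Bv. Pairing w hermitianly with Aw = ABv = kv gives (form of A at w) = k (form of
  B at v). Both forms are real and nonnegative, so k is too unless the form of B vanishes at v; then
  Bv = 0 and kv = 0. Since \<open>pos_semidef\<close> speaks of real vectors, v and w are split into
  real and imaginary parts.\<close>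

lemma eigenvalue_mult_pos_semidef:
  assumes A: "A \<in> carrier_mat n n" "pos_semidef A" and B: "B \<in> carrier_mat n n" "pos_semidef B"
    and ev: "eigenvalue (map_mat complex_of_real (A * B)) k"
  shows "Im k = 0 \<and> 0 \<le> Re k"
proof -
  obtain v where v: "v \<in> carrier_vec n" "v \<noteq> 0\<^sub>v n"
    and eq: "map_mat complex_of_real (A * B) *\<^sub>v v = k \<cdot>\<^sub>v v"
    using ev A B by (auto simp: eigenvalue_def eigenvector_def)
  have symA: "transpose_mat A = A" and psdA: "\<And>v. v \<in> carrier_vec n \<Longrightarrow> 0 \<le> v \<bullet> (A *\<^sub>v v)"
    using A by (auto simp: pos_semidef_def)
  have symB: "transpose_mat B = B" and psdB: "\<And>v. v \<in> carrier_vec n \<Longrightarrow> 0 \<le> v \<bullet> (B *\<^sub>v v)"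
    using B by (auto simp: pos_semidef_def)
  define a b where "a = map_vec Re v" and "b = map_vec Im v"
  have a: "a \<in> carrier_vec n" and b: "b \<in> carrier_vec n" using v by (auto simp: a_def b_def)
  define w1 w2 where "w1 = B *\<^sub>v a" and "w2 = B *\<^sub>v b"
  have w1: "w1 \<in> carrier_vec n" and w2: "w2 \<in> carrier_vec n" using a b B by (auto simp: w1_def w2_def)
  have AB: "A * B \<in> carrier_mat n n" using A B by auto
  have "A *\<^sub>v w1 = (A * B) *\<^sub>v a" using A B a by (simp add: w1_def assoc_mult_mat_vec)
  also have "\<dots> = map_vec Re (k \<cdot>\<^sub>v v)"
    using map_vec_Re_mult_mat_vec(1)[OF AB v(1)] eq by (simp add: a_def)
  also have "\<dots> = Re k \<cdot>\<^sub>v a - Im k \<cdot>\<^sub>v b"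
    using v by (auto intro!: eq_vecI simp: a_def b_def)
  finally have Aw1: "A *\<^sub>v w1 = Re k \<cdot>\<^sub>v a - Im k \<cdot>\<^sub>v b" .
  have "A *\<^sub>v w2 = (A * B) *\<^sub>v b" using A B b by (simp add: w2_def assoc_mult_mat_vec)
  also have "\<dots> = map_vec Im (k \<cdot>\<^sub>v v)"
    using map_vec_Re_mult_mat_vec(2)[OF AB v(1)] eq by (simp add: b_def)
  also have "\<dots> = Re k \<cdot>\<^sub>v b + Im k \<cdot>\<^sub>v a"
    using v by (auto intro!: eq_vecI simp: a_def b_def)
  finally have Aw2: "A *\<^sub>v w2 = Re k \<cdot>\<^sub>v b + Im k \<cdot>\<^sub>v a" .
  define V where "V = a \<bullet> w1 + b \<bullet> w2"
  have comm: "w1 \<bullet> a = a \<bullet> w1" "w2 \<bullet> b = b \<bullet> w2" "w1 \<bullet> b = b \<bullet> w1" "w2 \<bullet> a = a \<bullet> w2"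
    using a b w1 w2 by (auto intro!: comm_scalar_prod[of _ n])
  have ab: "a \<bullet> w2 = b \<bullet> w1"
    using symmetric_scalar_prod[OF B(1) symB a b] by (simp add: w1_def w2_def)
  \<comment> \<open>\<open>V\<close> is the hermitian form of B at v. This fact and the next are the
    real and imaginary parts of the identity between the two forms.\<close>
  have 1: "w1 \<bullet> (A *\<^sub>v w1) + w2 \<bullet> (A *\<^sub>v w2) = Re k * V"
    using a b w1 w2 comm ab
    by (simp add: Aw1 Aw2 scalar_prod_minus_distrib[of _ n] scalar_prod_add_distrib[of _ n] V_def algebra_simps)
  have 2: "Im k * V = 0"
    using symmetric_scalar_prod[OF A(1) symA w1 w2] a b w1 w2 comm ab
    by (simp add: Aw1 Aw2 scalar_prod_minus_distrib[of _ n] scalar_prod_add_distrib[of _ n] V_def algebra_simps)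
  have V0: "a \<bullet> w1 \<ge> 0" "b \<bullet> w2 \<ge> 0" using psdB a b by (auto simp: w1_def w2_def)
  show ?thesis
  proof (cases "V = 0")
    \<comment> \<open>The form of B then vanishes at both parts of v, so the kernel lemma gives Bv =
      0.\<close>
    case True
    then have "a \<bullet> w1 = 0" "b \<bullet> w2 = 0" using V0 by (auto simp: V_def)
    then have w0: "w1 = 0\<^sub>v n" "w2 = 0\<^sub>v n"
      using pos_semidef_kernel[OF B a] pos_semidef_kernel[OF B b] by (auto simp: w1_def w2_def)
    have A0: "A *\<^sub>v 0\<^sub>v n = 0\<^sub>v n" using A by (auto intro!: eq_vecI)
    have "k \<cdot>\<^sub>v v = 0\<^sub>v n"
    proof (rule eq_vecI)
      fix i assume "i < dim_vec (0\<^sub>v n :: complex vec)"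
      then have i: "i < n" by simp
      have "(Re k \<cdot>\<^sub>v a - Im k \<cdot>\<^sub>v b) $ i = 0" "(Re k \<cdot>\<^sub>v b + Im k \<cdot>\<^sub>v a) $ i = 0"
        using Aw1 Aw2 w0 A0 i by (metis index_zero_vec(1))+
      then show "(k \<cdot>\<^sub>v v) $ i = 0\<^sub>v n $ i"
        using i v by (auto simp: a_def b_def complex_eq_iff)
    qed (use v in auto)
    have "\<exists>i<n. v $ i \<noteq> 0" 
    proof (rule ccontr)
      assume "\<not> (\<exists>i<n. v $ i \<noteq> 0)"
      then have "v = 0\<^sub>v n" using v by (auto intro!: eq_vecI)
      with v show False by simp
    qed
    then obtain i where "i < n" "v $ i \<noteq> 0" by blast
    moreover have "(k \<cdot>\<^sub>v v) $ i = 0" using \<open>k \<cdot>\<^sub>v v = 0\<^sub>v n\<close> \<open>i < n\<close> by simp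
    ultimately have "k = 0" using v by auto
    then show ?thesis by simp
  next
    case False
    then have "V > 0" using V0 by (auto simp: V_def)
    moreover have "Re k * V \<ge> 0" using psdA[OF w1] psdA[OF w2] 1 by simp
    ultimately show ?thesis using 2 by (auto simp: zero_le_mult_iff)
  qed
qed

text \<open>The Weierstrass product inequality. In the induction the new factor removes t x times
  the old product, which is at most t x because the old product is at most 1.\<close>

lemma prod_one_minus_ge:
  fixes t :: "'b \<Rightarrow> real"
  assumes "finite I" "\<And>i. i \<in> I \<Longrightarrow> 0 \<le> t i" "\<And>i. i \<in> I \<Longrightarrow> t i \<le> 1"
  shows "1 - (\<Sum>i\<in>I. t i) \<le> (\<Prod>i\<in>I. 1 - t i)"
  using assms
proof (induction I rule: finite_induct)
  case (insert x F)
  have "(\<Prod>i\<in>F. 1 - t i) \<le> 1" using insert by (intro prod_le_1) auto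
  then have "t x * (\<Prod>i\<in>F. 1 - t i) \<le> t x * 1" using insert by (intro mult_left_mono) auto
  moreover have "1 - (\<Sum>i\<in>F. t i) \<le> (\<Prod>i\<in>F. 1 - t i)" using insert by auto
  ultimately show ?case using insert(1,2) by (simp add: algebra_simps)
qed auto

text \<open>The eigenvalues of a product of two positive semidefinite matrices are nonnegative reals
  although the product need not be symmetric.\<close>

lemma det_one_minus_mult_ge:
  assumes A: "A \<in> carrier_mat n n" "pos_semidef A" and B: "B \<in> carrier_mat n n" "pos_semidef B"
    and tr: "mat_trace (A * B) \<le> 1"
  shows "1 - mat_trace (A * B) \<le> det (1\<^sub>m n - A * B)"
proof -
  define C where "C = map_mat complex_of_real (A * B)"
  have AB: "A * B \<in> carrier_mat n n" using A B by auto
  have C: "C \<in> carrier_mat n n" using AB by (auto simp: C_def)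
  obtain as where as: "char_poly C = (\<Prod>a\<leftarrow>as. [:- a, 1:])"
    using char_poly_factorized[OF C] by auto
  \<comment> \<open>AB need not be symmetric, so it is triangularised over the complex numbers. A
    triangular form suffices: trace and characteristic polynomial are read off its diagonal.\<close>
  obtain T where T: "T \<in> carrier_mat n n" "upper_triangular T" "similar_mat C T"
    using schur_decomposition_exists[OF C as] by auto
  have cp: "char_poly C = (\<Prod>a\<leftarrow>diag_mat T. [:- a, 1:])"
    using char_poly_similar[OF T(3)] char_poly_upper_triangular[OF T(1,2)] by simp
  define t where "t i = Re (T $$ (i, i))" for i
  have ev: "T $$ (i, i) = complex_of_real (t i) \<and> 0 \<le> t i" if "i < n" for i
  proof -
    have "T $$ (i, i) \<in> set (diag_mat T)" using that T by (auto simp: diag_mat_def)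
    then have "poly (char_poly C) (T $$ (i, i)) = 0"
      unfolding cp poly_prod_list by (auto simp: prod_list_zero_iff image_iff intro!: bexI[of _ "T $$ (i, i)"])
    then have "eigenvalue C (T $$ (i, i))" using eigenvalue_root_char_poly[OF C] by simp
    from eigenvalue_mult_pos_semidef[OF A B this[unfolded C_def]] show ?thesis
      by (auto simp: t_def complex_eq_iff)
  qed
  have "complex_of_real (det (1\<^sub>m n - A * B)) = det (map_mat complex_of_real (1\<^sub>m n - A * B))"
    by (simp add: of_real_hom.hom_det)
  \<comment> \<open>\<open>char_matrix C 1\<close> is C - I, whence the sign: the determinant of I -
    C is the characteristic polynomial at 1.\<close>
  also have "map_mat complex_of_real (1\<^sub>m n - A * B) = - char_matrix C 1"
  proof (rule eq_matI)
    fix i j assume "i < dim_row (- char_matrix C 1)" "j < dim_col (- char_matrix C 1)"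
    then have "i < n" "j < n" using C by (auto simp: char_matrix_def)
    then show "map_mat complex_of_real (1\<^sub>m n - A * B) $$ (i, j) = (- char_matrix C 1) $$ (i, j)"
      using carrier_matD[OF A(1)] carrier_matD[OF B(1)] by (simp add: char_matrix_def C_def del: index_mult_mat(1))
  qed (use AB C in \<open>auto simp: char_matrix_def\<close>)
  also have "det (- char_matrix C 1) = poly (char_poly C) 1"
    using char_poly_matrix[OF C, of 1] by simp
  also have "\<dots> = (\<Prod>a\<leftarrow>diag_mat T. 1 - a)"
    unfolding cp by (simp add: poly_prod_list o_def)
  also have "\<dots> = (\<Prod>i<n. 1 - T $$ (i, i))"
    using T by (simp add: diag_mat_def o_def prod.list_conv_set_nth lessThan_atLeast0)
  also have "\<dots> = (\<Prod>i<n. complex_of_real (1 - t i))" using ev by (intro prod.cong) auto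
  also have "\<dots> = complex_of_real (\<Prod>i<n. 1 - t i)" by simp
  finally have det: "det (1\<^sub>m n - A * B) = (\<Prod>i<n. 1 - t i)" using of_real_eq_iff by blast
  obtain P Q where PQ: "P \<in> carrier_mat n n" "Q \<in> carrier_mat n n" "Q * P = 1\<^sub>m n" "C = P * T * Q"
  proof -
    obtain m P Q where *: "{C, T, P, Q} \<subseteq> carrier_mat m m" "Q * P = 1\<^sub>m m" "C = P * T * Q"
      using similar_matD[OF T(3)] by auto
    then have "m = n" using C by auto
    with * show ?thesis using that by auto
  qed
  have "mat_trace C = mat_trace (Q * (P * T))"
    unfolding PQ(4) using PQ T by (intro mat_trace_mult_commute[of _ n n]) auto
  also have "Q * (P * T) = T" using PQ T by (simp flip: assoc_mult_mat[of Q n n P n T n])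
  also have "mat_trace T = complex_of_real (\<Sum>i<n. t i)" using T ev by (simp add: mat_trace_def)
  also have "mat_trace C = complex_of_real (mat_trace (A * B))"
    using carrier_matD[OF A(1)] carrier_matD[OF B(1)] by (simp add: mat_trace_def C_def del: index_mult_mat(1))
  finally have trace: "mat_trace (A * B) = (\<Sum>i<n. t i)" using of_real_eq_iff by blast
  \<comment> \<open>The trace hypothesis enters here: nonnegative eigenvalues are each bounded by
    their sum.\<close>
  have "t i \<le> 1" if "i < n" for i
  proof -
    have "t i \<le> (\<Sum>i<n. t i)" using that ev by (intro member_le_sum) auto
    then show ?thesis using tr trace by simp
  qed
  then show ?thesis unfolding det trace using ev by (intro prod_one_minus_ge) auto
qed

section \<open>Gaussian integrals by successive elimination of coordinates\<close>

definition pos_def :: "real mat \<Rightarrow> bool" where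
  "pos_def A \<longleftrightarrow> square_mat A \<and> transpose_mat A = A \<and>
     (\<forall>v\<in>carrier_vec (dim_row A). v \<noteq> 0\<^sub>v (dim_row A) \<longrightarrow> 0 < v \<bullet> (A *\<^sub>v v))"

lemma quadratic_form_sum:
  assumes "A \<in> carrier_mat n n" "v \<in> carrier_vec n"
  shows "v \<bullet> (A *\<^sub>v v) = (\<Sum>i<n. \<Sum>j<n. A $$ (i, j) * v $ i * (v $ j :: real))"
  using assms by (subst scalar_prod_sum[of _ n])
    (auto simp: mult_mat_vec_index sum_distrib_left mult_ac simp del: index_mult_mat_vec)

text \<open>The pivot is the last index, to match an induction on the dimension that integrates out
  the last coordinate first.\<close>

definition schur_complement :: "nat \<Rightarrow> real mat \<Rightarrow> real mat" where
  "schur_complement m B = mat m m (\<lambda>(i, j). B $$ (i, j) - B $$ (i, m) * B $$ (m, j) / B $$ (m, m))"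

lemma schur_complement_carrier [simp]: "schur_complement m B \<in> carrier_mat m m"
  by (simp add: schur_complement_def)

text \<open>Block elimination: B is a block upper triangular matrix with diagonal blocks the Schur
  complement and the pivot, times a unit lower triangular one.\<close>

lemma det_schur_complement:
  assumes B: "B \<in> carrier_mat (Suc m) (Suc m)" and b: "B $$ (m, m) \<noteq> 0"
  shows "det B = B $$ (m, m) * det (schur_complement m B)"
proof -
  define b where "b = B $$ (m, m)"
  define c where "c = mat m 1 (\<lambda>(i, j). B $$ (i, m))"
  define d where "d = mat 1 m (\<lambda>(i, j). B $$ (m, j) / b)"
  define b' where "b' = mat 1 1 (\<lambda>(i, j). b)"
  define U where "U = four_block_mat (schur_complement m B) c (0\<^sub>m 1 m) b'"
  define L where "L = four_block_mat (1\<^sub>m m) (0\<^sub>m m 1) d (1\<^sub>m 1)"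
  have carr: "c \<in> carrier_mat m 1" "d \<in> carrier_mat 1 m" "b' \<in> carrier_mat 1 1"
    by (auto simp: c_def d_def b'_def)
  have "U * L = four_block_mat (schur_complement m B + c * d) c (b' * d) b'"
    unfolding U_def L_def
    by (subst mult_four_block_mat[of _ m m _ 1 _ 1 _ _ m _ 1])
      (use carr right_mult_one_mat[OF schur_complement_carrier[of m B]] right_mult_zero_mat[OF schur_complement_carrier[of m B]] in \<open>auto simp: left_add_zero_mat[of _ m]\<close>)
  also have "\<dots> = B"
  proof (rule eq_matI)
    fix i j assume "i < dim_row B" "j < dim_col B"
    then have "i < Suc m" "j < Suc m" using B by auto
    then show "four_block_mat (schur_complement m B + c * d) c (b' * d) b' $$ (i, j) = B $$ (i, j)"
      using b by (auto simp: schur_complement_def c_def d_def b'_def scalar_prod_def b_def less_Suc_eq)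
  qed (use B carr in \<open>auto simp: schur_complement_def\<close>)
  finally have "B = U * L" by simp
  moreover have "U \<in> carrier_mat (Suc m) (Suc m)" "L \<in> carrier_mat (Suc m) (Suc m)"
    using carr by (auto simp: U_def L_def schur_complement_def)
  ultimately have "det B = det U * det L" by (simp add: det_mult)
  also have "det U = det (schur_complement m B) * det b'"
    unfolding U_def by (rule det_four_block_mat_lower_left_zero) (use carr in auto)
  also have "det L = det (1\<^sub>m m :: real mat) * det (1\<^sub>m 1 :: real mat)"
    unfolding L_def by (rule det_four_block_mat_upper_right_zero) (use carr in auto)
  also have "det b' = b" using carr by (simp add: b'_def det_single)
  finally show ?thesis by (simp add: b_def)
qed

text \<open>Completing the square in the last coordinate; the remainder is the form of the Schur
  complement.\<close>

lemma quadratic_form_schur_complement: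
  assumes B: "B \<in> carrier_mat (Suc m) (Suc m)" "transpose_mat B = B" and b: "B $$ (m, m) \<noteq> 0"
  shows "(\<Sum>i<Suc m. \<Sum>j<Suc m. B $$ (i, j) * (x(m := t)) i * (x(m := t)) j)
    = (\<Sum>i<m. \<Sum>j<m. schur_complement m B $$ (i, j) * x i * x j)
      + B $$ (m, m) * (t + (\<Sum>j<m. B $$ (m, j) * x j) / B $$ (m, m))\<^sup>2"
proof -
  define b s where "b = B $$ (m, m)" and "s = (\<Sum>j<m. B $$ (m, j) * x j)"
  have sym: "B $$ (i, m) = B $$ (m, i)" if "i < m" for i
    using that B by (metis carrier_matD index_transpose_mat(1) less_SucI lessI)
  have "(\<Sum>i<m. \<Sum>j<m. schur_complement m B $$ (i, j) * x i * x j)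
    = (\<Sum>i<m. \<Sum>j<m. B $$ (i, j) * x i * x j - (B $$ (m, i) * x i) * (B $$ (m, j) * x j) / b)"
    by (intro sum.cong refl) (auto simp: schur_complement_def sym b_def algebra_simps)
  also have "\<dots> = (\<Sum>i<m. \<Sum>j<m. B $$ (i, j) * x i * x j) - s * s / b"
    by (simp add: sum_subtractf s_def sum_product sum_divide_distrib)
  finally have 1: "(\<Sum>i<m. \<Sum>j<m. schur_complement m B $$ (i, j) * x i * x j) =
     (\<Sum>i<m. \<Sum>j<m. B $$ (i, j) * x i * x j) - s * s / b" .
  have "(\<Sum>i<Suc m. \<Sum>j<Suc m. B $$ (i, j) * (x(m := t)) i * (x(m := t)) j)
    = (\<Sum>i<m. (\<Sum>j<m. B $$ (i, j) * x i * x j) + B $$ (m, i) * x i * t) + (\<Sum>j<m. B $$ (m, j) * t * x j) + b * t * t"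
    by (simp add: sym b_def)
  also have "\<dots> = (\<Sum>i<m. \<Sum>j<m. B $$ (i, j) * x i * x j) + 2 * s * t + b * t * t"
  proof -
    have "(\<Sum>i<m. B $$ (m, i) * x i * t) = s * t" by (simp add: s_def sum_distrib_right)
    moreover have "(\<Sum>j<m. B $$ (m, j) * t * x j) = s * t"
      unfolding s_def sum_distrib_right by (intro sum.cong) auto
    ultimately show ?thesis by (simp add: sum.distrib)
  qed
  finally have 2: "(\<Sum>i<Suc m. \<Sum>j<Suc m. B $$ (i, j) * (x(m := t)) i * (x(m := t)) j) =
      (\<Sum>i<m. \<Sum>j<m. B $$ (i, j) * x i * x j) + 2 * s * t + b * t * t" .
  have 3: "b * (t + s / b)\<^sup>2 = 2 * s * t + b * t * t + s * s / b"
    using b unfolding b_def[symmetric] by (simp add: field_simps power2_eq_square)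
  show ?thesis
    unfolding 1 2 unfolding b_def[symmetric] s_def[symmetric] 3 by simp
qed

text \<open>The integrand is a multiple of the normal density with mean -\<mu> and variance
  1/b.\<close>

lemma nn_integral_exp_quadratic:
  fixes b \<mu> :: real
  assumes "b > 0"
  shows "(\<integral>\<^sup>+t. ennreal (exp (- (b * (t + \<mu>)\<^sup>2) / 2)) \<partial>lborel) = ennreal (sqrt (2 * pi / b))"
proof -
  define \<sigma> where "\<sigma> = 1 / sqrt b"
  have \<sigma>: "\<sigma> > 0" "\<sigma>\<^sup>2 = 1 / b" using assms by (auto simp: \<sigma>_def power_divide)
  have eq: "exp (- (b * (t + \<mu>)\<^sup>2) / 2) = sqrt (2 * pi / b) * normal_density (- \<mu>) \<sigma> t" for t
    using assms by (simp add: normal_density_def \<sigma> field_simps)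
  have "(\<integral>\<^sup>+t. ennreal (exp (- (b * (t + \<mu>)\<^sup>2) / 2)) \<partial>lborel)
      = (\<integral>\<^sup>+t. ennreal (sqrt (2 * pi / b)) * ennreal (normal_density (- \<mu>) \<sigma> t) \<partial>lborel)"
    unfolding eq using assms by (simp add: ennreal_mult)
  also have "\<dots> = ennreal (sqrt (2 * pi / b)) * (\<integral>\<^sup>+t. ennreal (normal_density (- \<mu>) \<sigma> t) \<partial>lborel)"
    by (rule nn_integral_cmult) auto
  also have "(\<integral>\<^sup>+t. ennreal (normal_density (- \<mu>) \<sigma> t) \<partial>lborel) = 1"
    using \<sigma> by (subst nn_integral_eq_integral) (auto simp: integrable_normal_density integral_normal_density)
  finally show ?thesis by simp
qed

lemma pos_def_schur_complement:
  assumes B: "B \<in> carrier_mat (Suc m) (Suc m)" "pos_def B"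
  shows "0 < B $$ (m, m)" "pos_def (schur_complement m B)"
proof -
  have sym: "transpose_mat B = B"
    and pd: "\<And>v. v \<in> carrier_vec (Suc m) \<Longrightarrow> v \<noteq> 0\<^sub>v (Suc m) \<Longrightarrow> 0 < v \<bullet> (B *\<^sub>v v)"
    using B by (auto simp: pos_def_def)
  have sym': "B $$ (i, j) = B $$ (j, i)" if "i < Suc m" "j < Suc m" for i j
    using that B sym by (metis carrier_matD index_transpose_mat(1))
  have pd': "0 < (\<Sum>i<Suc m. \<Sum>j<Suc m. B $$ (i, j) * x i * x j)" if "i < Suc m" "x i \<noteq> 0" for x i
  proof -
    have "vec (Suc m) x $ i \<noteq> 0\<^sub>v (Suc m) $ i" using that by simp
    then have "vec (Suc m) x \<noteq> 0\<^sub>v (Suc m)" by metis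
    then have "0 < vec (Suc m) x \<bullet> (B *\<^sub>v vec (Suc m) x)" by (intro pd) simp_all
    also have "\<dots> = (\<Sum>i<Suc m. \<Sum>j<Suc m. B $$ (i, j) * vec (Suc m) x $ i * vec (Suc m) x $ j)"
      by (rule quadratic_form_sum[OF B(1)]) simp
    also have "\<dots> = (\<Sum>i<Suc m. \<Sum>j<Suc m. B $$ (i, j) * x i * x j)"
      by (intro sum.cong refl) simp
    finally show ?thesis .
  qed
  have "0 < (\<Sum>i<Suc m. \<Sum>j<Suc m. B $$ (i, j) * (if i = m then 1 else 0) * (if j = m then 1 else 0))"
    by (rule pd'[of m]) auto
  then show b: "0 < B $$ (m, m)" by (simp add: if_distrib cong: if_cong)
  have "0 < v \<bullet> (schur_complement m B *\<^sub>v v)" if v: "v \<in> carrier_vec m" "v \<noteq> 0\<^sub>v m" for v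
  proof -
    obtain i where i: "i < m" "v $ i \<noteq> 0"
    proof (rule ccontr)
      assume "\<not> thesis"
      then have "v = 0\<^sub>v m" using v that by (intro eq_vecI) auto
      with v show False by simp
    qed
    \<comment> \<open>Extending v by -s makes the completed square vanish, so the Schur complement
      inherits its values from B at nonzero vectors.\<close>
    define s where "s = (\<Sum>j<m. B $$ (m, j) * v $ j) / B $$ (m, m)"
    have "0 < (\<Sum>i<Suc m. \<Sum>j<Suc m. B $$ (i, j) * ((\<lambda>i. v $ i)(m := - s)) i * ((\<lambda>i. v $ i)(m := - s)) j)"
      by (rule pd'[of i]) (use i in auto)
    also have "\<dots> = (\<Sum>i<m. \<Sum>j<m. schur_complement m B $$ (i, j) * v $ i * v $ j)"
      by (subst quadratic_form_schur_complement[OF B(1) sym]) (use b in \<open>auto simp: s_def\<close>)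
    also have "\<dots> = v \<bullet> (schur_complement m B *\<^sub>v v)"
      by (rule quadratic_form_sum[symmetric]) (use v in auto)
    finally show ?thesis .
  qed
  moreover have "transpose_mat (schur_complement m B) = schur_complement m B"
  proof (rule eq_matI)
    fix i j assume "i < dim_row (schur_complement m B)" "j < dim_col (schur_complement m B)"
    then have "i < m" "j < m" by (auto simp: schur_complement_def)
    moreover have "B $$ (i, j) = B $$ (j, i)" "B $$ (i, m) = B $$ (m, i)" "B $$ (m, j) = B $$ (j, m)"
      using \<open>i < m\<close> \<open>j < m\<close> by (auto intro: sym')
    ultimately show "transpose_mat (schur_complement m B) $$ (i, j) = schur_complement m B $$ (i, j)"
      by (simp add: schur_complement_def)
  qed (auto simp: schur_complement_def)
  moreover have "square_mat (schur_complement m B)" by (simp add: schur_complement_def)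
  ultimately show "pos_def (schur_complement m B)"
    by (auto simp: pos_def_def schur_complement_def)
qed

text \<open>After completing the square, the inner integral over the last coordinate has the value
  sqrt (2 pi / b) whatever the other coordinates are, and the Schur complement remains. Both
  conclusions go through one induction, because combining the square roots requires the smaller
  determinant to be positive. The first conclusion is also the source of every later statement that
  a positive definite matrix is invertible.\<close>

proposition gaussian_integral:
  assumes "B \<in> carrier_mat m m" "pos_def B"
  shows "0 < det B"
    and "(\<integral>\<^sup>+x. ennreal (exp (- (\<Sum>i<m. \<Sum>j<m. B $$ (i, j) * x i * x j) / 2)) \<partial>(\<Pi>\<^sub>M i\<in>{..<m}. lborel))
      = ennreal (sqrt ((2 * pi) ^ m / det B))"
proof -
  have "0 < det B \<and> (\<integral>\<^sup>+x. ennreal (exp (- (\<Sum>i<m. \<Sum>j<m. B $$ (i, j) * x i * x j) / 2)) \<partial>(\<Pi>\<^sub>M i\<in>{..<m}. lborel))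
      = ennreal (sqrt ((2 * pi) ^ m / det B))"
    using assms
  proof (induction m arbitrary: B)
    case 0
    then show ?case by (simp add: PiM_empty)
  next
    case (Suc m)
    define b C where "b = B $$ (m, m)" and "C = schur_complement m B"
    have b: "b > 0" and C: "pos_def C" "C \<in> carrier_mat m m"
      using pos_def_schur_complement[OF Suc.prems] by (auto simp: b_def C_def)
    have sym: "transpose_mat B = B" using Suc.prems by (auto simp: pos_def_def)
    have det: "det B = b * det C"
      using det_schur_complement[OF Suc.prems(1)] b by (simp add: b_def C_def)
    have IH: "0 < det C" "(\<integral>\<^sup>+x. ennreal (exp (- (\<Sum>i<m. \<Sum>j<m. C $$ (i, j) * x i * x j) / 2)) \<partial>(\<Pi>\<^sub>M i\<in>{..<m}. lborel))
      = ennreal (sqrt ((2 * pi) ^ m / det C))"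
      using Suc.IH[OF C(2,1)] by auto
    interpret product_sigma_finite "\<lambda>_::nat. lborel :: real measure" ..
    have "(\<integral>\<^sup>+x. ennreal (exp (- (\<Sum>i<Suc m. \<Sum>j<Suc m. B $$ (i, j) * x i * x j) / 2)) \<partial>(\<Pi>\<^sub>M i\<in>{..<Suc m}. lborel))
      = (\<integral>\<^sup>+x. \<integral>\<^sup>+t. ennreal (exp (- (\<Sum>i<Suc m. \<Sum>j<Suc m. B $$ (i, j) * (x(m := t)) i * (x(m := t)) j) / 2)) \<partial>lborel \<partial>(\<Pi>\<^sub>M i\<in>{..<m}. lborel))"
      unfolding lessThan_Suc by (rule product_nn_integral_insert) auto
    also have "\<dots> = (\<integral>\<^sup>+x. ennreal (exp (- (\<Sum>i<m. \<Sum>j<m. C $$ (i, j) * x i * x j) / 2)) * ennreal (sqrt (2 * pi / b)) \<partial>(\<Pi>\<^sub>M i\<in>{..<m}. lborel))"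
    proof (rule nn_integral_cong)
      fix x :: "nat \<Rightarrow> real"
      define q s where "q = (\<Sum>i<m. \<Sum>j<m. C $$ (i, j) * x i * x j)" and "s = (\<Sum>j<m. B $$ (m, j) * x j) / b"
      have "(\<integral>\<^sup>+t. ennreal (exp (- (\<Sum>i<Suc m. \<Sum>j<Suc m. B $$ (i, j) * (x(m := t)) i * (x(m := t)) j) / 2)) \<partial>lborel)
        = (\<integral>\<^sup>+t. ennreal (exp (- q / 2)) * ennreal (exp (- (b * (t + s)\<^sup>2) / 2)) \<partial>lborel)"
      proof (rule nn_integral_cong)
        fix t :: real
        have "(\<Sum>i<Suc m. \<Sum>j<Suc m. B $$ (i, j) * (x(m := t)) i * (x(m := t)) j) = q + b * (t + s)\<^sup>2"
          using quadratic_form_schur_complement[OF Suc.prems(1) sym] b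
          unfolding b_def C_def q_def s_def by simp
        then show "ennreal (exp (- (\<Sum>i<Suc m. \<Sum>j<Suc m. B $$ (i, j) * (x(m := t)) i * (x(m := t)) j) / 2))
          = ennreal (exp (- q / 2)) * ennreal (exp (- (b * (t + s)\<^sup>2) / 2))"
          by (simp only: ennreal_mult[symmetric] exp_add[symmetric] exp_ge_zero minus_add_distrib add_divide_distrib
            diff_conv_add_uminus[symmetric])
             (simp add: add_divide_distrib diff_divide_distrib)
      qed
      also have "\<dots> = ennreal (exp (- q / 2)) * ennreal (sqrt (2 * pi / b))"
        using nn_integral_exp_quadratic[OF b] by (simp add: nn_integral_cmult)
      finally show "(\<integral>\<^sup>+t. ennreal (exp (- (\<Sum>i<Suc m. \<Sum>j<Suc m. B $$ (i, j) * (x(m := t)) i * (x(m := t)) j) / 2)) \<partial>lborel)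
        = ennreal (exp (- (\<Sum>i<m. \<Sum>j<m. C $$ (i, j) * x i * x j) / 2)) * ennreal (sqrt (2 * pi / b))"
        by (simp add: q_def)
    qed
    also have "\<dots> = ennreal (sqrt ((2 * pi) ^ m / det C)) * ennreal (sqrt (2 * pi / b))"
      by (subst nn_integral_multc, simp, simp only: IH(2))
    also have "\<dots> = ennreal (sqrt ((2 * pi) ^ Suc m / det B))"
      using b IH by (simp add: det real_sqrt_mult[symmetric] ennreal_mult[symmetric] field_simps)
    finally show ?case using det b IH by simp
  qed
  then show "0 < det B" "(\<integral>\<^sup>+x. ennreal (exp (- (\<Sum>i<m. \<Sum>j<m. B $$ (i, j) * x i * x j) / 2)) \<partial>(\<Pi>\<^sub>M i\<in>{..<m}. lborel))
      = ennreal (sqrt ((2 * pi) ^ m / det B))" by auto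
qed

section \<open>The second-moment method\<close>

text \<open>Evaluating the kernel at an event is a parameter integral of a jointly measurable
  function, hence measurable in the parameter. The normalisation makes every member of the kernel a
  probability law.\<close>

lemma kernel_density_measurable:
  assumes "prob_space M" "prob_space N"
    and l: "(\<lambda>(q, x). l q x) \<in> borel_measurable (N \<Otimes>\<^sub>M M)"
    and norm: "\<And>q. q \<in> space N \<Longrightarrow> (\<integral>\<^sup>+x. l q x \<partial>M) = 1"
    and K: "\<And>q. q \<in> space N \<Longrightarrow> K q = density M (l q)"
  shows "K \<in> N \<rightarrow>\<^sub>M subprob_algebra M"
proof (rule measurable_subprob_algebra)
  interpret M: prob_space M by fact
  note l[measurable]
  fix q assume q: "q \<in> space N"
  have [measurable]: "l q \<in> borel_measurable M"
    using measurable_compose[OF measurable_Pair1'[OF q] l] by simp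
  have "prob_space (density M (l q))"
    by (rule prob_spaceI) (simp add: emeasure_density norm[OF q] cong: nn_integral_cong)
  then show "subprob_space (K q)" using K[OF q] by (simp add: prob_space_imp_subprob_space)
  show "sets (K q) = sets M" using K[OF q] by simp
next
  interpret M: prob_space M by fact
  note l[measurable]
  fix A assume A[measurable]: "A \<in> sets M"
  have "(\<lambda>q. \<integral>\<^sup>+x. l q x * indicator A x \<partial>M) \<in> borel_measurable N"
    by measurable
  also have "?this \<longleftrightarrow> (\<lambda>q. emeasure (K q) A) \<in> borel_measurable N"
  proof (rule measurable_cong)
    fix q assume q: "q \<in> space N"
    have [measurable]: "l q \<in> borel_measurable M"
      using measurable_compose[OF measurable_Pair1'[OF q] l] by simp
    show "(\<integral>\<^sup>+x. l q x * indicator A x \<partial>M) = emeasure (K q) A"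
      by (simp add: K[OF q] emeasure_density)
  qed
  finally show "(\<lambda>q. emeasure (K q) A) \<in> borel_measurable N" .
qed

text \<open>By Tonelli, the likelihood ratio of a mixture is the average of the likelihood ratios of
  its members.\<close>

lemma bind_density:
  assumes M: "prob_space M" and N: "prob_space N"
    and l: "(\<lambda>(q, x). l q x) \<in> borel_measurable (N \<Otimes>\<^sub>M M)"
    and norm: "\<And>q. q \<in> space N \<Longrightarrow> (\<integral>\<^sup>+x. l q x \<partial>M) = 1"
    and K: "\<And>q. q \<in> space N \<Longrightarrow> K q = density M (l q)"
  shows "N \<bind> K = density M (\<lambda>x. \<integral>\<^sup>+q. l q x \<partial>N)"
proof -
  interpret M: prob_space M by fact
  interpret N: prob_space N by fact
  interpret pair_sigma_finite N M ..
  have Km: "K \<in> N \<rightarrow>\<^sub>M subprob_algebra M"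
    by (rule kernel_density_measurable[OF assms])
  have ne: "space N \<noteq> {}" by (rule N.not_empty)
  note l[measurable]
  have [measurable]: "(\<lambda>(x, q). l q x) \<in> borel_measurable (M \<Otimes>\<^sub>M N)"
    by measurable
  show ?thesis
  proof (rule measure_eqI)
    show "sets (N \<bind> K) = sets (density M (\<lambda>x. \<integral>\<^sup>+q. l q x \<partial>N))"
      using sets_bind[OF sets_kernel[OF Km] ne] by simp
  next
    fix A assume "A \<in> sets (N \<bind> K)"
    then have A[measurable]: "A \<in> sets M" using sets_bind[OF sets_kernel[OF Km] ne] by simp
    have "emeasure (N \<bind> K) A = (\<integral>\<^sup>+q. emeasure (K q) A \<partial>N)"
      by (rule emeasure_bind[OF ne Km A])
    also have "\<dots> = (\<integral>\<^sup>+q. \<integral>\<^sup>+x. l q x * indicator A x \<partial>M \<partial>N)"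
    proof (rule nn_integral_cong)
      fix q assume q: "q \<in> space N"
      have [measurable]: "l q \<in> borel_measurable M"
        using measurable_compose[OF measurable_Pair1'[OF q] l] by simp
      show "emeasure (K q) A = (\<integral>\<^sup>+x. l q x * indicator A x \<partial>M)"
        by (simp add: K[OF q] emeasure_density)
    qed
    also have "\<dots> = (\<integral>\<^sup>+x. \<integral>\<^sup>+q. l q x * indicator A x \<partial>N \<partial>M)"
      by (rule Fubini'[symmetric]) measurable
    also have "\<dots> = (\<integral>\<^sup>+x. (\<integral>\<^sup>+q. l q x \<partial>N) * indicator A x \<partial>M)"
    proof (rule nn_integral_cong)
      fix x assume x: "x \<in> space M"
      have [measurable]: "(\<lambda>q. l q x) \<in> borel_measurable N"
        using measurable_compose[OF measurable_Pair2'[OF x] l] by simp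
      show "(\<integral>\<^sup>+q. l q x * indicator A x \<partial>N) = (\<integral>\<^sup>+q. l q x \<partial>N) * indicator A x"
        by (rule nn_integral_multc) measurable
    qed
    also have "\<dots> = emeasure (density M (\<lambda>x. \<integral>\<^sup>+q. l q x \<partial>N)) A"
      by (rule emeasure_density[symmetric]) measurable
    finally show "emeasure (N \<bind> K) A = emeasure (density M (\<lambda>x. \<integral>\<^sup>+q. l q x \<partial>N)) A" .
  qed
qed

text \<open>With g the likelihood ratio of the mixture, the deviation from 1 is the mean of \<phi>
  (1 - g), at most the mean of |g - 1|. Since g has mean 1, its variance is its second moment minus
  1, hence at most \<eta>^2. The bound does not depend on \<phi>.\<close>

lemma mixture_error_sum:
  fixes \<phi> :: "'x \<Rightarrow> real"
  assumes M: "prob_space M" and N: "prob_space N"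
    and l: "(\<lambda>(q, x). l q x) \<in> borel_measurable (N \<Otimes>\<^sub>M M)"
    and norm: "\<And>q. q \<in> space N \<Longrightarrow> (\<integral>\<^sup>+x. l q x \<partial>M) = 1"
    and K: "\<And>q. q \<in> space N \<Longrightarrow> K q = density M (l q)"
    and second: "(\<integral>\<^sup>+q. \<integral>\<^sup>+q'. \<integral>\<^sup>+x. l q x * l q' x \<partial>M \<partial>N \<partial>N) \<le> ennreal (1 + \<eta>\<^sup>2)"
    and \<eta>: "0 < \<eta>"
    and \<phi>: "\<phi> \<in> borel_measurable M" "\<And>x. 0 \<le> \<phi> x" "\<And>x. \<phi> x \<le> 1"
  shows "\<bar>(\<integral>x. \<phi> x \<partial>M) + (\<integral>x. 1 - \<phi> x \<partial>(N \<bind> K)) - 1\<bar> \<le> \<eta>"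
proof -
  interpret M: prob_space M by fact
  interpret N: prob_space N by fact
  interpret pair_sigma_finite N M ..
  interpret NN: pair_sigma_finite N N ..
  interpret MN: pair_sigma_finite M N ..
  note l[measurable] \<phi>(1)[measurable]
  have [measurable]: "(\<lambda>(x, q). l q x) \<in> borel_measurable (M \<Otimes>\<^sub>M N)"
    by measurable
  define L where "L x = (\<integral>\<^sup>+q. l q x \<partial>N)" for x
  have L[measurable]: "L \<in> borel_measurable M" unfolding L_def by measurable
  have bind: "N \<bind> K = density M L"
    unfolding L_def by (rule bind_density[OF assms(1-5)])
  have "(\<integral>\<^sup>+x. L x \<partial>M) = (\<integral>\<^sup>+q. \<integral>\<^sup>+x. l q x \<partial>M \<partial>N)"
    unfolding L_def by (rule Fubini') measurable
  also have "\<dots> = (\<integral>\<^sup>+q. 1 \<partial>N)" by (intro nn_integral_cong norm)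
  finally have L1: "(\<integral>\<^sup>+x. L x \<partial>M) = 1" by (simp add: N.emeasure_space_1)
  have "(\<integral>\<^sup>+x. L x * L x \<partial>M) = (\<integral>\<^sup>+x. \<integral>\<^sup>+q. \<integral>\<^sup>+q'. l q x * l q' x \<partial>N \<partial>N \<partial>M)"
  proof (rule nn_integral_cong)
    fix x assume x: "x \<in> space M"
    have [measurable]: "(\<lambda>q. l q x) \<in> borel_measurable N"
      using measurable_compose[OF measurable_Pair2'[OF x] l] by simp
    show "L x * L x = (\<integral>\<^sup>+q. \<integral>\<^sup>+q'. l q x * l q' x \<partial>N \<partial>N)"
      unfolding L_def by (simp add: nn_integral_cmult nn_integral_multc)
  qed
  also have "\<dots> = (\<integral>\<^sup>+q. \<integral>\<^sup>+x. \<integral>\<^sup>+q'. l q x * l q' x \<partial>N \<partial>M \<partial>N)"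
    by (rule Fubini') measurable
  also have "\<dots> = (\<integral>\<^sup>+q. \<integral>\<^sup>+q'. \<integral>\<^sup>+x. l q x * l q' x \<partial>M \<partial>N \<partial>N)"
  proof (rule nn_integral_cong)
    fix q assume q: "q \<in> space N"
    have [measurable]: "l q \<in> borel_measurable M"
      using measurable_compose[OF measurable_Pair1'[OF q] l] by simp
    show "(\<integral>\<^sup>+x. \<integral>\<^sup>+q'. l q x * l q' x \<partial>N \<partial>M) = (\<integral>\<^sup>+q'. \<integral>\<^sup>+x. l q x * l q' x \<partial>M \<partial>N)"
      by (rule Fubini') measurable
  qed
  finally have L2: "(\<integral>\<^sup>+x. L x * L x \<partial>M) \<le> ennreal (1 + \<eta>\<^sup>2)" using second by simp
  \<comment> \<open>L may be infinite on a null set; \<open>enn2real\<close> sends it to 0 there,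
    which changes no integral.\<close>
  define g where "g x = enn2real (L x)" for x
  have g[measurable]: "g \<in> borel_measurable M" unfolding g_def by measurable
  have g0: "0 \<le> g x" for x by (simp add: g_def)
  have "AE x in M. L x \<noteq> \<infinity>" by (rule nn_integral_PInf_AE) (use L1 in auto)
  then have Lg: "AE x in M. L x = ennreal (g x)"
    by eventually_elim (auto simp: g_def less_top)
  have dens: "N \<bind> K = density M (\<lambda>x. ennreal (g x))"
    unfolding bind by (rule density_cong) (use Lg in auto)
  have "(\<integral>\<^sup>+x. ennreal (g x) \<partial>M) = (\<integral>\<^sup>+x. L x \<partial>M)"
    by (rule nn_integral_cong_AE) (use Lg in auto)
  then have g1: "(\<integral>\<^sup>+x. ennreal (g x) \<partial>M) = ennreal 1" using L1 by simp
  have int_g: "integrable M g"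
    by (rule integrableI_nonneg) (use g1 g0 in auto)
  have eg: "(\<integral>x. g x \<partial>M) = 1"
    by (rule integral_eq_nn_integral[THEN trans]) (use g1 g0 in auto)
  have "(\<integral>\<^sup>+x. ennreal (g x * g x) \<partial>M) = (\<integral>\<^sup>+x. L x * L x \<partial>M)"
    by (rule nn_integral_cong_AE) (use Lg g0 in \<open>auto simp: ennreal_mult\<close>)
  then have g2: "(\<integral>\<^sup>+x. ennreal (g x * g x) \<partial>M) \<le> ennreal (1 + \<eta>\<^sup>2)" using L2 by simp
  have int_gg: "integrable M (\<lambda>x. g x * g x)"
    by (rule integrableI_nonneg) (use g2 g0 in \<open>auto intro: le_less_trans\<close>)
  have egg: "(\<integral>x. g x * g x \<partial>M) \<le> 1 + \<eta>\<^sup>2"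
    using g2 by (subst integral_eq_nn_integral) (auto intro!: enn2real_leI)
  have int_\<phi>: "integrable M \<phi>"
    by (rule M.integrable_const_bound[of _ 1]) (use \<phi> in auto)
  have int_\<phi>g: "integrable M (\<lambda>x. \<phi> x * g x)"
    by (rule Bochner_Integration.integrable_bound[OF int_g])
      (use \<phi> g0 in \<open>auto simp: abs_mult intro!: mult_left_le_one_le\<close>)
  have "(\<integral>x. 1 - \<phi> x \<partial>(N \<bind> K)) = (\<integral>x. g x - \<phi> x * g x \<partial>M)"
    unfolding dens by (subst integral_density) (use g0 in \<open>auto simp: algebra_simps\<close>)
  also have "\<dots> = 1 - (\<integral>x. \<phi> x * g x \<partial>M)"
    using int_g int_\<phi>g eg by simp
  finally have "(\<integral>x. \<phi> x \<partial>M) + (\<integral>x. 1 - \<phi> x \<partial>(N \<bind> K)) - 1 = (\<integral>x. \<phi> x - \<phi> x * g x \<partial>M)"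
    using int_\<phi> int_\<phi>g by simp
  also have "\<bar>\<dots>\<bar> \<le> (\<integral>x. \<bar>\<phi> x - \<phi> x * g x\<bar> \<partial>M)"
    by (rule integral_abs_bound)
  also have "\<dots> \<le> (\<integral>x. \<eta> / 2 + (g x * g x - 2 * g x + 1) / (2 * \<eta>) \<partial>M)"
  proof (rule integral_mono)
    fix x
    have "\<bar>\<phi> x - \<phi> x * g x\<bar> = \<phi> x * \<bar>g x - 1\<bar>"
    proof -
      have "\<phi> x - \<phi> x * g x = \<phi> x * (1 - g x)" by (simp add: algebra_simps)
      then show ?thesis using \<phi>(2)[of x] by (simp add: abs_mult abs_minus_commute)
    qed
    also have "\<dots> \<le> \<bar>g x - 1\<bar>" using \<phi>[of] by (intro mult_left_le_one_le) auto
    \<comment> \<open>A pointwise arithmetic-geometric mean inequality in place of Cauchy-Schwarz.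
      The weight \<eta> is the one for which both terms integrate to at most \<eta>/2.\<close>
    also have "\<dots> \<le> \<eta> / 2 + (g x * g x - 2 * g x + 1) / (2 * \<eta>)"
    proof -
      have "0 \<le> (\<eta> - \<bar>g x - 1\<bar>)\<^sup>2" by simp
      also have "\<dots> = \<eta> * \<eta> - 2 * \<eta> * \<bar>g x - 1\<bar> + (g x * g x - 2 * g x + 1)"
        by (simp add: power2_eq_square algebra_simps abs_if)
      finally show ?thesis using \<eta> by (simp add: field_simps)
    qed
    finally show "\<bar>\<phi> x - \<phi> x * g x\<bar> \<le> \<eta> / 2 + (g x * g x - 2 * g x + 1) / (2 * \<eta>)" .
  qed (use int_\<phi> int_\<phi>g int_g int_gg in auto)
  also have "\<dots> = \<eta> / 2 + ((\<integral>x. g x * g x \<partial>M) - 2 * (\<integral>x. g x \<partial>M) + 1) / (2 * \<eta>)"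
    using int_g int_gg by (simp add: M.prob_space)
  also have "\<dots> \<le> \<eta> / 2 + \<eta>\<^sup>2 / (2 * \<eta>)"
    using egg eg \<eta> by (intro add_left_mono divide_right_mono) auto
  also have "\<dots> = \<eta>" using \<eta> by (simp add: power2_eq_square)
  finally show ?thesis .
qed

text \<open>A finite product measure is determined by boxes, and the indicator of a box is a product
  of one-coordinate indicators, so the integral over a box factors.\<close>

lemma PiM_density:
  fixes M :: "'i \<Rightarrow> 'a measure"
  assumes I: "finite I" and M: "\<And>i. prob_space (M i)"
    and f: "\<And>i. i \<in> I \<Longrightarrow> f i \<in> borel_measurable (M i)"
    and norm: "\<And>i. i \<in> I \<Longrightarrow> (\<integral>\<^sup>+x. f i x \<partial>M i) = 1"
  shows "(\<Pi>\<^sub>M i\<in>I. density (M i) (f i)) = density (\<Pi>\<^sub>M i\<in>I. M i) (\<lambda>x. \<Prod>i\<in>I. f i (x i))"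
proof -
  \<comment> \<open>\<open>product_prob_space\<close> wants a probability measure at every index,
    also outside I; the constant density 1 supplies one there.\<close>
  define f' where "f' i = (if i \<in> I then f i else (\<lambda>_. 1))" for i
  have f'm: "f' i \<in> borel_measurable (M i)" for i using f by (auto simp: f'_def)
  have "prob_space (density (M i) (f' i))" for i
    by (rule prob_spaceI)
      (use f'm[of i] norm[of i] prob_space.emeasure_space_1[OF M[of i]] in 
        \<open>auto simp: emeasure_density f'_def cong: nn_integral_cong\<close>)
  then interpret D: product_prob_space "\<lambda>i. density (M i) (f' i)"
    by (intro product_prob_spaceI)
  interpret P: product_prob_space M using M by (intro product_prob_spaceI)
  have "(\<Pi>\<^sub>M i\<in>I. density (M i) (f i)) = (\<Pi>\<^sub>M i\<in>I. density (M i) (f' i))"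
    by (rule PiM_cong) (auto simp: f'_def)
  also have "\<dots> = density (\<Pi>\<^sub>M i\<in>I. M i) (\<lambda>x. \<Prod>i\<in>I. f i (x i))"
  proof (rule D.PiM_eqI[symmetric])
    show "finite I" by fact
    show "sets (density (\<Pi>\<^sub>M i\<in>I. M i) (\<lambda>x. \<Prod>i\<in>I. f i (x i))) = sets (\<Pi>\<^sub>M i\<in>I. density (M i) (f' i))"
      by (auto intro!: sets_PiM_cong)
    fix A assume A: "\<And>i. i \<in> I \<Longrightarrow> A i \<in> sets (density (M i) (f' i))"
    then have A': "\<And>i. i \<in> I \<Longrightarrow> A i \<in> sets (M i)" by simp
    have prod_m: "(\<lambda>x. \<Prod>i\<in>I. f i (x i)) \<in> borel_measurable (\<Pi>\<^sub>M i\<in>I. M i)"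
      using f by (intro borel_measurable_prod_ennreal measurable_compose[OF measurable_component_singleton]) auto
    have "emeasure (density (\<Pi>\<^sub>M i\<in>I. M i) (\<lambda>x. \<Prod>i\<in>I. f i (x i))) (Pi\<^sub>E I A)
      = (\<integral>\<^sup>+x. (\<Prod>i\<in>I. f i (x i)) * indicator (Pi\<^sub>E I A) x \<partial>(\<Pi>\<^sub>M i\<in>I. M i))"
      using prod_m I A' by (intro emeasure_density sets_PiM_I_finite) auto
    also have "\<dots> = (\<integral>\<^sup>+x. (\<Prod>i\<in>I. f i (x i) * indicator (A i) (x i)) \<partial>(\<Pi>\<^sub>M i\<in>I. M i))"
    proof (rule nn_integral_cong)
      fix x assume "x \<in> space (\<Pi>\<^sub>M i\<in>I. M i)"
      then have "indicator (Pi\<^sub>E I A) x = (\<Prod>i\<in>I. indicator (A i) (x i) :: ennreal)"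
        using I by (auto simp: indicator_def space_PiM PiE_iff prod_zero_iff if_distrib)
      then show "(\<Prod>i\<in>I. f i (x i)) * indicator (Pi\<^sub>E I A) x = (\<Prod>i\<in>I. f i (x i) * indicator (A i) (x i))"
        by (simp add: prod.distrib)
    qed
    also have "\<dots> = (\<Prod>i\<in>I. \<integral>\<^sup>+x. f i x * indicator (A i) x \<partial>M i)"
      using I f A' by (intro P.product_nn_integral_prod) auto
    also have "\<dots> = (\<Prod>i\<in>I. emeasure (density (M i) (f' i)) (A i))"
      using f A' by (intro prod.cong) (auto simp: emeasure_density f'_def)
    finally show "emeasure (density (\<Pi>\<^sub>M i\<in>I. M i) (\<lambda>x. \<Prod>i\<in>I. f i (x i))) (Pi\<^sub>E I A)
      = (\<Prod>i\<in>I. emeasure (density (M i) (f' i)) (A i))" .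
  qed
  finally show ?thesis .
qed

section \<open>Normal laws on column vectors\<close>

lemma space_borel_vec [simp]: "space (borel_vec p) = carrier_vec p"
  by (simp add: borel_vec_def)

lemma space_borel_mat [simp]: "space (borel_mat p r) = carrier_mat p r"
  by (simp add: borel_mat_def)

lemma measurable_vec_nth [measurable (raw)]:
  assumes "f \<in> M \<rightarrow>\<^sub>M borel_vec p" "i < p"
  shows "(\<lambda>w. f w $ i) \<in> borel_measurable M"
proof -
  have "(\<lambda>v. \<lambda>i\<in>{..<p}. v $ i) \<in> borel_vec p \<rightarrow>\<^sub>M (\<Pi>\<^sub>M i\<in>{..<p}. borel :: real measure)"
    unfolding borel_vec_def by (rule measurable_vimage_algebra1) (auto simp: space_PiM)
  from measurable_compose[OF this measurable_component_singleton[of i "{..<p}"]] assms(2)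
  have "(\<lambda>v. v $ i) \<in> borel_measurable (borel_vec p)" by simp
  from measurable_compose[OF assms(1) this] show ?thesis .
qed

lemma measurable_mat_index [measurable (raw)]:
  assumes "f \<in> M \<rightarrow>\<^sub>M borel_mat p r" "i < p" "j < r"
  shows "(\<lambda>w. f w $$ (i, j)) \<in> borel_measurable M"
proof -
  have "(\<lambda>A. \<lambda>ij\<in>{..<p} \<times> {..<r}. A $$ ij) \<in> borel_mat p r \<rightarrow>\<^sub>M (\<Pi>\<^sub>M ij\<in>{..<p} \<times> {..<r}. borel :: real measure)"
    unfolding borel_mat_def by (rule measurable_vimage_algebra1) (auto simp: space_PiM)
  from measurable_compose[OF this measurable_component_singleton[of "(i, j)" "{..<p} \<times> {..<r}"]] assms(2,3)
  have "(\<lambda>v. v $$ (i, j)) \<in> borel_measurable (borel_mat p r)" by simp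
  from measurable_compose[OF assms(1) this] show ?thesis .
qed

lemma measurable_borel_vecI:
  assumes "\<And>w. w \<in> space M \<Longrightarrow> f w \<in> carrier_vec p"
    and "\<And>i. i < p \<Longrightarrow> (\<lambda>w. f w $ i) \<in> borel_measurable M"
  shows "f \<in> M \<rightarrow>\<^sub>M borel_vec p"
  unfolding borel_vec_def
  by (rule measurable_vimage_algebra2) (use assms in \<open>auto intro!: measurable_restrict\<close>)

lemma measurable_borel_matI:
  assumes "\<And>w. w \<in> space M \<Longrightarrow> f w \<in> carrier_mat p r"
    and "\<And>i j. i < p \<Longrightarrow> j < r \<Longrightarrow> (\<lambda>w. f w $$ (i, j)) \<in> borel_measurable M"
  shows "f \<in> M \<rightarrow>\<^sub>M borel_mat p r"
  unfolding borel_mat_def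
  by (rule measurable_vimage_algebra2) (use assms in \<open>auto intro!: measurable_restrict\<close>)

lemma measurable_borel_vec_carrier:
  "f \<in> M \<rightarrow>\<^sub>M borel_vec p \<Longrightarrow> w \<in> space M \<Longrightarrow> f w \<in> carrier_vec p"
  using measurable_space[of f M "borel_vec p" w] by simp

lemma measurable_borel_mat_carrier:
  "f \<in> M \<rightarrow>\<^sub>M borel_mat p r \<Longrightarrow> w \<in> space M \<Longrightarrow> f w \<in> carrier_mat p r"
  using measurable_space[of f M "borel_mat p r" w] by simp

lemma measurable_mult_mat:
  assumes "f \<in> M \<rightarrow>\<^sub>M borel_mat n k" "g \<in> M \<rightarrow>\<^sub>M borel_mat k m"
  shows "(\<lambda>w. f w * g w) \<in> M \<rightarrow>\<^sub>M borel_mat n m"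
proof (rule measurable_borel_matI)
  note carr = measurable_borel_mat_carrier[OF assms(1)] measurable_borel_mat_carrier[OF assms(2)]
  show "f w * g w \<in> carrier_mat n m" if "w \<in> space M" for w
    using carr[OF that] by simp
  fix i j assume ij: "i < n" "j < m"
  have "(\<lambda>w. \<Sum>l<k. f w $$ (i, l) * g w $$ (l, j)) \<in> borel_measurable M"
    using assms ij by (intro borel_measurable_sum borel_measurable_times measurable_mat_index) auto
  also have "?this \<longleftrightarrow> (\<lambda>w. (f w * g w) $$ (i, j)) \<in> borel_measurable M"
    by (rule measurable_cong) (use mat_mult_index[OF carr ij] in simp)
  finally show "(\<lambda>w. (f w * g w) $$ (i, j)) \<in> borel_measurable M" .
qed

lemma measurable_mult_mat_vec:
  assumes "f \<in> M \<rightarrow>\<^sub>M borel_mat n k" "g \<in> M \<rightarrow>\<^sub>M borel_vec k"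
  shows "(\<lambda>w. f w *\<^sub>v g w) \<in> M \<rightarrow>\<^sub>M borel_vec n"
proof (rule measurable_borel_vecI)
  note carr = measurable_borel_mat_carrier[OF assms(1)] measurable_borel_vec_carrier[OF assms(2)]
  show "f w *\<^sub>v g w \<in> carrier_vec n" if "w \<in> space M" for w
    using carr[OF that] by simp
  fix i assume i: "i < n"
  have "(\<lambda>w. \<Sum>l<k. f w $$ (i, l) * g w $ l) \<in> borel_measurable M"
    using assms i by (intro borel_measurable_sum borel_measurable_times measurable_mat_index measurable_vec_nth) auto
  also have "?this \<longleftrightarrow> (\<lambda>w. (f w *\<^sub>v g w) $ i) \<in> borel_measurable M"
    by (rule measurable_cong) (use mult_mat_vec_index[OF carr i] in simp)
  finally show "(\<lambda>w. (f w *\<^sub>v g w) $ i) \<in> borel_measurable M" .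
qed

lemma measurable_scalar_prod:
  assumes "f \<in> M \<rightarrow>\<^sub>M borel_vec n" "g \<in> M \<rightarrow>\<^sub>M borel_vec n"
  shows "(\<lambda>w. f w \<bullet> g w) \<in> borel_measurable M"
proof -
  have "(\<lambda>w. \<Sum>l<n. f w $ l * g w $ l) \<in> borel_measurable M"
    using assms by (intro borel_measurable_sum borel_measurable_times measurable_vec_nth) auto
  also have "?this \<longleftrightarrow> (\<lambda>w. f w \<bullet> g w) \<in> borel_measurable M"
    by (rule measurable_cong) (use scalar_prod_sum[OF measurable_borel_vec_carrier[OF assms(2)]] in simp)
  finally show ?thesis .
qed

lemma measurable_transpose_mat:
  assumes "f \<in> M \<rightarrow>\<^sub>M borel_mat n k"
  shows "(\<lambda>w. transpose_mat (f w)) \<in> M \<rightarrow>\<^sub>M borel_mat k n"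
proof (rule measurable_borel_matI)
  note carr = measurable_borel_mat_carrier[OF assms(1)]
  show "transpose_mat (f w) \<in> carrier_mat k n" if "w \<in> space M" for w
    using carr[OF that] by simp
  fix i j assume ij: "i < k" "j < n"
  have "(\<lambda>w. f w $$ (j, i)) \<in> borel_measurable M"
    using assms ij by (intro measurable_mat_index)
  also have "?this \<longleftrightarrow> (\<lambda>w. transpose_mat (f w) $$ (i, j)) \<in> borel_measurable M"
    by (rule measurable_cong) (use carr ij in fastforce)
  finally show "(\<lambda>w. transpose_mat (f w) $$ (i, j)) \<in> borel_measurable M" .
qed

lemma measurable_add_mat:
  assumes "f \<in> M \<rightarrow>\<^sub>M borel_mat n k" "g \<in> M \<rightarrow>\<^sub>M borel_mat n k"
  shows "(\<lambda>w. f w + g w) \<in> M \<rightarrow>\<^sub>M borel_mat n k"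
proof (rule measurable_borel_matI)
  note carr = measurable_borel_mat_carrier[OF assms(1)] measurable_borel_mat_carrier[OF assms(2)]
  show "f w + g w \<in> carrier_mat n k" if "w \<in> space M" for w
    using carr[OF that] by simp
  fix i j assume ij: "i < n" "j < k"
  have "(\<lambda>w. f w $$ (i, j) + g w $$ (i, j)) \<in> borel_measurable M"
    using assms ij by (intro borel_measurable_add measurable_mat_index)
  also have "?this \<longleftrightarrow> (\<lambda>w. (f w + g w) $$ (i, j)) \<in> borel_measurable M"
    by (rule measurable_cong) (use carr ij in fastforce)
  finally show "(\<lambda>w. (f w + g w) $$ (i, j)) \<in> borel_measurable M" .
qed

lemma measurable_const_mat: "A \<in> carrier_mat n k \<Longrightarrow> (\<lambda>w. A) \<in> M \<rightarrow>\<^sub>M borel_mat n k"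
  by (rule measurable_const) simp

text \<open>By the Leibniz formula the determinant is a polynomial in the entries.\<close>

lemma measurable_det:
  assumes "f \<in> M \<rightarrow>\<^sub>M borel_mat n n"
  shows "(\<lambda>w. det (f w)) \<in> borel_measurable M"
proof -
  have "(\<lambda>w. \<Sum>\<pi>\<in>{\<pi>. \<pi> permutes {0..<n}}. signof \<pi> * (\<Prod>i=0..<n. f w $$ (i, \<pi> i))) \<in> borel_measurable M"
    using assms
    by (intro borel_measurable_sum borel_measurable_times borel_measurable_prod measurable_mat_index measurable_const)
       (auto dest: permutes_in_image)
  also have "?this \<longleftrightarrow> (\<lambda>w. det (f w)) \<in> borel_measurable M"
    by (rule measurable_cong) (use det_def'[OF measurable_borel_mat_carrier[OF assms]] in simp)
  finally show ?thesis .
qed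

lemma measurable_vec_PiM [measurable]: "vec p \<in> (\<Pi>\<^sub>M i\<in>{..<p}. lborel) \<rightarrow>\<^sub>M borel_vec p"
proof (rule measurable_borel_vecI)
  fix i assume i: "i < p"
  have "(\<lambda>w. w i) \<in> (\<Pi>\<^sub>M i\<in>{..<p}. lborel) \<rightarrow>\<^sub>M (borel :: real measure)"
    using i by (intro measurable_compose[OF measurable_component_singleton]) auto
  then show "(\<lambda>w. vec p w $ i) \<in> borel_measurable (\<Pi>\<^sub>M i\<in>{..<p}. lborel)" using i by simp
qed auto

lemma sets_lborel_vec [simp, measurable_cong]: "sets (lborel_vec p) = sets (borel_vec p)"
  by (simp add: lborel_vec_def)

lemma space_lborel_vec [simp]: "space (lborel_vec p) = carrier_vec p"
  by (simp add: lborel_vec_def)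

lemma nn_integral_lborel_vec_gaussian:
  assumes B: "B \<in> carrier_mat p p" "pos_def B"
  shows "(\<integral>\<^sup>+x. ennreal (exp (- (x \<bullet> (B *\<^sub>v x)) / 2)) \<partial>lborel_vec p) = ennreal (sqrt ((2 * pi) ^ p / det B))"
proof -
  have "(\<lambda>x. ennreal (exp (- (x \<bullet> (B *\<^sub>v x)) / 2))) \<in> borel_measurable (borel_vec p)"
  proof -
    have "(\<lambda>x. x \<bullet> (B *\<^sub>v x)) \<in> borel_measurable (borel_vec p)"
      by (intro measurable_scalar_prod[of _ _ p] measurable_mult_mat_vec[of _ _ p p] measurable_ident_sets[OF refl] measurable_const_mat B)
    then show ?thesis by measurable
  qed
  then have "(\<integral>\<^sup>+x. ennreal (exp (- (x \<bullet> (B *\<^sub>v x)) / 2)) \<partial>lborel_vec p)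
    = (\<integral>\<^sup>+x. ennreal (exp (- (vec p x \<bullet> (B *\<^sub>v vec p x)) / 2)) \<partial>(\<Pi>\<^sub>M i\<in>{..<p}. lborel))"
    unfolding lborel_vec_def by (intro nn_integral_distr) auto
  also have "\<dots> = (\<integral>\<^sup>+x. ennreal (exp (- (\<Sum>i<p. \<Sum>j<p. B $$ (i, j) * x i * x j) / 2)) \<partial>(\<Pi>\<^sub>M i\<in>{..<p}. lborel))"
    by (simp add: quadratic_form_sum[OF B(1)])
  also have "\<dots> = ennreal (sqrt ((2 * pi) ^ p / det B))"
    by (rule gaussian_integral(2)[OF B])
  finally show ?thesis .
qed

text \<open>Exhibiting T excludes the result \<open>None\<close>, on which \<open>the\<close> would
  say nothing; uniqueness of the inverse does the rest.\<close>

lemma the_mat_inverse: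
  fixes S T :: "real mat"
  assumes S: "S \<in> carrier_mat n n" and T: "T \<in> carrier_mat n n" and "S * T = 1\<^sub>m n" "T * S = 1\<^sub>m n"
  shows "the (mat_inverse S) = T"
proof -
  have "S \<in> Units (ring_mat TYPE(real) n ())"
    using assms by (auto simp: Units_def ring_mat_simps intro!: exI[of _ T])
  then have "mat_inverse S \<noteq> None" using mat_inverse(1)[OF S, of "()"] by blast
  then obtain R where R: "mat_inverse S = Some R" by auto
  from mat_inverse(2)[OF S R] have R': "S * R = 1\<^sub>m n" "R \<in> carrier_mat n n" by auto
  have "R = (T * S) * R" using assms R' by simp
  also have "\<dots> = T * (S * R)" by (rule assoc_mult_mat[OF T S R'(2)])
  also have "\<dots> = T" using assms R' by simp
  finally show ?thesis using R by simp
qed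

lemma measurable_scalar_prod_self: "(\<lambda>x. x \<bullet> x) \<in> borel_measurable (borel_vec p)"
  by (intro measurable_scalar_prod[of _ _ p] measurable_ident_sets[OF refl])

lemma normal_vec_one:
  "normal_vec (1\<^sub>m p) = density (lborel_vec p) (\<lambda>x. ennreal (exp (- (x \<bullet> x) / 2) / sqrt ((2 * pi) ^ p)))"
proof -
  have inv: "the (mat_inverse (1\<^sub>m p)) = (1\<^sub>m p :: real mat)"
    by (rule the_mat_inverse[of _ p]) auto
  have [measurable]: "(\<lambda>x. x \<bullet> x) \<in> borel_measurable (borel_vec p)" "(\<lambda>x. x \<bullet> (1\<^sub>m p *\<^sub>v x)) \<in> borel_measurable (borel_vec p)"
    by (rule measurable_scalar_prod_self, 
        intro measurable_scalar_prod[of _ _ p] measurable_mult_mat_vec[of _ _ p p] measurable_ident_sets[OF refl] measurable_const_mat one_carrier_mat)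
  show ?thesis
    unfolding normal_vec_def inv index_one_mat(2)
    by (rule density_cong) (measurable, auto)
qed

lemma sets_normal_vec [simp, measurable_cong]: "sets (normal_vec S) = sets (borel_vec (dim_row S))"
  by (simp add: normal_vec_def)

lemma space_normal_vec [simp]: "space (normal_vec S) = carrier_vec (dim_row S)"
  by (simp add: normal_vec_def)

lemma measurable_quadratic_form:
  assumes "B \<in> carrier_mat p p"
  shows "(\<lambda>x. x \<bullet> (B *\<^sub>v x)) \<in> borel_measurable (borel_vec p)"
  using assms by (intro measurable_scalar_prod[of _ _ p] measurable_mult_mat_vec[of _ _ p p] measurable_ident_sets[OF refl] measurable_const_mat)

text \<open>The one Gaussian computation behind everything later. G = 0 gives the total mass, one
  spike the normalisation of the likelihood ratio, two spikes its second moment, a multiple of I the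
  exponential moment of g.g, and a multiple of qq' that of (q.g)^2.\<close>

lemma nn_integral_standard_normal_quadratic:
  assumes G: "G \<in> carrier_mat p p" and pd: "pos_def (1\<^sub>m p - G)"
  shows "(\<integral>\<^sup>+x. ennreal (exp (x \<bullet> (G *\<^sub>v x) / 2)) \<partial>normal_vec (1\<^sub>m p)) = ennreal (1 / sqrt (det (1\<^sub>m p - G)))"
proof -
  define c where "c = 1 / sqrt ((2 * pi) ^ p)"
  have c: "c > 0" by (simp add: c_def)
  have carr: "1\<^sub>m p - G \<in> carrier_mat p p" using G by auto
  have det: "0 < det (1\<^sub>m p - G)" by (rule gaussian_integral(1)[OF carr pd])
  have [measurable]: "(\<lambda>x. x \<bullet> x) \<in> borel_measurable (borel_vec p)" "(\<lambda>x. x \<bullet> (G *\<^sub>v x)) \<in> borel_measurable (borel_vec p)"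
      "(\<lambda>x. x \<bullet> ((1\<^sub>m p - G) *\<^sub>v x)) \<in> borel_measurable (borel_vec p)"
    using measurable_scalar_prod_self measurable_quadratic_form[OF G] measurable_quadratic_form[OF carr]
    by (auto cong: measurable_cong)
  have "(\<integral>\<^sup>+x. ennreal (exp (x \<bullet> (G *\<^sub>v x) / 2)) \<partial>normal_vec (1\<^sub>m p))
      = (\<integral>\<^sup>+x. ennreal (exp (- (x \<bullet> x) / 2) / sqrt ((2 * pi) ^ p)) * ennreal (exp (x \<bullet> (G *\<^sub>v x) / 2)) \<partial>lborel_vec p)"
    unfolding normal_vec_one by (rule nn_integral_density) measurable
  also have "\<dots> = (\<integral>\<^sup>+x. ennreal c * ennreal (exp (- (x \<bullet> ((1\<^sub>m p - G) *\<^sub>v x)) / 2)) \<partial>lborel_vec p)"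
  proof (rule nn_integral_cong)
    fix x assume "x \<in> space (lborel_vec p)"
    then have x: "x \<in> carrier_vec p" by simp
    have "x \<bullet> ((1\<^sub>m p - G) *\<^sub>v x) = x \<bullet> x - x \<bullet> (G *\<^sub>v x)"
      using x G by (simp add: minus_mult_distrib_mat_vec[of _ p p] scalar_prod_minus_distrib[of _ p])
    then have e: "exp (- (x \<bullet> ((1\<^sub>m p - G) *\<^sub>v x)) / 2) = exp (- (x \<bullet> x) / 2) * exp (x \<bullet> (G *\<^sub>v x) / 2)"
      by (simp add: exp_add[symmetric] field_simps)
    show "ennreal (exp (- (x \<bullet> x) / 2) / sqrt ((2 * pi) ^ p)) * ennreal (exp (x \<bullet> (G *\<^sub>v x) / 2))
      = ennreal c * ennreal (exp (- (x \<bullet> ((1\<^sub>m p - G) *\<^sub>v x)) / 2))"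
      unfolding e using c by (simp add: ennreal_mult[symmetric] c_def)
  qed
  also have "\<dots> = ennreal c * (\<integral>\<^sup>+x. ennreal (exp (- (x \<bullet> ((1\<^sub>m p - G) *\<^sub>v x)) / 2)) \<partial>lborel_vec p)"
    by (rule nn_integral_cmult) measurable
  also have "\<dots> = ennreal c * ennreal (sqrt ((2 * pi) ^ p / det (1\<^sub>m p - G)))"
    using nn_integral_lborel_vec_gaussian[OF carr pd] by simp
  also have "\<dots> = ennreal (1 / sqrt (det (1\<^sub>m p - G)))"
    using det c by (simp add: ennreal_mult[symmetric] c_def real_sqrt_divide)
  finally show ?thesis .
qed

lemma pos_def_one: "pos_def (1\<^sub>m p)"
proof -
  have "0 < v \<bullet> v" if "v \<in> carrier_vec p" "v \<noteq> 0\<^sub>v p" for v :: "real vec"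
    using that scalar_prod_self_eq_0[of v p] scalar_prod_self_nonneg[of v] by (auto simp: less_le)
  then show ?thesis by (auto simp: pos_def_def)
qed

lemma prob_space_standard_normal: "prob_space (normal_vec (1\<^sub>m p))"
proof (rule prob_spaceI)
  have 1: "(1\<^sub>m p - 0\<^sub>m p p :: real mat) = 1\<^sub>m p" by (auto intro!: eq_matI)
  have "(\<integral>\<^sup>+x. ennreal (exp (x \<bullet> (0\<^sub>m p p *\<^sub>v x) / 2)) \<partial>normal_vec (1\<^sub>m p)) = ennreal (1 / sqrt (det (1\<^sub>m p - 0\<^sub>m p p)))"
    by (rule nn_integral_standard_normal_quadratic) (auto simp: 1 pos_def_one)
  also note 1
  also have "(\<integral>\<^sup>+x. ennreal (exp (x \<bullet> (0\<^sub>m p p *\<^sub>v x) / 2)) \<partial>normal_vec (1\<^sub>m p)) = (\<integral>\<^sup>+x. 1 \<partial>normal_vec (1\<^sub>m p))"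
  proof (rule nn_integral_cong)
    fix x assume "x \<in> space (normal_vec (1\<^sub>m p))"
    then have "0\<^sub>m p p *\<^sub>v x = 0\<^sub>v p" "x \<in> carrier_vec p" by (auto intro!: eq_vecI)
    then show "ennreal (exp (x \<bullet> (0\<^sub>m p p *\<^sub>v x) / 2)) = 1" by simp
  qed
  finally show "emeasure (normal_vec (1\<^sub>m p)) (space (normal_vec (1\<^sub>m p))) = 1" by simp
qed

text \<open>Writing the inverse covariance as I - G cancels the null density and leaves the form of
  G alone in the exponent.\<close>

lemma normal_vec_density:
  assumes S: "S \<in> carrier_mat p p" and G: "G \<in> carrier_mat p p"
    and inv: "S * (1\<^sub>m p - G) = 1\<^sub>m p" "(1\<^sub>m p - G) * S = 1\<^sub>m p" and det: "0 < det S"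
  shows "normal_vec S = density (normal_vec (1\<^sub>m p)) (\<lambda>x. ennreal (exp (x \<bullet> (G *\<^sub>v x) / 2) / sqrt (det S)))"
proof -
  have T: "1\<^sub>m p - G \<in> carrier_mat p p" using G by auto
  have the_inv: "the (mat_inverse S) = 1\<^sub>m p - G"
    by (rule the_mat_inverse[OF S T inv])
  have [measurable]: "(\<lambda>x. x \<bullet> x) \<in> borel_measurable (borel_vec p)" "(\<lambda>x. x \<bullet> (G *\<^sub>v x)) \<in> borel_measurable (borel_vec p)"
      "(\<lambda>x. x \<bullet> ((1\<^sub>m p - G) *\<^sub>v x)) \<in> borel_measurable (borel_vec p)"
    using measurable_scalar_prod_self measurable_quadratic_form[OF G] measurable_quadratic_form[OF T]
    by (auto cong: measurable_cong)
  have "density (normal_vec (1\<^sub>m p)) (\<lambda>x. ennreal (exp (x \<bullet> (G *\<^sub>v x) / 2) / sqrt (det S)))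
    = density (lborel_vec p) (\<lambda>x. ennreal (exp (- (x \<bullet> x) / 2) / sqrt ((2 * pi) ^ p)) * ennreal (exp (x \<bullet> (G *\<^sub>v x) / 2) / sqrt (det S)))"
    unfolding normal_vec_one by (rule density_density_eq) measurable
  also have "\<dots> = normal_vec S"
    unfolding normal_vec_def the_inv carrier_matD[OF S]
  proof (rule density_cong)
    have "ennreal (exp (- (x \<bullet> x) / 2) / sqrt ((2 * pi) ^ p)) * ennreal (exp (x \<bullet> (G *\<^sub>v x) / 2) / sqrt (det S))
      = ennreal (exp (- (x \<bullet> ((1\<^sub>m p - G) *\<^sub>v x)) / 2) / sqrt ((2 * pi) ^ p * det S))" if x: "x \<in> carrier_vec p" for x
    proof -
      have "x \<bullet> ((1\<^sub>m p - G) *\<^sub>v x) = x \<bullet> x - x \<bullet> (G *\<^sub>v x)"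
        using x G by (simp add: minus_mult_distrib_mat_vec[of _ p p] scalar_prod_minus_distrib[of _ p])
      then have e: "exp (- (x \<bullet> ((1\<^sub>m p - G) *\<^sub>v x)) / 2) = exp (- (x \<bullet> x) / 2) * exp (x \<bullet> (G *\<^sub>v x) / 2)"
        by (simp add: exp_add[symmetric] field_simps)
      show ?thesis
        unfolding e using det by (simp add: ennreal_mult[symmetric] real_sqrt_mult)
    qed
    then show "AE x in lborel_vec p. ennreal (exp (- (x \<bullet> x) / 2) / sqrt ((2 * pi) ^ p)) * ennreal (exp (x \<bullet> (G *\<^sub>v x) / 2) / sqrt (det S))
      = ennreal (exp (- (x \<bullet> ((1\<^sub>m p - G) *\<^sub>v x)) / 2) / sqrt ((2 * pi) ^ p * det S))"
      by (intro AE_I2) simp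
  qed measurable
  finally show ?thesis by simp
qed

section \<open>Spiked covariance matrices\<close>

lemma smult_mat_mult_vec:
  assumes "A \<in> carrier_mat n m" "v \<in> carrier_vec m"
  shows "(k \<cdot>\<^sub>m A) *\<^sub>v v = k \<cdot>\<^sub>v (A *\<^sub>v (v :: 'a :: comm_ring_1 vec))"
  using assms by (auto intro!: eq_vecI simp: scalar_prod_def sum_distrib_left mult_ac)

lemma pos_def_inverse_exists:
  assumes "A \<in> carrier_mat n n" "pos_def A"
  obtains W where "W \<in> carrier_mat n n" "A * W = 1\<^sub>m n" "W * A = 1\<^sub>m n"
proof -
  have "det A \<noteq> 0" using gaussian_integral(1)[OF assms] by simp
  from det_non_zero_imp_unit[OF assms(1) this, of "()"]
  show ?thesis using that by (auto simp: Units_def ring_mat_simps)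
qed

lemma stiefelD:
  assumes "Q \<in> stiefel p r"
  shows "Q \<in> carrier_mat p r" "transpose_mat Q \<in> carrier_mat r p" "transpose_mat Q * Q = 1\<^sub>m r"
  using assms by (auto simp: stiefel_def)

text \<open>Bessel's inequality for the orthonormal columns of Q: expand the squared length of x -
  QQ'x.\<close>

lemma stiefel_bessel:
  assumes Q: "Q \<in> stiefel p r" and x: "x \<in> carrier_vec p"
  shows "(transpose_mat Q *\<^sub>v x) \<bullet> (transpose_mat Q *\<^sub>v x) \<le> x \<bullet> x"
proof -
  note Qc = stiefelD[OF Q]
  define y where "y = transpose_mat Q *\<^sub>v x"
  have y: "y \<in> carrier_vec r" using Qc x by (simp add: y_def)
  have Qy: "Q *\<^sub>v y \<in> carrier_vec p" using Qc y by simp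
  have 1: "x \<bullet> (Q *\<^sub>v y) = y \<bullet> y"
    using scalar_prod_mult_mat_vec_transpose[OF Qc(1) x y] by (simp add: y_def)
  have 2: "(Q *\<^sub>v y) \<bullet> (Q *\<^sub>v y) = y \<bullet> y"
    using scalar_prod_mult_mat_vec_transpose[OF Qc(1) Qy y] Qc y
    by (simp flip: assoc_mult_mat_vec[of _ r p _ r])
  have "0 \<le> (x - Q *\<^sub>v y) \<bullet> (x - Q *\<^sub>v y)" by (rule scalar_prod_self_nonneg)
  also have "\<dots> = x \<bullet> x - 2 * (x \<bullet> (Q *\<^sub>v y)) + (Q *\<^sub>v y) \<bullet> (Q *\<^sub>v y)"
    using x Qy comm_scalar_prod[OF Qy x]
    by (simp add: minus_scalar_prod_distrib[of _ p] scalar_prod_minus_distrib[of _ p])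
  finally show ?thesis using 1 2 by (simp add: y_def)
qed

lemma stiefel_isometry:
  assumes Q: "Q \<in> stiefel p r" and y: "y \<in> carrier_vec r"
  shows "(Q *\<^sub>v y) \<bullet> (Q *\<^sub>v y) = y \<bullet> y"
proof -
  note Qc = stiefelD[OF Q]
  have Qy: "Q *\<^sub>v y \<in> carrier_vec p" using Qc y by simp
  show ?thesis
    using scalar_prod_mult_mat_vec_transpose[OF Qc(1) Qy y] Qc y
    by (simp flip: assoc_mult_mat_vec[of _ r p _ r])
qed

lemma conjugate_mult_mat_vec:
  assumes Q: "Q \<in> carrier_mat p r" and D: "D \<in> carrier_mat r r" and x: "x \<in> carrier_vec p"
  shows "(Q * D * transpose_mat Q) *\<^sub>v x = Q *\<^sub>v (D *\<^sub>v (transpose_mat Q *\<^sub>v x))"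
  using assms by (simp add: assoc_mult_mat_vec[of _ p r _ p] assoc_mult_mat_vec[of _ p r _ r])

lemma conjugate_pos_semidef:
  assumes Q: "Q \<in> carrier_mat p r" and D: "D \<in> carrier_mat r r" "pos_semidef D"
  shows "pos_semidef (Q * D * transpose_mat Q)"
proof -
  have sym: "transpose_mat D = D" and psd: "\<And>v. v \<in> carrier_vec r \<Longrightarrow> 0 \<le> v \<bullet> (D *\<^sub>v v)"
    using D by (auto simp: pos_semidef_def)
  have "0 \<le> x \<bullet> ((Q * D * transpose_mat Q) *\<^sub>v x)" if x: "x \<in> carrier_vec p" for x
  proof -
    have y: "transpose_mat Q *\<^sub>v x \<in> carrier_vec r" using Q x by simp
    have "x \<bullet> ((Q * D * transpose_mat Q) *\<^sub>v x) = (transpose_mat Q *\<^sub>v x) \<bullet> (D *\<^sub>v (transpose_mat Q *\<^sub>v x))"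
      unfolding conjugate_mult_mat_vec[OF Q D(1) x]
      by (rule scalar_prod_mult_mat_vec_transpose[OF Q x]) (use D y in simp)
    then show ?thesis using psd[OF y] by simp
  qed
  moreover have "transpose_mat (Q * D * transpose_mat Q) = Q * D * transpose_mat Q"
  proof -
    have "transpose_mat (Q * D * transpose_mat Q) = Q * (D * transpose_mat Q)"
      using Q D by (simp add: transpose_mult[of _ p r _ p] transpose_mult[of _ r r _ p] sym)
    also have "\<dots> = Q * D * transpose_mat Q"
      using Q D by (intro assoc_mult_mat[symmetric, of _ p r _ r _ p]) auto
    finally show ?thesis .
  qed
  ultimately show ?thesis using Q D by (auto simp: pos_semidef_def)
qed

text \<open>Q' is a contraction and Q an isometry, so the bound on D survives conjugation. Squared
  lengths keep square roots out of the argument.\<close>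

lemma conjugate_norm_le:
  assumes Q: "Q \<in> stiefel p r" and D: "D \<in> carrier_mat r r" and x: "x \<in> carrier_vec p"
    and \<epsilon>: "\<And>v. v \<in> carrier_vec r \<Longrightarrow> (D *\<^sub>v v) \<bullet> (D *\<^sub>v v) \<le> \<epsilon>\<^sup>2 * (v \<bullet> v)"
  shows "((Q * D * transpose_mat Q) *\<^sub>v x) \<bullet> ((Q * D * transpose_mat Q) *\<^sub>v x) \<le> \<epsilon>\<^sup>2 * (x \<bullet> x)"
proof -
  note Qc = stiefelD[OF Q]
  have y: "transpose_mat Q *\<^sub>v x \<in> carrier_vec r" using Qc x by simp
  have "((Q * D * transpose_mat Q) *\<^sub>v x) \<bullet> ((Q * D * transpose_mat Q) *\<^sub>v x)
    = (D *\<^sub>v (transpose_mat Q *\<^sub>v x)) \<bullet> (D *\<^sub>v (transpose_mat Q *\<^sub>v x))"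
    unfolding conjugate_mult_mat_vec[OF Qc(1) D x] by (rule stiefel_isometry[OF Q]) (use D y in simp)
  also have "\<dots> \<le> \<epsilon>\<^sup>2 * ((transpose_mat Q *\<^sub>v x) \<bullet> (transpose_mat Q *\<^sub>v x))" by (rule \<epsilon>[OF y])
  also have "\<dots> \<le> \<epsilon>\<^sup>2 * (x \<bullet> x)" by (intro mult_left_mono stiefel_bessel[OF Q x]) simp
  finally show ?thesis .
qed

text \<open>Because Q'Q = I, conjugation by Q is multiplicative. This is how identities between
  small r by r matrices are carried over to p by p ones.\<close>

lemma conjugate_mult:
  assumes "Q \<in> stiefel p r" and "D \<in> carrier_mat r r" "E \<in> carrier_mat r r"
  shows "(Q * D * transpose_mat Q) * (Q * E * transpose_mat Q) = Q * (D * E) * transpose_mat Q"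
proof -
  note Qc = stiefelD[OF assms(1)]
  have "(Q * D * transpose_mat Q) * (Q * E * transpose_mat Q) = Q * D * (transpose_mat Q * (Q * E * transpose_mat Q))"
    using Qc assms(2,3) by (intro assoc_mult_mat[of _ p r _ p _ p]) auto
  also have "transpose_mat Q * (Q * E * transpose_mat Q) = transpose_mat Q * (Q * (E * transpose_mat Q))"
    using Qc assms(2,3) by (subst assoc_mult_mat[of Q p r E r _ p]) auto
  also have "\<dots> = (transpose_mat Q * Q) * (E * transpose_mat Q)"
    using Qc assms(2,3) by (intro assoc_mult_mat[symmetric, of _ r p _ r _ p]) auto
  also have "\<dots> = E * transpose_mat Q"
    using Qc assms(2,3) by (metis left_mult_one_mat mult_carrier_mat)
  also have "Q * D * (E * transpose_mat Q) = (Q * D * E) * transpose_mat Q"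
    using Qc assms(2,3) by (intro assoc_mult_mat[symmetric, of _ p r _ r _ p]) auto
  also have "Q * D * E = Q * (D * E)"
    using Qc assms(2,3) by (intro assoc_mult_mat[of _ p r _ r _ r]) auto
  finally show ?thesis .
qed

text \<open>\<open>(I + QDQ')\<^sup>-\<^sup>1 = I - Q E Q'\<close> with \<open>E = D (I + D)\<^sup>-\<^sup>1\<close> whenever \<open>Q\<close> has orthonormal
  columns. This makes the inverse covariance a polynomial in the entries of \<open>Q\<close>, hence measurable.\<close>

definition inverse_spike :: "real mat \<Rightarrow> real mat" where
  "inverse_spike D = D * the (mat_inverse (1\<^sub>m (dim_row D) + D))"

text \<open>The second conclusion is (I + D) E = D for E = \<open>inverse_spike D\<close>, the form
  of the inverse relation that conjugation by Q transports directly.\<close>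

lemma inverse_spike:
  assumes D: "D \<in> carrier_mat r r" "pos_semidef D"
  shows "inverse_spike D \<in> carrier_mat r r" "inverse_spike D + D * inverse_spike D = D"
proof -
  have sym: "transpose_mat D = D" and psd: "\<And>v. v \<in> carrier_vec r \<Longrightarrow> 0 \<le> v \<bullet> (D *\<^sub>v v)"
    using D by (auto simp: pos_semidef_def)
  have ID: "1\<^sub>m r + D \<in> carrier_mat r r" using D by simp
  have "0 < v \<bullet> ((1\<^sub>m r + D) *\<^sub>v v)" if v: "v \<in> carrier_vec r" "v \<noteq> 0\<^sub>v r" for v
  proof -
    have "v \<bullet> ((1\<^sub>m r + D) *\<^sub>v v) = v \<bullet> v + v \<bullet> (D *\<^sub>v v)"
      using D v by (simp add: add_mult_distrib_mat_vec[of _ r r] scalar_prod_add_distrib[of _ r])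
    moreover have "v \<bullet> v > 0"
      using v scalar_prod_self_eq_0[of v r] scalar_prod_self_nonneg[of v] by (auto simp: less_le)
    ultimately show ?thesis using psd[OF v(1)] by simp
  qed
  moreover have "transpose_mat (1\<^sub>m r + D) = 1\<^sub>m r + D" using D sym by (simp add: transpose_add[of _ r r])
  ultimately have "pos_def (1\<^sub>m r + D)" using D by (auto simp: pos_def_def)
  then obtain W where W: "W \<in> carrier_mat r r" "(1\<^sub>m r + D) * W = 1\<^sub>m r" "W * (1\<^sub>m r + D) = 1\<^sub>m r"
    using pos_def_inverse_exists[OF ID] by blast
  have E: "inverse_spike D = D * W"
    using the_mat_inverse[OF ID W(1) W(2,3)] D by (simp add: inverse_spike_def)
  show "inverse_spike D \<in> carrier_mat r r" using E D W by simp
  have "inverse_spike D + D * inverse_spike D = (1\<^sub>m r + D) * (D * W)"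
    unfolding E using D W by (simp add: add_mult_distrib_mat[of _ r r _ _ r])
  also have "\<dots> = ((1\<^sub>m r + D) * D) * W"
    using D W by (intro assoc_mult_mat[symmetric, of _ r r _ r _ r]) auto
  \<comment> \<open>D commutes with I + D, so the factor I + D can be brought next to its inverse
    W.\<close>
  also have "(1\<^sub>m r + D) * D = D * (1\<^sub>m r + D)"
    using D by (simp add: add_mult_distrib_mat[of _ r r _ _ r] mult_add_distrib_mat[of _ r r _ r])
  also have "\<dots> * W = D * ((1\<^sub>m r + D) * W)"
    using D W by (intro assoc_mult_mat[of _ r r _ r _ r]) auto
  finally show "inverse_spike D + D * inverse_spike D = D" using D W by simp
qed

text \<open>Conjugating E + DE = D by Q gives G + AG = A, which is (I + A)(I - G) = I multiplied
  out: a Woodbury identity.\<close>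

lemma spiked_inverse:
  assumes Q: "Q \<in> stiefel p r" and D: "D \<in> carrier_mat r r" "pos_semidef D"
  defines "S \<equiv> 1\<^sub>m p + Q * D * transpose_mat Q" and "T \<equiv> 1\<^sub>m p - Q * inverse_spike D * transpose_mat Q"
  shows "S * T = 1\<^sub>m p" "T * S = 1\<^sub>m p"
proof -
  note Qc = stiefelD[OF Q]
  note E = inverse_spike[OF D]
  define A G where "A = Q * D * transpose_mat Q" and "G = Q * inverse_spike D * transpose_mat Q"
  have A: "A \<in> carrier_mat p p" and G: "G \<in> carrier_mat p p"
    using Qc D E by (auto simp: A_def G_def)
  have "G + A * G = Q * inverse_spike D * transpose_mat Q + Q * (D * inverse_spike D) * transpose_mat Q"
    unfolding A_def G_def by (subst conjugate_mult[OF Q D(1) E(1)]) simp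
  also have "\<dots> = (Q * inverse_spike D + Q * (D * inverse_spike D)) * transpose_mat Q"
    using Qc D E by (intro add_mult_distrib_mat[symmetric, of _ p r _ _ p]) auto
  also have "Q * inverse_spike D + Q * (D * inverse_spike D) = Q * (inverse_spike D + D * inverse_spike D)"
    using Qc D E(1) by (intro mult_add_distrib_mat[symmetric, of _ p r _ r]) auto
  finally have AG: "G + A * G = A" by (simp add: E(2) A_def)
  have "(1\<^sub>m p + A) * (1\<^sub>m p - G) = (1\<^sub>m p + A) * 1\<^sub>m p - (1\<^sub>m p + A) * G"
    using A G by (intro mult_minus_distrib_mat[of _ p p _ p]) auto
  also have "(1\<^sub>m p + A) * G = G + A * G"
    using A G by (simp add: add_mult_distrib_mat[of _ p p _ _ p])
  also have "(1\<^sub>m p + A) * 1\<^sub>m p - (G + A * G) = 1\<^sub>m p"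
    unfolding AG using A by (auto intro!: eq_matI)
  finally show ST: "S * T = 1\<^sub>m p" unfolding S_def T_def A_def G_def .
  show "T * S = 1\<^sub>m p"
    by (rule mat_mult_left_right_inverse[OF _ _ ST], unfold S_def T_def)
      (intro add_carrier_mat minus_carrier_mat A[unfolded A_def] G[unfolded G_def])+
qed

text \<open>G lies strictly below I/2, so that two such matrices together stay below I. With y = (I
  - G) x one has x = y + Ay, and 2 x.y - x.x = y.y - (Ay).(Ay), which is positive because A strictly
  shrinks y.\<close>

lemma spiked_inverse_quadratic_form:
  assumes Q: "Q \<in> stiefel p r" and D: "D \<in> carrier_mat r r" "pos_semidef D"
    and \<epsilon>: "\<And>v. v \<in> carrier_vec r \<Longrightarrow> (D *\<^sub>v v) \<bullet> (D *\<^sub>v v) \<le> \<epsilon>\<^sup>2 * (v \<bullet> v)" "\<epsilon>\<^sup>2 < 1"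
    and x: "x \<in> carrier_vec p" "x \<noteq> 0\<^sub>v p"
  shows "x \<bullet> x < 2 * (x \<bullet> ((1\<^sub>m p - Q * inverse_spike D * transpose_mat Q) *\<^sub>v x))"
proof -
  note Qc = stiefelD[OF Q]
  note E = inverse_spike[OF D]
  define A T where "A = Q * D * transpose_mat Q" and "T = 1\<^sub>m p - Q * inverse_spike D * transpose_mat Q"
  have A: "A \<in> carrier_mat p p" and T: "T \<in> carrier_mat p p"
    using Qc D E by (auto simp: A_def T_def)
  define y where "y = T *\<^sub>v x"
  have y: "y \<in> carrier_vec p" using T x by (simp add: y_def)
  have Ay: "A *\<^sub>v y \<in> carrier_vec p" using A y by simp
  have "y + A *\<^sub>v y = (1\<^sub>m p + A) *\<^sub>v y" using A y by (simp add: add_mult_distrib_mat_vec[of _ p p])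
  also have "\<dots> = ((1\<^sub>m p + A) * T) *\<^sub>v x" using A T x by (simp add: y_def assoc_mult_mat_vec[of _ p p])
  also have "\<dots> = x" using spiked_inverse(1)[OF Q D] x by (simp add: A_def T_def)
  finally have xy: "x = y + A *\<^sub>v y" by simp
  have "y \<noteq> 0\<^sub>v p"
  proof
    assume "y = 0\<^sub>v p"
    moreover have "A *\<^sub>v 0\<^sub>v p = 0\<^sub>v p" using A by (auto intro!: eq_vecI)
    ultimately show False using xy x by simp
  qed
  then have yy: "y \<bullet> y > 0"
    using y scalar_prod_self_eq_0[of y p] scalar_prod_self_nonneg[of y] by (auto simp: less_le)
  have "(A *\<^sub>v y) \<bullet> (A *\<^sub>v y) \<le> \<epsilon>\<^sup>2 * (y \<bullet> y)"
    unfolding A_def by (rule conjugate_norm_le[OF Q D(1) y \<epsilon>(1)])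
  also have "\<dots> < 1 * (y \<bullet> y)" using yy \<epsilon>(2) by (intro mult_strict_right_mono)
  finally have lt: "(A *\<^sub>v y) \<bullet> (A *\<^sub>v y) < y \<bullet> y" by simp
  have "x \<bullet> y = y \<bullet> y + (A *\<^sub>v y) \<bullet> y"
    by (subst xy) (use y Ay in \<open>simp add: add_scalar_prod_distrib[of _ p]\<close>)
  moreover have "x \<bullet> x = y \<bullet> y + 2 * ((A *\<^sub>v y) \<bullet> y) + (A *\<^sub>v y) \<bullet> (A *\<^sub>v y)"
    by (subst xy, subst xy)
      (use y Ay comm_scalar_prod[OF y Ay] in \<open>simp add: add_scalar_prod_distrib[of _ p] scalar_prod_add_distrib[of _ p]\<close>)
  ultimately show ?thesis using lt unfolding y_def T_def by simp
qed

text \<open>I - G is the inverse of the symmetric matrix I + A, hence symmetric itself; the symmetry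
  of \<open>inverse_spike D\<close> need not be examined.\<close>

lemma spiked_inverse_symmetric:
  assumes Q: "Q \<in> stiefel p r" and D: "D \<in> carrier_mat r r" "pos_semidef D"
  defines "G \<equiv> Q * inverse_spike D * transpose_mat Q"
  shows "transpose_mat G = G"
proof -
  note Qc = stiefelD[OF Q]
  note E = inverse_spike[OF D]
  define S T where "S = 1\<^sub>m p + Q * D * transpose_mat Q" and "T = 1\<^sub>m p - G"
  have G: "G \<in> carrier_mat p p" and S: "S \<in> carrier_mat p p" and T: "T \<in> carrier_mat p p"
    using Qc D E by (auto simp: S_def T_def G_def)
  have A: "Q * D * transpose_mat Q \<in> carrier_mat p p" using Qc D by simp
  have sym: "transpose_mat S = S"
    using conjugate_pos_semidef[OF Qc(1) D] A by (simp add: S_def transpose_add[of _ p p] pos_semidef_def)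
  have ST: "S * T = 1\<^sub>m p" and TS: "T * S = 1\<^sub>m p"
    using spiked_inverse[OF Q D] by (auto simp: S_def T_def G_def)
  have "transpose_mat T * S = transpose_mat (S * T)" using S T sym by (simp add: transpose_mult[of _ p p _ p])
  then have TtS: "transpose_mat T * S = 1\<^sub>m p" using ST by simp
  have "transpose_mat T = transpose_mat T * (S * T)" using ST T by simp
  also have "\<dots> = (transpose_mat T * S) * T" using S T by (intro assoc_mult_mat[symmetric, of _ p p _ p _ p]) auto
  also have "\<dots> = T" using TtS T by simp
  finally have T': "transpose_mat T = T" .
  show "transpose_mat G = G"
  proof (rule eq_matI)
    fix i j assume "i < dim_row G" "j < dim_col G"
    then have ij: "i < p" "j < p" using G by auto
    have "transpose_mat T $$ (i, j) = T $$ (i, j)" using T' by simp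
    then show "transpose_mat G $$ (i, j) = G $$ (i, j)" using ij G by (auto simp: T_def split: if_splits)
  qed (use G in auto)
qed

text \<open>I - (G + G') is (I - G) + (I - G') - I, and each of the first two terms exceeds I/2.
  This makes the second moment of the likelihood ratio finite.\<close>

lemma pos_def_two_spikes:
  assumes Q: "Q \<in> stiefel p r" "Q' \<in> stiefel p r" and D: "D \<in> carrier_mat r r" "pos_semidef D"
    and \<epsilon>: "\<And>v. v \<in> carrier_vec r \<Longrightarrow> (D *\<^sub>v v) \<bullet> (D *\<^sub>v v) \<le> \<epsilon>\<^sup>2 * (v \<bullet> v)" "\<epsilon>\<^sup>2 < 1"
  defines "G \<equiv> Q * inverse_spike D * transpose_mat Q" and "G' \<equiv> Q' * inverse_spike D * transpose_mat Q'"
  shows "pos_def (1\<^sub>m p - G)" "pos_def (1\<^sub>m p - (G + G'))"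
proof -
  have G: "G \<in> carrier_mat p p" "G' \<in> carrier_mat p p"
    using stiefelD[OF Q(1)] stiefelD[OF Q(2)] inverse_spike[OF D] by (auto simp: G_def G'_def)
  have sym: "transpose_mat G = G" "transpose_mat G' = G'"
    using spiked_inverse_symmetric[OF Q(1) D] spiked_inverse_symmetric[OF Q(2) D] by (auto simp: G_def G'_def)
  have q: "x \<bullet> x < 2 * (x \<bullet> ((1\<^sub>m p - G) *\<^sub>v x))" "x \<bullet> x < 2 * (x \<bullet> ((1\<^sub>m p - G') *\<^sub>v x))"
    if "x \<in> carrier_vec p" "x \<noteq> 0\<^sub>v p" for x
    unfolding G_def G'_def
    by (rule spiked_inverse_quadratic_form[OF Q(1) D \<epsilon> that], assumption,
        rule spiked_inverse_quadratic_form[OF Q(2) D \<epsilon> that], assumption)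
  have "0 < x \<bullet> ((1\<^sub>m p - G) *\<^sub>v x)" if x: "x \<in> carrier_vec p" "x \<noteq> 0\<^sub>v p" for x
    using q(1)[OF x] scalar_prod_self_nonneg[of x] by simp
  moreover have "transpose_mat (1\<^sub>m p - G) = 1\<^sub>m p - G" using G sym by (simp add: transpose_minus[of _ p p])
  ultimately show "pos_def (1\<^sub>m p - G)" using G by (auto simp: pos_def_def)
  have "0 < x \<bullet> ((1\<^sub>m p - (G + G')) *\<^sub>v x)" if x: "x \<in> carrier_vec p" "x \<noteq> 0\<^sub>v p" for x
    using q(1)[OF x] q(2)[OF x] x G
    by (simp add: minus_mult_distrib_mat_vec[of _ p p] add_mult_distrib_mat_vec[of _ p p]
      scalar_prod_minus_distrib[of _ p] scalar_prod_add_distrib[of _ p])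
  moreover have "transpose_mat (1\<^sub>m p - (G + G')) = 1\<^sub>m p - (G + G')"
    using G sym by (simp add: transpose_minus[of _ p p] transpose_add[of _ p p])
  ultimately show "pos_def (1\<^sub>m p - (G + G'))" using G by (auto simp: pos_def_def)
qed

text \<open>With S = I + A, S' = I + A' and inverses T, T', the middle matrix is T + T' - I.
  Multiplying by S on the left and S' on the right gives S' + S - SS' = I - AA'. The three
  determinants are those met in the second moment: two normalisations and one Gaussian
  integral.\<close>

lemma det_two_spikes:
  assumes Q: "Q \<in> stiefel p r" "Q' \<in> stiefel p r" and D: "D \<in> carrier_mat r r" "pos_semidef D"
  defines "G \<equiv> Q * inverse_spike D * transpose_mat Q" and "G' \<equiv> Q' * inverse_spike D * transpose_mat Q'"
    and "A \<equiv> Q * D * transpose_mat Q" and "A' \<equiv> Q' * D * transpose_mat Q'"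
  shows "det (1\<^sub>m p + A) * det (1\<^sub>m p - (G + G')) * det (1\<^sub>m p + A') = det (1\<^sub>m p - A * A')"
proof -
  have carr: "G \<in> carrier_mat p p" "G' \<in> carrier_mat p p" "A \<in> carrier_mat p p" "A' \<in> carrier_mat p p"
    using stiefelD[OF Q(1)] stiefelD[OF Q(2)] inverse_spike[OF D] D by (auto simp: G_def G'_def A_def A'_def)
  define S T S' T' where "S = 1\<^sub>m p + A" and "T = 1\<^sub>m p - G" and "S' = 1\<^sub>m p + A'" and "T' = 1\<^sub>m p - G'"
  have carr': "S \<in> carrier_mat p p" "T \<in> carrier_mat p p" "S' \<in> carrier_mat p p" "T' \<in> carrier_mat p p"
    using carr by (auto simp: S_def T_def S'_def T'_def)
  have ST: "S * T = 1\<^sub>m p" and TS': "T' * S' = 1\<^sub>m p"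
    using spiked_inverse[OF Q(1) D] spiked_inverse[OF Q(2) D]
    by (auto simp: S_def T_def S'_def T'_def G_def A_def G'_def A'_def)
  have B: "1\<^sub>m p - (G + G') = T - (1\<^sub>m p - T')"
    using carr by (auto intro!: eq_matI simp: T_def T'_def)
  have "(T - (1\<^sub>m p - T')) * S' = T * S' - (1\<^sub>m p - T') * S'"
    using carr' by (intro minus_mult_distrib_mat[of _ p p _ _ p]) auto
  also have "(1\<^sub>m p - T') * S' = S' - 1\<^sub>m p"
    using carr' TS' by (simp add: minus_mult_distrib_mat[of _ p p _ _ p])
  also have "\<dots> = A'" using carr by (auto intro!: eq_matI simp: S'_def)
  finally have 1: "(1\<^sub>m p - (G + G')) * S' = T * S' - A'" by (simp add: B)
  have "S * (T * S' - A') = S * (T * S') - S * A'"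
    using carr carr' by (intro mult_minus_distrib_mat[of _ p p _ p]) auto
  also have "S * (T * S') = (S * T) * S'" using carr' by (intro assoc_mult_mat[symmetric, of _ p p _ p _ p]) auto
  also have "\<dots> = S'" using ST carr' by simp
  also have "S * A' = A' + A * A'" using carr by (simp add: S_def add_mult_distrib_mat[of _ p p _ _ p])
  also have "S' - (A' + A * A') = 1\<^sub>m p - A * A'" using carr by (auto intro!: eq_matI simp: S'_def)
  finally have 2: "S * ((1\<^sub>m p - (G + G')) * S') = 1\<^sub>m p - A * A'" by (simp add: 1)
  have "det (1\<^sub>m p - A * A') = det S * det ((1\<^sub>m p - (G + G')) * S')"
    using carr carr' by (subst 2[symmetric], intro det_mult) auto
  also have "det ((1\<^sub>m p - (G + G')) * S') = det (1\<^sub>m p - (G + G')) * det S'"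
    using carr carr' by (intro det_mult) auto
  finally show ?thesis by (simp add: S_def S'_def)
qed

section \<open>The overlap of two spikes and the spectral norm\<close>

definition frobenius_sq :: "real mat \<Rightarrow> real" where
  "frobenius_sq M = (\<Sum>j<dim_row M. \<Sum>k<dim_col M. (M $$ (j, k))\<^sup>2)"

lemma frobenius_sq_mult_le:
  assumes D: "D \<in> carrier_mat r r" and M: "M \<in> carrier_mat r r"
    and \<epsilon>: "\<And>v. v \<in> carrier_vec r \<Longrightarrow> (D *\<^sub>v v) \<bullet> (D *\<^sub>v v) \<le> \<epsilon>\<^sup>2 * (v \<bullet> v)"
  shows "frobenius_sq (D * M) \<le> \<epsilon>\<^sup>2 * frobenius_sq M"
proof -
  have col: "frobenius_sq N = (\<Sum>k<r. col N k \<bullet> col N k)" if N: "N \<in> carrier_mat r r" for N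
  proof -
    have "frobenius_sq N = (\<Sum>k<r. \<Sum>j<r. (N $$ (j, k))\<^sup>2)"
      unfolding frobenius_sq_def using N by (subst sum.swap) simp
    also have "\<dots> = (\<Sum>k<r. col N k \<bullet> col N k)"
      using N by (intro sum.cong refl) (auto simp: scalar_prod_def power2_eq_square lessThan_atLeast0)
    finally show ?thesis .
  qed
  have "frobenius_sq (D * M) = (\<Sum>k<r. (D *\<^sub>v col M k) \<bullet> (D *\<^sub>v col M k))"
    using D M by (subst col) (auto intro!: sum.cong simp: col_mult2[of _ r r _ r])
  also have "\<dots> \<le> (\<Sum>k<r. \<epsilon>\<^sup>2 * (col M k \<bullet> col M k))"
    using M by (intro sum_mono \<epsilon>) auto
  also have "\<dots> = \<epsilon>\<^sup>2 * frobenius_sq M" using M by (simp add: col sum_distrib_left)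
  finally show ?thesis .
qed

lemma frobenius_sq_transpose: "frobenius_sq (transpose_mat M) = frobenius_sq M"
  unfolding frobenius_sq_def by (subst sum.swap) simp

text \<open>The arithmetic-geometric form of Cauchy-Schwarz loses nothing in the application, where
  both terms receive the same bound.\<close>

lemma mat_trace_mult_le_frobenius:
  assumes "A \<in> carrier_mat r r" "B \<in> carrier_mat r r"
  shows "mat_trace (A * B) \<le> (frobenius_sq A + frobenius_sq B) / 2"
proof -
  have "mat_trace (A * B) = (\<Sum>i<r. \<Sum>k<r. A $$ (i, k) * B $$ (k, i))"
    using assms by (auto simp: mat_trace_def mat_mult_index simp del: index_mult_mat(1) intro!: sum.cong)
  also have "\<dots> \<le> (\<Sum>i<r. \<Sum>k<r. ((A $$ (i, k))\<^sup>2 + (B $$ (k, i))\<^sup>2) / 2)"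
  proof (intro sum_mono)
    fix i k
    have "0 \<le> (A $$ (i, k) - B $$ (k, i))\<^sup>2" by simp
    then show "A $$ (i, k) * B $$ (k, i) \<le> ((A $$ (i, k))\<^sup>2 + (B $$ (k, i))\<^sup>2) / 2"
      by (simp add: power2_diff)
  qed
  also have "\<dots> = ((\<Sum>i<r. \<Sum>k<r. (A $$ (i, k))\<^sup>2) + (\<Sum>i<r. \<Sum>k<r. (B $$ (k, i))\<^sup>2)) / 2"
    by (simp add: sum.distrib sum_divide_distrib[symmetric])
  also have "(\<Sum>i<r. \<Sum>k<r. (B $$ (k, i))\<^sup>2) = frobenius_sq B"
    unfolding frobenius_sq_def using assms by (subst sum.swap) simp
  also have "(\<Sum>i<r. \<Sum>k<r. (A $$ (i, k))\<^sup>2) = frobenius_sq A"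
    unfolding frobenius_sq_def using assms by simp
  finally show ?thesis .
qed

text \<open>Cyclicity of the trace moves Q to the end, so that only the r by r matrix M = Q'R of
  inner products between the two frames remains: the trace is that of (DM)(DM').\<close>

lemma trace_two_spikes:
  assumes Q: "Q \<in> stiefel p r" "Q' \<in> stiefel p r" and D: "D \<in> carrier_mat r r"
    and \<epsilon>: "\<And>v. v \<in> carrier_vec r \<Longrightarrow> (D *\<^sub>v v) \<bullet> (D *\<^sub>v v) \<le> \<epsilon>\<^sup>2 * (v \<bullet> v)"
  shows "mat_trace ((Q * D * transpose_mat Q) * (Q' * D * transpose_mat Q'))
    \<le> \<epsilon>\<^sup>2 * frobenius_sq (transpose_mat Q * Q')"
proof -
  note Qc = stiefelD[OF Q(1)] stiefelD[OF Q(2)]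
  define M where "M = transpose_mat Q * Q'"
  have M: "M \<in> carrier_mat r r" using Qc by (simp add: M_def)
  have Mt: "transpose_mat M = transpose_mat Q' * Q"
    using Qc by (simp add: M_def transpose_mult[of _ r p _ r])
  have "(Q * D * transpose_mat Q) * (Q' * D * transpose_mat Q') = Q * ((D * M) * (D * transpose_mat Q'))"
    unfolding M_def using Qc D
    by (simp add: assoc_mult_mat[of _ p r _ r _ p] assoc_mult_mat[of _ p r _ p _ p] assoc_mult_mat[of _ r r _ p _ p]
      assoc_mult_mat[of _ r p _ r _ p] assoc_mult_mat[of _ r r _ r _ p])
  also have "mat_trace \<dots> = mat_trace (((D * M) * (D * transpose_mat Q')) * Q)"
    by (rule mat_trace_mult_commute[of _ p r]) (use Qc D M in auto)
  also have "((D * M) * (D * transpose_mat Q')) * Q = (D * M) * (D * transpose_mat M)"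
    unfolding Mt using Qc D M
    by (simp add: assoc_mult_mat[of _ r r _ p _ r])
  also have "mat_trace \<dots> \<le> (frobenius_sq (D * M) + frobenius_sq (D * transpose_mat M)) / 2"
    by (rule mat_trace_mult_le_frobenius[of _ r]) (use D M in auto)
  also have "\<dots> \<le> (\<epsilon>\<^sup>2 * frobenius_sq M + \<epsilon>\<^sup>2 * frobenius_sq (transpose_mat M)) / 2"
    using D M by (intro divide_right_mono add_mono frobenius_sq_mult_le[OF _ _ \<epsilon>]) auto
  finally show ?thesis by (simp add: frobenius_sq_transpose M_def)
qed

text \<open>A real \<open>SUP\<close> bounds its members only when the set is bounded above, which
  the crude entrywise estimate provides. Rescaling v to unit length then gives the bound for all
  vectors.\<close>

lemma spectral_norm_bound:
  assumes D: "D \<in> carrier_mat r r" and le: "spectral_norm D \<le> \<epsilon>" and v: "v \<in> carrier_vec r"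
  shows "(D *\<^sub>v v) \<bullet> (D *\<^sub>v v) \<le> \<epsilon>\<^sup>2 * (v \<bullet> v)"
proof (cases "v = 0\<^sub>v r")
  case True
  moreover have "D *\<^sub>v 0\<^sub>v r = 0\<^sub>v r" using D by (auto intro!: eq_vecI)
  ultimately show ?thesis by simp
next
  case False
  define B :: "real vec set" where "B = {w \<in> carrier_vec (dim_col D). w \<bullet> w \<le> 1}"
  define f where "f w = sqrt ((D *\<^sub>v w) \<bullet> (D *\<^sub>v w))" for w
  have "f w \<le> sqrt (\<Sum>i<r. (\<Sum>j<r. \<bar>D $$ (i, j)\<bar>)\<^sup>2)" if w: "w \<in> B" for w
  proof -
    have wc: "w \<in> carrier_vec r" and w1: "w \<bullet> w \<le> 1" using w D by (auto simp: B_def)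
    have wj: "\<bar>w $ j\<bar> \<le> 1" if "j < r" for j
    proof -
      have "w $ j * w $ j \<le> (\<Sum>i<r. w $ i * w $ i)" using that by (intro member_le_sum) auto
      also have "\<dots> \<le> 1" using w1 scalar_prod_sum[OF wc, of w] by simp
      finally show ?thesis by (simp add: abs_square_le_1 power2_eq_square[symmetric])
    qed
    have "(D *\<^sub>v w) \<bullet> (D *\<^sub>v w) = (\<Sum>i<r. (\<Sum>j<r. D $$ (i, j) * w $ j)\<^sup>2)"
      using D wc by (subst scalar_prod_sum[of _ r]) (auto simp: mult_mat_vec_index power2_eq_square simp del: index_mult_mat_vec)
    also have "\<dots> \<le> (\<Sum>i<r. (\<Sum>j<r. \<bar>D $$ (i, j)\<bar>)\<^sup>2)"
    proof (rule sum_mono)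
      fix i
      have "\<bar>\<Sum>j<r. D $$ (i, j) * w $ j\<bar> \<le> (\<Sum>j<r. \<bar>D $$ (i, j) * w $ j\<bar>)" by (rule sum_abs)
      also have "\<dots> \<le> (\<Sum>j<r. \<bar>D $$ (i, j)\<bar>)"
        using wj by (intro sum_mono) (auto simp: abs_mult intro!: mult_left_le)
      finally have "\<bar>\<Sum>j<r. D $$ (i, j) * w $ j\<bar> \<le> \<bar>\<Sum>j<r. \<bar>D $$ (i, j)\<bar>\<bar>" by (simp add: sum_nonneg)
      then show "(\<Sum>j<r. D $$ (i, j) * w $ j)\<^sup>2 \<le> (\<Sum>j<r. \<bar>D $$ (i, j)\<bar>)\<^sup>2"
        by (simp only: abs_le_square_iff)
    qed
    finally show ?thesis by (simp add: f_def)
  qed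
  then have bdd: "bdd_above (f ` B)" by (intro bdd_aboveI) auto
  have vv: "v \<bullet> v > 0"
    using v False scalar_prod_self_eq_0[of v r] scalar_prod_self_nonneg[of v] by (auto simp: less_le)
  define s where "s = 1 / sqrt (v \<bullet> v)"
  have ss: "s * s * (v \<bullet> v) = 1" using vv by (simp add: s_def power_divide flip: power2_eq_square)
  have "s \<cdot>\<^sub>v v \<in> B" using v D ss by (simp add: B_def)
  then have "f (s \<cdot>\<^sub>v v) \<le> \<epsilon>"
    using cSUP_upper[OF _ bdd, of "s \<cdot>\<^sub>v v"] le by (simp add: spectral_norm_def B_def f_def[abs_def])
  moreover have "0 \<le> f (s \<cdot>\<^sub>v v)" by (simp add: f_def scalar_prod_self_nonneg)
  ultimately have "(f (s \<cdot>\<^sub>v v))\<^sup>2 \<le> \<epsilon>\<^sup>2" by (intro power_mono)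
  then have "(D *\<^sub>v (s \<cdot>\<^sub>v v)) \<bullet> (D *\<^sub>v (s \<cdot>\<^sub>v v)) \<le> \<epsilon>\<^sup>2" by (simp add: f_def scalar_prod_self_nonneg)
  also have "(D *\<^sub>v (s \<cdot>\<^sub>v v)) \<bullet> (D *\<^sub>v (s \<cdot>\<^sub>v v)) = s * s * ((D *\<^sub>v v) \<bullet> (D *\<^sub>v v))"
    using D v by (simp add: mult_mat_vec[of _ r r])
  finally have "s * s * ((D *\<^sub>v v) \<bullet> (D *\<^sub>v v)) * (v \<bullet> v) \<le> \<epsilon>\<^sup>2 * (v \<bullet> v)" using vv by simp
  then show ?thesis using ss by (metis mult.assoc mult.commute mult.left_neutral)
qed

section \<open>Reflections\<close>

definition outer_prod :: "real vec \<Rightarrow> real mat" where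
  "outer_prod v = mat (dim_vec v) (dim_vec v) (\<lambda>(i, j). v $ i * v $ j)"

lemma outer_prod_carrier [simp]: "v \<in> carrier_vec n \<Longrightarrow> outer_prod v \<in> carrier_mat n n"
  by (simp add: outer_prod_def)

lemma outer_prod_mult_vec:
  assumes "v \<in> carrier_vec n" "x \<in> carrier_vec n"
  shows "outer_prod v *\<^sub>v x = (v \<bullet> x) \<cdot>\<^sub>v v"
proof (rule eq_vecI)
  fix i assume "i < dim_vec ((v \<bullet> x) \<cdot>\<^sub>v v)"
  then have i: "i < n" using assms by simp
  have "(outer_prod v *\<^sub>v x) $ i = (\<Sum>l<n. outer_prod v $$ (i, l) * x $ l)"
    using assms i by (intro mult_mat_vec_index) auto
  also have "\<dots> = (\<Sum>l<n. v $ l * x $ l * v $ i)"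
    using assms i by (intro sum.cong) (auto simp: outer_prod_def)
  also have "\<dots> = ((v \<bullet> x) \<cdot>\<^sub>v v) $ i"
    using assms i scalar_prod_sum[OF assms(2), of v] by (simp add: sum_distrib_right)
  finally show "(outer_prod v *\<^sub>v x) $ i = ((v \<bullet> x) \<cdot>\<^sub>v v) $ i" .
qed (use assms in \<open>auto simp: outer_prod_def\<close>)

lemma outer_prod_mult_self:
  assumes "v \<in> carrier_vec n"
  shows "outer_prod v * outer_prod v = (v \<bullet> v) \<cdot>\<^sub>m outer_prod v"
proof (rule eq_matI)
  fix i j assume "i < dim_row ((v \<bullet> v) \<cdot>\<^sub>m outer_prod v)" "j < dim_col ((v \<bullet> v) \<cdot>\<^sub>m outer_prod v)"
  then have ij: "i < n" "j < n" using assms by (auto simp: outer_prod_def)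
  have "(outer_prod v * outer_prod v) $$ (i, j) = (\<Sum>l<n. outer_prod v $$ (i, l) * outer_prod v $$ (l, j))"
    using assms ij by (intro mat_mult_index) auto
  also have "\<dots> = (\<Sum>l<n. v $ l * v $ l * (v $ i * v $ j))"
    using assms ij by (intro sum.cong) (auto simp: outer_prod_def)
  also have "\<dots> = ((v \<bullet> v) \<cdot>\<^sub>m outer_prod v) $$ (i, j)"
    using assms ij scalar_prod_sum[OF assms(1), of v] by (simp add: sum_distrib_right outer_prod_def)
  finally show "(outer_prod v * outer_prod v) $$ (i, j) = ((v \<bullet> v) \<cdot>\<^sub>m outer_prod v) $$ (i, j)" .
qed (use assms in \<open>auto simp: outer_prod_def\<close>)

text \<open>The reflection in the hyperplane orthogonal to a - b exchanges a and b when they have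
  equal length. It is symmetric and its own inverse, so it qualifies as a rotation in
  \<open>uniform_stiefel\<close> and moves freely across inner products.\<close>

lemma householder:
  assumes a: "a \<in> carrier_vec n" and b: "b \<in> carrier_vec n" and ab: "a \<bullet> a = b \<bullet> b"
  obtains U :: "real mat" where "U \<in> carrier_mat n n" "transpose_mat U = U" "U * U = 1\<^sub>m n" "U *\<^sub>v a = b"
proof (cases "a = b")
  case True
  then show ?thesis using that[of "1\<^sub>m n"] a by auto
next
  case False
  define v where "v = a - b"
  have v: "v \<in> carrier_vec n" using a b by (simp add: v_def)
  have "v \<noteq> 0\<^sub>v n"
  proof
    assume v0: "v = 0\<^sub>v n"
    have "a = b"
    proof (rule eq_vecI)
      fix i assume "i < dim_vec b"
      then show "a $ i = b $ i" using arg_cong[OF v0, of "\<lambda>v. v $ i"] a b by (simp add: v_def)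
    qed (use a b in auto)
    with False show False by simp
  qed
  then have c: "v \<bullet> v \<noteq> 0" using scalar_prod_self_eq_0[OF v] by blast
  define k where "k = 2 / (v \<bullet> v)"
  define V U where "V = outer_prod v" and "U = 1\<^sub>m n - k \<cdot>\<^sub>m V"
  have V: "V \<in> carrier_mat n n" using v by (simp add: V_def)
  have U: "U \<in> carrier_mat n n" unfolding U_def by (intro minus_carrier_mat smult_carrier_mat V)
  have "transpose_mat U = U"
    using v by (auto intro!: eq_matI simp: U_def V_def outer_prod_def)
  moreover have "U * U = 1\<^sub>m n"
  proof -
    have "U * V = V - (k \<cdot>\<^sub>m V) * V" using V by (simp add: U_def minus_mult_distrib_mat[of _ n n _ _ n])
    also have "(k \<cdot>\<^sub>m V) * V = k \<cdot>\<^sub>m ((v \<bullet> v) \<cdot>\<^sub>m V)"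
      using V outer_prod_mult_self[OF v] by (simp add: V_def mult_smult_assoc_mat[of _ n n _ n])
    finally have UV: "U * V = V - k \<cdot>\<^sub>m ((v \<bullet> v) \<cdot>\<^sub>m V)" .
    have kc: "k * (v \<bullet> v) = 2" using c by (simp add: k_def)
    have "U * U = U * 1\<^sub>m n - U * (k \<cdot>\<^sub>m V)"
      unfolding U_def using V by (intro mult_minus_distrib_mat[of _ n n _ n]) auto
    also have "U * (k \<cdot>\<^sub>m V) = k \<cdot>\<^sub>m (U * V)" using U V by (intro mult_smult_distrib[of _ n n _ n])
    also have "U * 1\<^sub>m n - \<dots> = 1\<^sub>m n"
    proof (rule eq_matI)
      fix i j assume "i < dim_row (1\<^sub>m n :: real mat)" "j < dim_col (1\<^sub>m n :: real mat)"
      then have ij: "i < n" "j < n" by auto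
      have "(U * 1\<^sub>m n - k \<cdot>\<^sub>m (U * V)) $$ (i, j) = 1\<^sub>m n $$ (i, j) - k * V $$ (i, j) - k * (V $$ (i, j) - k * (v \<bullet> v) * V $$ (i, j))"
        unfolding UV using ij U V by (simp add: U_def)
      then show "(U * 1\<^sub>m n - k \<cdot>\<^sub>m (U * V)) $$ (i, j) = 1\<^sub>m n $$ (i, j)" by (simp add: kc)
    qed (use U V in auto)
    finally show ?thesis .
  qed
  moreover have "U *\<^sub>v a = b"
  proof -
    \<comment> \<open>Equality of the two lengths enters here: half of a - b is then the component
      of a along a - b.\<close>
    have va: "v \<bullet> a = (v \<bullet> v) / 2"
      using a b v ab comm_scalar_prod[OF a b]
      by (simp add: v_def minus_scalar_prod_distrib[of _ n] scalar_prod_minus_distrib[of _ n])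
    have "U *\<^sub>v a = a - (k \<cdot>\<^sub>m V) *\<^sub>v a"
      using V a by (simp add: U_def minus_mult_distrib_mat_vec[of _ n n])
    also have "(k \<cdot>\<^sub>m V) *\<^sub>v a = k \<cdot>\<^sub>v (V *\<^sub>v a)" using V a by (simp add: smult_mat_mult_vec[of _ n n])
    also have "V *\<^sub>v a = (v \<bullet> a) \<cdot>\<^sub>v v" unfolding V_def by (rule outer_prod_mult_vec[OF v a])
    also have "k \<cdot>\<^sub>v ((v \<bullet> a) \<cdot>\<^sub>v v) = v" using c v by (auto simp: va k_def intro!: eq_vecI)
    also have "a - v = b" using a b by (auto simp: v_def intro!: eq_vecI)
    finally show ?thesis .
  qed
  ultimately show ?thesis using that[OF U] by blast
qed

section \<open>Moments of the uniform law on the Stiefel manifold\<close>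

lemma unit_cauchy_schwarz:
  assumes q: "q \<in> carrier_vec n" "q \<bullet> q = (1 :: real)" and x: "x \<in> carrier_vec n"
  shows "(q \<bullet> x)\<^sup>2 \<le> x \<bullet> x"
proof -
  define t where "t = q \<bullet> x"
  have "0 \<le> (x - t \<cdot>\<^sub>v q) \<bullet> (x - t \<cdot>\<^sub>v q)" by (rule scalar_prod_self_nonneg)
  also have "\<dots> = x \<bullet> x - t\<^sup>2"
    using q x comm_scalar_prod[OF q(1) x]
    by (simp add: minus_scalar_prod_distrib[of _ n] scalar_prod_minus_distrib[of _ n] t_def power2_eq_square algebra_simps)
  finally show ?thesis by (simp add: t_def)
qed

lemma stiefel_col_unit:
  assumes Q: "Q \<in> stiefel p r" and j: "j < r"
  shows "col Q j \<in> carrier_vec p" "col Q j \<bullet> col Q j = 1"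
proof -
  note Qc = stiefelD[OF Q]
  show "col Q j \<in> carrier_vec p" using Qc j by auto
  have "(transpose_mat Q * Q) $$ (j, j) = col Q j \<bullet> col Q j" using Qc(1) j by simp
  then show "col Q j \<bullet> col Q j = 1" using Qc(3) j by simp
qed

lemma measurable_col:
  assumes "f \<in> M \<rightarrow>\<^sub>M borel_mat p r" "j < r"
  shows "(\<lambda>w. col (f w) j) \<in> M \<rightarrow>\<^sub>M borel_vec p"
proof (rule measurable_borel_vecI)
  note carr = measurable_borel_mat_carrier[OF assms(1)]
  show "col (f w) j \<in> carrier_vec p" if "w \<in> space M" for w using carr[OF that] assms(2) by auto
  fix i assume i: "i < p"
  have "(\<lambda>w. f w $$ (i, j)) \<in> borel_measurable M" using assms i by (intro measurable_mat_index)
  also have "?this \<longleftrightarrow> (\<lambda>w. col (f w) j $ i) \<in> borel_measurable M"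
    by (rule measurable_cong) (use carr i assms(2) in fastforce)
  finally show "(\<lambda>w. col (f w) j $ i) \<in> borel_measurable M" .
qed

lemma uniform_stiefel_sets:
  assumes "uniform_stiefel p r \<nu>"
  shows "space \<nu> = stiefel p r" "(\<lambda>Q. Q) \<in> \<nu> \<rightarrow>\<^sub>M borel_mat p r"
proof -
  have s: "sets \<nu> = sets (restrict_space (borel_mat p r) (stiefel p r))"
    using assms by (simp add: uniform_stiefel_def)
  have "stiefel p r \<subseteq> carrier_mat p r" by (auto simp: stiefel_def)
  then show "space \<nu> = stiefel p r" using sets_eq_imp_space_eq[OF s] by (auto simp: space_restrict_space)
  have "(\<lambda>Q. Q) \<in> restrict_space (borel_mat p r) (stiefel p r) \<rightarrow>\<^sub>M borel_mat p r"
    by (intro measurable_restrict_space1 measurable_ident_sets[OF refl])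
  then show "(\<lambda>Q. Q) \<in> \<nu> \<rightarrow>\<^sub>M borel_mat p r" using measurable_cong_sets[OF s refl] by blast
qed

lemma uniform_stiefel_rotate:
  assumes \<nu>: "uniform_stiefel p r \<nu>" and U: "U \<in> carrier_mat p p" "transpose_mat U * U = 1\<^sub>m p"
    and f: "f \<in> borel_measurable \<nu>"
  shows "(\<integral>\<^sup>+Q. f (U * Q) \<partial>\<nu>) = (\<integral>\<^sup>+Q. f Q \<partial>\<nu>)"
proof -
  note sp = uniform_stiefel_sets[OF \<nu>]
  have s: "sets \<nu> = sets (restrict_space (borel_mat p r) (stiefel p r))"
    using \<nu> by (simp add: uniform_stiefel_def)
  have "(\<lambda>Q. U * Q) \<in> \<nu> \<rightarrow>\<^sub>M restrict_space (borel_mat p r) (stiefel p r)"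
  proof (rule measurable_restrict_space2)
    show "(\<lambda>Q. U * Q) \<in> \<nu> \<rightarrow>\<^sub>M borel_mat p r"
      by (intro measurable_mult_mat[of _ _ p p] measurable_const_mat U sp)
    show "(\<lambda>Q. U * Q) \<in> space \<nu> \<rightarrow> stiefel p r"
    proof
      fix Q assume "Q \<in> space \<nu>"
      then have Q: "Q \<in> stiefel p r" using sp by simp
      note Qc = stiefelD[OF Q]
      have "transpose_mat (U * Q) * (U * Q) = transpose_mat Q * (transpose_mat U * (U * Q))"
        using U Qc by (simp add: transpose_mult[of _ p p _ r] assoc_mult_mat[of _ r p _ p _ r])
      also have "transpose_mat U * (U * Q) = (transpose_mat U * U) * Q"
        using U Qc by (intro assoc_mult_mat[symmetric, of _ p p _ p _ r]) auto
      also have "\<dots> = Q" using U Qc by (metis left_mult_one_mat)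
      finally show "U * Q \<in> stiefel p r" using U Qc by (simp add: stiefel_def)
    qed
  qed
  then have m: "(\<lambda>Q. U * Q) \<in> \<nu> \<rightarrow>\<^sub>M \<nu>" using measurable_cong_sets[OF refl s] by blast
  have "(\<integral>\<^sup>+Q. f (U * Q) \<partial>\<nu>) = (\<integral>\<^sup>+Q. f Q \<partial>distr \<nu> \<nu> (\<lambda>Q. U * Q))"
    by (rule nn_integral_distr[symmetric, OF m]) (simp add: f)
  also have "distr \<nu> \<nu> (\<lambda>Q. U * Q) = \<nu>" using \<nu> U by (simp add: uniform_stiefel_def)
  finally show ?thesis .
qed

text \<open>Jensen's inequality, as g.g has mean p. It is read off from the exact value (1 -
  2a)^(-p/2) by 1 - 2a \<le> exp (-2a).\<close>

lemma exp_le_standard_normal: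
  assumes "0 \<le> a" "a < 1 / 2"
  shows "ennreal (exp (real p * a)) \<le> (\<integral>\<^sup>+g. ennreal (exp (a * (g \<bullet> g))) \<partial>normal_vec (1\<^sub>m p))"
proof -
  define G :: "real mat" where "G = (2 * a) \<cdot>\<^sub>m 1\<^sub>m p"
  have G: "G \<in> carrier_mat p p" by (simp add: G_def)
  have IG: "1\<^sub>m p - G = (1 - 2 * a) \<cdot>\<^sub>m 1\<^sub>m p" by (auto simp: G_def intro!: eq_matI)
  have "0 < v \<bullet> ((1\<^sub>m p - G) *\<^sub>v v)" if v: "v \<in> carrier_vec p" "v \<noteq> 0\<^sub>v p" for v
  proof -
    have "v \<bullet> ((1\<^sub>m p - G) *\<^sub>v v) = (1 - 2 * a) * (v \<bullet> v)"
      using v by (simp add: IG smult_mat_mult_vec[of _ p p])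
    moreover have "v \<bullet> v > 0"
      using v scalar_prod_self_eq_0[of v p] scalar_prod_self_nonneg[of v] by (auto simp: less_le)
    ultimately show ?thesis using assms by simp
  qed
  moreover have "transpose_mat (1\<^sub>m p - G) = 1\<^sub>m p - G" unfolding IG by (auto intro!: eq_matI)
  ultimately have pd: "pos_def (1\<^sub>m p - G)" using G by (auto simp: pos_def_def)
  have det: "det (1\<^sub>m p - G) = (1 - 2 * a) ^ p" unfolding IG by simp
  have "(\<integral>\<^sup>+g. ennreal (exp (a * (g \<bullet> g))) \<partial>normal_vec (1\<^sub>m p)) = (\<integral>\<^sup>+g. ennreal (exp (g \<bullet> (G *\<^sub>v g) / 2)) \<partial>normal_vec (1\<^sub>m p))"
    by (rule nn_integral_cong) (auto simp: G_def smult_mat_mult_vec[of _ p p])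
  also have "\<dots> = ennreal (1 / sqrt ((1 - 2 * a) ^ p))"
    using nn_integral_standard_normal_quadratic[OF G pd] by (simp add: det)
  finally have eq: "(\<integral>\<^sup>+g. ennreal (exp (a * (g \<bullet> g))) \<partial>normal_vec (1\<^sub>m p)) = ennreal (1 / sqrt ((1 - 2 * a) ^ p))" .
  have "1 - 2 * a \<le> exp (- 2 * a)" using exp_ge_add_one_self[of "- 2 * a"] by simp
  then have "(1 - 2 * a) ^ p \<le> exp (- 2 * a) ^ p" using assms by (intro power_mono) auto
  also have "\<dots> = exp (- (real p * a)) ^ 2" by (simp add: exp_of_nat_mult[symmetric] exp_double[symmetric] algebra_simps)
  finally have "sqrt ((1 - 2 * a) ^ p) \<le> sqrt (exp (- (real p * a)) ^ 2)" by (rule real_sqrt_le_mono)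
  then have le: "sqrt ((1 - 2 * a) ^ p) \<le> exp (- (real p * a))" by simp
  have "exp (real p * a) = 1 / exp (- (real p * a))" by (simp add: exp_minus inverse_eq_divide)
  also have "\<dots> \<le> 1 / sqrt ((1 - 2 * a) ^ p)" using le assms by (intro divide_left_mono) auto
  finally show ?thesis unfolding eq by (intro ennreal_leI)
qed

text \<open>The moment generating function of the square of the standard normal variable q.g. An
  upper bound suffices, so the determinant of I - 2 \<tau> qq' is only estimated from below.\<close>

lemma standard_normal_projection:
  assumes q: "q \<in> carrier_vec p" "q \<bullet> q = 1" and \<tau>: "0 \<le> \<tau>" "\<tau> < 1 / 2"
  shows "(\<integral>\<^sup>+g. ennreal (exp (\<tau> * (q \<bullet> g)\<^sup>2)) \<partial>normal_vec (1\<^sub>m p)) \<le> ennreal (1 / sqrt (1 - 2 * \<tau>))"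
proof -
  define G where "G = (2 * \<tau>) \<cdot>\<^sub>m outer_prod q"
  have V: "outer_prod q \<in> carrier_mat p p" using q by simp
  have G: "G \<in> carrier_mat p p" using V by (simp add: G_def)
  have quad: "g \<bullet> (G *\<^sub>v g) = 2 * \<tau> * (q \<bullet> g)\<^sup>2" if g: "g \<in> carrier_vec p" for g
    using g q V comm_scalar_prod[OF q(1) g]
    by (simp add: G_def smult_mat_mult_vec[of _ p p] outer_prod_mult_vec[OF q(1) g] power2_eq_square)
  have symG: "transpose_mat G = G" using q by (auto intro!: eq_matI simp: G_def outer_prod_def)
  have "0 < v \<bullet> ((1\<^sub>m p - G) *\<^sub>v v)" if v: "v \<in> carrier_vec p" "v \<noteq> 0\<^sub>v p" for v
  proof -
    have "v \<bullet> ((1\<^sub>m p - G) *\<^sub>v v) = v \<bullet> v - 2 * \<tau> * (q \<bullet> v)\<^sup>2"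
      using v G quad[OF v(1)] by (simp add: minus_mult_distrib_mat_vec[of _ p p] scalar_prod_minus_distrib[of _ p])
    moreover have "2 * \<tau> * (q \<bullet> v)\<^sup>2 \<le> 2 * \<tau> * (v \<bullet> v)"
      using unit_cauchy_schwarz[OF q v(1)] \<tau> by (intro mult_left_mono) auto
    moreover have "v \<bullet> v > 0"
      using v scalar_prod_self_eq_0[of v p] scalar_prod_self_nonneg[of v] by (auto simp: less_le)
    moreover have "2 * \<tau> * (v \<bullet> v) < 1 * (v \<bullet> v)" using \<tau> \<open>v \<bullet> v > 0\<close> by (intro mult_strict_right_mono) auto
    ultimately show ?thesis by linarith
  qed
  moreover have "transpose_mat (1\<^sub>m p - G) = 1\<^sub>m p - G" using G symG by (simp add: transpose_minus[of _ p p])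
  ultimately have pd: "pos_def (1\<^sub>m p - G)" using G by (auto simp: pos_def_def)
  have psdG: "pos_semidef G" using G symG quad \<tau> by (auto simp: pos_semidef_def)
  have psd1: "pos_semidef (1\<^sub>m p)" using scalar_prod_self_nonneg by (auto simp: pos_semidef_def)
  have "mat_trace G = (\<Sum>i<p. 2 * \<tau> * (q $ i * q $ i))"
    using q by (auto simp: mat_trace_def G_def outer_prod_def intro!: sum.cong)
  also have "\<dots> = 2 * \<tau>" using scalar_prod_sum[OF q(1), of q] q(2) by (simp add: sum_distrib_left[symmetric])
  finally have trG: "mat_trace G = 2 * \<tau>" .
  \<comment> \<open>The determinant inequality for products, taken with the identity as second
    factor.\<close>
  have "1 - 2 * \<tau> \<le> det (1\<^sub>m p - G)"
    using det_one_minus_mult_ge[OF G psdG _ psd1] G \<tau> by (simp add: trG)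
  then have le: "sqrt (1 - 2 * \<tau>) \<le> sqrt (det (1\<^sub>m p - G))" by (rule real_sqrt_le_mono)
  have "(\<integral>\<^sup>+g. ennreal (exp (\<tau> * (q \<bullet> g)\<^sup>2)) \<partial>normal_vec (1\<^sub>m p)) = (\<integral>\<^sup>+g. ennreal (exp (g \<bullet> (G *\<^sub>v g) / 2)) \<partial>normal_vec (1\<^sub>m p))"
    by (rule nn_integral_cong) (simp add: quad)
  also have "\<dots> = ennreal (1 / sqrt (det (1\<^sub>m p - G)))" by (rule nn_integral_standard_normal_quadratic[OF G pd])
  also have "\<dots> \<le> ennreal (1 / sqrt (1 - 2 * \<tau>))"
    using le \<tau> by (intro ennreal_leI divide_left_mono) (auto intro: order_less_le_trans)
  finally show ?thesis .
qed

text \<open>Multiplying the fixed direction \<open>e\<close> by an independent Gaussian length turns it into a Gaussian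
  vector, by rotation invariance; Jensen's inequality says that this can only increase the moment.\<close>

lemma uniform_stiefel_exp_moment:
  assumes \<nu>: "uniform_stiefel p r \<nu>" and j: "j < r" and e: "e \<in> carrier_vec p" "e \<bullet> e = 1"
    and \<tau>: "0 \<le> \<tau>" "\<tau> < 1 / 2"
  shows "(\<integral>\<^sup>+Q. ennreal (exp (real p * \<tau> * (col Q j \<bullet> e)\<^sup>2)) \<partial>\<nu>) \<le> ennreal (1 / sqrt (1 - 2 * \<tau>))"
proof -
  define \<Gamma> :: "real vec measure" where "\<Gamma> = normal_vec (1\<^sub>m p)"
  note sp = uniform_stiefel_sets[OF \<nu>]
  interpret \<nu>: prob_space \<nu> using \<nu> by (simp add: uniform_stiefel_def)
  interpret \<Gamma>: prob_space \<Gamma> unfolding \<Gamma>_def by (rule prob_space_standard_normal)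
  interpret pair_sigma_finite \<nu> \<Gamma> ..
  have sets\<Gamma>: "sets \<Gamma> = sets (borel_vec p)" by (simp add: \<Gamma>_def)
  have id\<Gamma>: "(\<lambda>g. g) \<in> \<Gamma> \<rightarrow>\<^sub>M borel_vec p" by (rule measurable_ident_sets[OF sets\<Gamma>])
  have colm: "(\<lambda>Q. col Q j) \<in> \<nu> \<rightarrow>\<^sub>M borel_vec p" by (rule measurable_col[OF sp(2) j])
  have ipm: "(\<lambda>Q. col Q j \<bullet> x) \<in> borel_measurable \<nu>" if "x \<in> carrier_vec p" for x
    by (intro measurable_scalar_prod[of _ _ p] colm measurable_const) (use that in simp)
  have [measurable]: "(\<lambda>Q. col Q j \<bullet> e) \<in> borel_measurable \<nu>" by (rule ipm[OF e(1)])
  have [measurable]: "(\<lambda>g. g \<bullet> g) \<in> borel_measurable \<Gamma>"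
    by (intro measurable_scalar_prod[of _ _ p] id\<Gamma>)
  have [measurable]: "(\<lambda>(Q, g). col Q j \<bullet> g) \<in> borel_measurable (\<nu> \<Otimes>\<^sub>M \<Gamma>)"
    unfolding case_prod_beta'
    by (intro measurable_scalar_prod[of _ _ p] measurable_compose[OF measurable_fst colm] measurable_compose[OF measurable_snd id\<Gamma>])
  have "(\<integral>\<^sup>+Q. ennreal (exp (real p * \<tau> * (col Q j \<bullet> e)\<^sup>2)) \<partial>\<nu>)
    \<le> (\<integral>\<^sup>+Q. \<integral>\<^sup>+g. ennreal (exp (\<tau> * (g \<bullet> g) * (col Q j \<bullet> e)\<^sup>2)) \<partial>\<Gamma> \<partial>\<nu>)"
  proof (rule nn_integral_mono)
    fix Q assume "Q \<in> space \<nu>"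
    then have Q: "Q \<in> stiefel p r" using sp by simp
    \<comment> \<open>Jensen is applied for each fixed Q with a = \<tau> (col Q j . e)^2;
      Cauchy-Schwarz keeps a below 1/2.\<close>
    have "(col Q j \<bullet> e)\<^sup>2 \<le> 1" using unit_cauchy_schwarz[OF stiefel_col_unit[OF Q j] e(1)] e(2) by simp
    then have "\<tau> * (col Q j \<bullet> e)\<^sup>2 \<le> \<tau>" using \<tau> by (intro mult_left_le)
    then show "ennreal (exp (real p * \<tau> * (col Q j \<bullet> e)\<^sup>2)) \<le> (\<integral>\<^sup>+g. ennreal (exp (\<tau> * (g \<bullet> g) * (col Q j \<bullet> e)\<^sup>2)) \<partial>\<Gamma>)"
      using exp_le_standard_normal[of "\<tau> * (col Q j \<bullet> e)\<^sup>2" p] \<tau> by (simp add: \<Gamma>_def mult_ac)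
  qed
  also have "\<dots> = (\<integral>\<^sup>+g. \<integral>\<^sup>+Q. ennreal (exp (\<tau> * (g \<bullet> g) * (col Q j \<bullet> e)\<^sup>2)) \<partial>\<nu> \<partial>\<Gamma>)"
    by (rule Fubini'[symmetric]) measurable
  also have "\<dots> = (\<integral>\<^sup>+g. \<integral>\<^sup>+Q. ennreal (exp (\<tau> * (col Q j \<bullet> g)\<^sup>2)) \<partial>\<nu> \<partial>\<Gamma>)"
  proof (rule nn_integral_cong)
    fix g assume "g \<in> space \<Gamma>"
    then have g: "g \<in> carrier_vec p" by (simp add: \<Gamma>_def)
    \<comment> \<open>s e has the length of g, so a reflection U takes it to g. Replacing Q by UQ
      does not change the integral, and the symmetric U then passes from the column to s e.\<close>
    define s where "s = sqrt (g \<bullet> g)"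
    have ss: "s\<^sup>2 = g \<bullet> g" by (simp add: s_def scalar_prod_self_nonneg)
    have se: "s \<cdot>\<^sub>v e \<in> carrier_vec p" using e by simp
    have "(s \<cdot>\<^sub>v e) \<bullet> (s \<cdot>\<^sub>v e) = g \<bullet> g" using e ss by (simp add: power2_eq_square)
    then obtain U where U: "U \<in> carrier_mat p p" "transpose_mat U = U" "U * U = 1\<^sub>m p" "U *\<^sub>v (s \<cdot>\<^sub>v e) = g"
      using householder[OF se g] by metis
    have "(\<integral>\<^sup>+Q. ennreal (exp (\<tau> * (g \<bullet> g) * (col Q j \<bullet> e)\<^sup>2)) \<partial>\<nu>)
      = (\<integral>\<^sup>+Q. ennreal (exp (\<tau> * (col Q j \<bullet> (s \<cdot>\<^sub>v e))\<^sup>2)) \<partial>\<nu>)"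
    proof (rule nn_integral_cong)
      fix Q assume "Q \<in> space \<nu>"
      then have "col Q j \<in> carrier_vec p" using sp stiefel_col_unit[OF _ j] by auto
      then have "col Q j \<bullet> (s \<cdot>\<^sub>v e) = s * (col Q j \<bullet> e)" using e by simp
      then show "ennreal (exp (\<tau> * (g \<bullet> g) * (col Q j \<bullet> e)\<^sup>2)) = ennreal (exp (\<tau> * (col Q j \<bullet> (s \<cdot>\<^sub>v e))\<^sup>2))"
        by (simp add: power_mult_distrib ss mult_ac)
    qed
    also have "\<dots> = (\<integral>\<^sup>+Q. ennreal (exp (\<tau> * (col (U * Q) j \<bullet> (s \<cdot>\<^sub>v e))\<^sup>2)) \<partial>\<nu>)"
    proof (rule uniform_stiefel_rotate[symmetric, OF \<nu> U(1)])
      show "transpose_mat U * U = 1\<^sub>m p" using U by simp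
      have [measurable]: "(\<lambda>Q. col Q j \<bullet> (s \<cdot>\<^sub>v e)) \<in> borel_measurable \<nu>" by (rule ipm[OF se])
      show "(\<lambda>Q. ennreal (exp (\<tau> * (col Q j \<bullet> (s \<cdot>\<^sub>v e))\<^sup>2))) \<in> borel_measurable \<nu>" by measurable
    qed
    also have "\<dots> = (\<integral>\<^sup>+Q. ennreal (exp (\<tau> * (col Q j \<bullet> g)\<^sup>2)) \<partial>\<nu>)"
    proof (rule nn_integral_cong)
      fix Q assume "Q \<in> space \<nu>"
      then have Q: "Q \<in> stiefel p r" using sp by simp
      have c: "col Q j \<in> carrier_vec p" using stiefel_col_unit[OF Q j] by simp
      have "col (U * Q) j = U *\<^sub>v col Q j" by (rule col_mult2[OF U(1) stiefelD(1)[OF Q] j])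
      then have "col (U * Q) j \<bullet> (s \<cdot>\<^sub>v e) = col Q j \<bullet> g"
        using scalar_prod_mult_mat_vec_transpose[OF U(1) c se] U by simp
      then show "ennreal (exp (\<tau> * (col (U * Q) j \<bullet> (s \<cdot>\<^sub>v e))\<^sup>2)) = ennreal (exp (\<tau> * (col Q j \<bullet> g)\<^sup>2))" by simp
    qed
    finally show "(\<integral>\<^sup>+Q. ennreal (exp (\<tau> * (g \<bullet> g) * (col Q j \<bullet> e)\<^sup>2)) \<partial>\<nu>) = (\<integral>\<^sup>+Q. ennreal (exp (\<tau> * (col Q j \<bullet> g)\<^sup>2)) \<partial>\<nu>)" .
  qed
  \<comment> \<open>Exchanging the order again fixes Q; its column is a unit vector and g is
    Gaussian.\<close>
  also have "\<dots> = (\<integral>\<^sup>+Q. \<integral>\<^sup>+g. ennreal (exp (\<tau> * (col Q j \<bullet> g)\<^sup>2)) \<partial>\<Gamma> \<partial>\<nu>)"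
    by (rule Fubini') measurable
  also have "\<dots> \<le> (\<integral>\<^sup>+Q. ennreal (1 / sqrt (1 - 2 * \<tau>)) \<partial>\<nu>)"
  proof (rule nn_integral_mono)
    fix Q assume "Q \<in> space \<nu>"
    then have Q: "Q \<in> stiefel p r" using sp by simp
    show "(\<integral>\<^sup>+g. ennreal (exp (\<tau> * (col Q j \<bullet> g)\<^sup>2)) \<partial>\<Gamma>) \<le> ennreal (1 / sqrt (1 - 2 * \<tau>))"
      unfolding \<Gamma>_def by (rule standard_normal_projection[OF stiefel_col_unit[OF Q j] \<tau>])
  qed
  also have "\<dots> = ennreal (1 / sqrt (1 - 2 * \<tau>))" by (simp add: \<nu>.emeasure_space_1)
  finally show ?thesis .
qed

section \<open>The likelihood ratio\<close>

definition spike_ratio :: "nat \<Rightarrow> real mat \<Rightarrow> real mat \<Rightarrow> real vec \<Rightarrow> real" where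
  "spike_ratio p D Q x = exp (x \<bullet> ((Q * inverse_spike D * transpose_mat Q) *\<^sub>v x) / 2) /
     sqrt (det (1\<^sub>m p + Q * D * transpose_mat Q))"

text \<open>The two determinants are reciprocal, and that of the positive definite I - G is
  positive.\<close>

lemma spiked_det_pos:
  assumes Q: "Q \<in> stiefel p r" and D: "D \<in> carrier_mat r r" "pos_semidef D"
    and \<epsilon>: "\<And>v. v \<in> carrier_vec r \<Longrightarrow> (D *\<^sub>v v) \<bullet> (D *\<^sub>v v) \<le> \<epsilon>\<^sup>2 * (v \<bullet> v)" "\<epsilon>\<^sup>2 < 1"
  shows "0 < det (1\<^sub>m p + Q * D * transpose_mat Q)"
    "det (1\<^sub>m p + Q * D * transpose_mat Q) * det (1\<^sub>m p - Q * inverse_spike D * transpose_mat Q) = 1"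
proof -
  define S T where "S = 1\<^sub>m p + Q * D * transpose_mat Q" and "T = 1\<^sub>m p - Q * inverse_spike D * transpose_mat Q"
  have A: "Q * D * transpose_mat Q \<in> carrier_mat p p" "Q * inverse_spike D * transpose_mat Q \<in> carrier_mat p p"
    using stiefelD[OF Q] D inverse_spike[OF D] by auto
  have S: "S \<in> carrier_mat p p" and T: "T \<in> carrier_mat p p"
    unfolding S_def T_def by (intro add_carrier_mat minus_carrier_mat A)+
  have "det S * det T = det (1\<^sub>m p :: real mat)"
    using spiked_inverse(1)[OF Q D] det_mult[OF S T] by (simp add: S_def T_def)
  then show *: "det (1\<^sub>m p + Q * D * transpose_mat Q) * det (1\<^sub>m p - Q * inverse_spike D * transpose_mat Q) = 1"
    by (simp add: S_def T_def)
  have "pos_def T" unfolding T_def by (rule pos_def_two_spikes(1)[OF Q Q D \<epsilon>])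
  then have "det T > 0" by (rule gaussian_integral(1)[OF T])
  moreover have "0 < det S * det T" using * by (simp add: S_def T_def)
  ultimately have "0 < det S" by (rule zero_less_mult_pos2[rotated])
  then show "0 < det (1\<^sub>m p + Q * D * transpose_mat Q)" by (simp add: S_def)
qed

lemma spiked_normal_density:
  assumes Q: "Q \<in> stiefel p r" and D: "D \<in> carrier_mat r r" "pos_semidef D"
    and \<epsilon>: "\<And>v. v \<in> carrier_vec r \<Longrightarrow> (D *\<^sub>v v) \<bullet> (D *\<^sub>v v) \<le> \<epsilon>\<^sup>2 * (v \<bullet> v)" "\<epsilon>\<^sup>2 < 1"
  shows "normal_vec (1\<^sub>m p + Q * D * transpose_mat Q) = density (normal_vec (1\<^sub>m p)) (\<lambda>x. ennreal (spike_ratio p D Q x))"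
  unfolding spike_ratio_def
proof (rule normal_vec_density)
  have A: "Q * D * transpose_mat Q \<in> carrier_mat p p" 
    using stiefelD[OF Q] D by auto
  show "1\<^sub>m p + Q * D * transpose_mat Q \<in> carrier_mat p p" by (intro add_carrier_mat A)
  show "Q * inverse_spike D * transpose_mat Q \<in> carrier_mat p p"
    using stiefelD[OF Q] inverse_spike[OF D] by auto
qed (fact spiked_inverse[OF Q D], fact spiked_inverse[OF Q D], rule spiked_det_pos[OF Q D \<epsilon>])

lemma measurable_spike_ratio:
  assumes f: "f \<in> M \<rightarrow>\<^sub>M borel_mat p r" and g: "g \<in> M \<rightarrow>\<^sub>M borel_vec p"
    and D: "D \<in> carrier_mat r r" "pos_semidef D"
  shows "(\<lambda>w. spike_ratio p D (f w) (g w)) \<in> borel_measurable M"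
proof -
  have [measurable]: "(\<lambda>w. g w \<bullet> ((f w * inverse_spike D * transpose_mat (f w)) *\<^sub>v g w)) \<in> borel_measurable M"
    by (intro measurable_scalar_prod[of _ _ p] measurable_mult_mat_vec[of _ _ p p] measurable_mult_mat[of _ _ p r _ p]
        measurable_mult_mat[of _ _ p r _ r] measurable_transpose_mat measurable_const_mat f g inverse_spike[OF D])
  have [measurable]: "(\<lambda>w. det (1\<^sub>m p + f w * D * transpose_mat (f w))) \<in> borel_measurable M"
    by (intro measurable_det[of _ _ p] measurable_add_mat measurable_mult_mat[of _ _ p r _ p]
        measurable_mult_mat[of _ _ p r _ r] measurable_transpose_mat measurable_const_mat f D one_carrier_mat)
  show ?thesis unfolding spike_ratio_def by measurable
qed

lemma measurable_spike_ratio_vec: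
  assumes Q: "Q \<in> stiefel p r" and D: "D \<in> carrier_mat r r" "pos_semidef D"
  shows "spike_ratio p D Q \<in> borel_measurable (normal_vec (1\<^sub>m p))"
proof -
  have "(\<lambda>x. spike_ratio p D Q x) \<in> borel_measurable (normal_vec (1\<^sub>m p))"
    by (rule measurable_spike_ratio[OF measurable_const_mat[OF stiefelD(1)[OF Q]] _ D])
      (rule measurable_ident_sets, simp)
  then show ?thesis by simp
qed

lemma nn_integral_spike_ratio:
  assumes Q: "Q \<in> stiefel p r" and D: "D \<in> carrier_mat r r" "pos_semidef D"
    and \<epsilon>: "\<And>v. v \<in> carrier_vec r \<Longrightarrow> (D *\<^sub>v v) \<bullet> (D *\<^sub>v v) \<le> \<epsilon>\<^sup>2 * (v \<bullet> v)" "\<epsilon>\<^sup>2 < 1"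
  shows "(\<integral>\<^sup>+x. ennreal (spike_ratio p D Q x) \<partial>normal_vec (1\<^sub>m p)) = 1"
proof -
  define G where "G = Q * inverse_spike D * transpose_mat Q"
  define s where "s = det (1\<^sub>m p + Q * D * transpose_mat Q)"
  have G: "G \<in> carrier_mat p p" using stiefelD[OF Q] inverse_spike[OF D] by (auto simp: G_def)
  have pd: "pos_def (1\<^sub>m p - G)" unfolding G_def by (rule pos_def_two_spikes(1)[OF Q Q D \<epsilon>])
  have det: "0 < det (1\<^sub>m p - G)" by (rule gaussian_integral(1)[of _ p, OF _ pd]) (intro minus_carrier_mat G)
  have s: "s > 0" "s * det (1\<^sub>m p - G) = 1" using spiked_det_pos[OF Q D \<epsilon>] by (auto simp: s_def G_def)
  have m: "(\<lambda>x. x \<bullet> (G *\<^sub>v x)) \<in> borel_measurable (normal_vec (1\<^sub>m p))"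
    using measurable_quadratic_form[OF G] by (simp cong: measurable_cong_sets)
  have "(\<integral>\<^sup>+x. ennreal (spike_ratio p D Q x) \<partial>normal_vec (1\<^sub>m p))
    = (\<integral>\<^sup>+x. ennreal (1 / sqrt s) * ennreal (exp (x \<bullet> (G *\<^sub>v x) / 2)) \<partial>normal_vec (1\<^sub>m p))"
    using s by (intro nn_integral_cong) (simp add: spike_ratio_def ennreal_mult[symmetric] s_def G_def)
  also have "\<dots> = ennreal (1 / sqrt s) * ennreal (1 / sqrt (det (1\<^sub>m p - G)))"
    using m by (simp add: nn_integral_cmult nn_integral_standard_normal_quadratic[OF G pd])
  also have "\<dots> = ennreal (1 / sqrt (s * det (1\<^sub>m p - G)))"
    using s(1) det by (simp add: ennreal_mult[symmetric] real_sqrt_mult)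
  finally show ?thesis using s by simp
qed

text \<open>The exponents add up to the form of G + G', so this is again a Gaussian integral; its
  determinant merges with the two normalisations into that of I - AA'.\<close>

lemma nn_integral_spike_ratio_mult:
  assumes Q: "Q \<in> stiefel p r" "Q' \<in> stiefel p r" and D: "D \<in> carrier_mat r r" "pos_semidef D"
    and \<epsilon>: "\<And>v. v \<in> carrier_vec r \<Longrightarrow> (D *\<^sub>v v) \<bullet> (D *\<^sub>v v) \<le> \<epsilon>\<^sup>2 * (v \<bullet> v)" "\<epsilon>\<^sup>2 < 1"
  shows "(\<integral>\<^sup>+x. ennreal (spike_ratio p D Q x) * ennreal (spike_ratio p D Q' x) \<partial>normal_vec (1\<^sub>m p))
    = ennreal (1 / sqrt (det (1\<^sub>m p - (Q * D * transpose_mat Q) * (Q' * D * transpose_mat Q'))))"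
proof -
  define G G' where "G = Q * inverse_spike D * transpose_mat Q" and "G' = Q' * inverse_spike D * transpose_mat Q'"
  define s s' where "s = det (1\<^sub>m p + Q * D * transpose_mat Q)" and "s' = det (1\<^sub>m p + Q' * D * transpose_mat Q')"
  have G: "G \<in> carrier_mat p p" and G': "G' \<in> carrier_mat p p"
    using stiefelD[OF Q(1)] stiefelD[OF Q(2)] inverse_spike[OF D] by (auto simp: G_def G'_def)
  have GG: "G + G' \<in> carrier_mat p p" using G G' by simp
  have pd: "pos_def (1\<^sub>m p - (G + G'))" unfolding G_def G'_def by (rule pos_def_two_spikes(2)[OF Q D \<epsilon>])
  have det: "det (1\<^sub>m p - (G + G')) > 0"
    by (rule gaussian_integral(1)[of _ p, OF _ pd]) (intro minus_carrier_mat GG)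
  have s: "s > 0" "s' > 0" using spiked_det_pos(1)[OF Q(1) D \<epsilon>] spiked_det_pos(1)[OF Q(2) D \<epsilon>] by (auto simp: s_def s'_def)
  have m: "(\<lambda>x. x \<bullet> ((G + G') *\<^sub>v x)) \<in> borel_measurable (normal_vec (1\<^sub>m p))"
    using measurable_quadratic_form[OF GG] by (simp cong: measurable_cong_sets)
  have "(\<integral>\<^sup>+x. ennreal (spike_ratio p D Q x) * ennreal (spike_ratio p D Q' x) \<partial>normal_vec (1\<^sub>m p))
    = (\<integral>\<^sup>+x. ennreal (1 / (sqrt s * sqrt s')) * ennreal (exp (x \<bullet> ((G + G') *\<^sub>v x) / 2)) \<partial>normal_vec (1\<^sub>m p))"
  proof (rule nn_integral_cong)
    fix x assume "x \<in> space (normal_vec (1\<^sub>m p))"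
    then have x: "x \<in> carrier_vec p" by simp
    have "x \<bullet> ((G + G') *\<^sub>v x) = x \<bullet> (G *\<^sub>v x) + x \<bullet> (G' *\<^sub>v x)"
      using x G G' by (simp add: add_mult_distrib_mat_vec[of _ p p] scalar_prod_add_distrib[of _ p])
    then have "exp (x \<bullet> ((G + G') *\<^sub>v x) / 2) = exp (x \<bullet> (G *\<^sub>v x) / 2) * exp (x \<bullet> (G' *\<^sub>v x) / 2)"
      by (simp add: exp_add[symmetric] add_divide_distrib)
    then show "ennreal (spike_ratio p D Q x) * ennreal (spike_ratio p D Q' x)
      = ennreal (1 / (sqrt s * sqrt s')) * ennreal (exp (x \<bullet> ((G + G') *\<^sub>v x) / 2))"
      using s by (simp add: spike_ratio_def ennreal_mult[symmetric] G_def[symmetric] G'_def[symmetric] s_def[symmetric] s'_def[symmetric])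
  qed
  also have "\<dots> = ennreal (1 / (sqrt s * sqrt s')) * ennreal (1 / sqrt (det (1\<^sub>m p - (G + G'))))"
    using m by (simp add: nn_integral_cmult nn_integral_standard_normal_quadratic[OF GG pd])
  also have "\<dots> = ennreal (1 / sqrt (s * det (1\<^sub>m p - (G + G')) * s'))"
    using s det by (simp add: ennreal_mult[symmetric] real_sqrt_mult mult_ac)
  finally show ?thesis
    using det_two_spikes[OF Q D] by (simp add: G_def G'_def s_def s'_def)
qed

text \<open>Jensen with equal weights: the sum is the mean of the terms multiplied by the
  cardinality. It reduces an exponential of dependent terms to their individual moments.\<close>

lemma exp_weighted_mean_le:
  fixes y :: "'b \<Rightarrow> real"
  assumes "finite I" "I \<noteq> {}"
  shows "exp (\<Sum>i\<in>I. y i) \<le> (\<Sum>i\<in>I. exp (real (card I) * y i)) / real (card I)"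
proof -
  define c where "c = real (card I)"
  have c: "c > 0" using assms by (simp add: c_def card_gt_0_iff)
  have "exp (\<Sum>i\<in>I. (1 / c) *\<^sub>R (c * y i)) \<le> (\<Sum>i\<in>I. (1 / c) * exp (c * y i))"
    by (rule convex_on_sum[OF assms exp_convex]) (use c in \<open>auto simp: c_def\<close>)
  then show ?thesis using c by (simp add: c_def sum_divide_distrib)
qed

lemma spike_second_moment_le:
  assumes Q: "Q \<in> stiefel p r" "Q' \<in> stiefel p r" and D: "D \<in> carrier_mat r r" "pos_semidef D"
    and \<epsilon>: "\<And>v. v \<in> carrier_vec r \<Longrightarrow> (D *\<^sub>v v) \<bullet> (D *\<^sub>v v) \<le> \<epsilon>\<^sup>2 * (v \<bullet> v)"
    and small: "(\<epsilon> * real r)\<^sup>2 \<le> 1 / 4" and r: "0 < r" and n: "n \<le> p"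
  shows "(1 / sqrt (det (1\<^sub>m p - (Q * D * transpose_mat Q) * (Q' * D * transpose_mat Q')))) ^ n
    \<le> (\<Sum>j<r. \<Sum>k<r. exp (real p * (\<epsilon> * real r)\<^sup>2 * (col Q' k \<bullet> col Q j)\<^sup>2)) / real (r * r)"
proof -
  define A A' where "A = Q * D * transpose_mat Q" and "A' = Q' * D * transpose_mat Q'"
  define m where "m j k = col Q' k \<bullet> col Q j" for j k
  define t where "t = \<epsilon>\<^sup>2 * (\<Sum>j<r. \<Sum>k<r. (m j k)\<^sup>2)"
  note Qc = stiefelD[OF Q(1)] stiefelD[OF Q(2)]
  have A: "A \<in> carrier_mat p p" "A' \<in> carrier_mat p p" using Qc D by (auto simp: A_def A'_def)
  have psd: "pos_semidef A" "pos_semidef A'"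
    unfolding A_def A'_def by (rule conjugate_pos_semidef[OF _ D], fact Qc)+
  have frob: "frobenius_sq (transpose_mat Q * Q') = (\<Sum>j<r. \<Sum>k<r. (m j k)\<^sup>2)"
  proof -
    have "(transpose_mat Q * Q') $$ (j, k) = m j k" if "j < r" "k < r" for j k
      using Qc that comm_scalar_prod[of "col Q j" p "col Q' k"] by (auto simp: m_def)
    then show ?thesis using Qc by (simp add: frobenius_sq_def)
  qed
  have tr: "mat_trace (A * A') \<le> t"
    using trace_two_spikes[OF Q D(1) \<epsilon>] by (simp add: A_def A'_def t_def frob)
  have "m j k ^ 2 \<le> 1" if "j < r" "k < r" for j k
    using unit_cauchy_schwarz[OF stiefel_col_unit[OF Q(2) that(2)] stiefel_col_unit(1)[OF Q(1) that(1)]]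
      stiefel_col_unit(2)[OF Q(1) that(1)] by (simp add: m_def)
  then have "(\<Sum>j<r. \<Sum>k<r. (m j k)\<^sup>2) \<le> (\<Sum>j<r. \<Sum>k<r. 1)" by (intro sum_mono) auto
  \<comment> \<open>The trivial bound 1 on the squared entries is used only to keep t away from 1;
    their true size enters later through the exponential moment.\<close>
  then have "t \<le> \<epsilon>\<^sup>2 * (real r * real r)" unfolding t_def by (intro mult_left_mono) auto
  also have "\<dots> = (\<epsilon> * real r)\<^sup>2" by (simp add: power2_eq_square)
  finally have t1: "t \<le> 1 / 4" using small by linarith
  have t0: "0 \<le> t" by (auto simp: t_def intro!: mult_nonneg_nonneg sum_nonneg)
  have "1 - t \<le> det (1\<^sub>m p - A * A')"
    using det_one_minus_mult_ge[OF A(1) psd(1) A(2) psd(2)] tr t1 by simp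
  \<comment> \<open>The 2 in the exponent is halved by the square root, leaving exp t per
    observation. The inequality comes from (1 - t)(1 + 2t) \<ge> 1 for t in [0, 1/2].\<close>
  moreover have "exp (- 2 * t) \<le> 1 - t"
  proof -
    have "t * t \<le> t * (1 / 4)" using t0 t1 by (intro mult_left_mono)
    then have "1 \<le> (1 - t) * (1 + 2 * t)" using t0 by (simp add: algebra_simps)
    also have "\<dots> \<le> (1 - t) * exp (2 * t)"
      using t1 exp_ge_add_one_self[of "2 * t"] by (intro mult_left_mono) auto
    finally show ?thesis by (simp add: exp_minus field_simps)
  qed
  ultimately have "exp (- 2 * t) \<le> det (1\<^sub>m p - A * A')" by linarith
  then have "sqrt (exp (- 2 * t)) \<le> sqrt (det (1\<^sub>m p - A * A'))" by (rule real_sqrt_le_mono)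
  moreover have "sqrt (exp (- 2 * t)) = exp (- t)"
    by (rule real_sqrt_unique) (simp_all add: exp_double[symmetric])
  ultimately have le: "exp (- t) \<le> sqrt (det (1\<^sub>m p - A * A'))" by (simp only:)
  have "1 / sqrt (det (1\<^sub>m p - A * A')) \<le> 1 / exp (- t)"
    using le less_le_trans[OF exp_gt_zero le] by (intro divide_left_mono mult_pos_pos) auto
  also have "\<dots> = exp t" by (simp add: exp_minus inverse_eq_divide)
  finally have "(1 / sqrt (det (1\<^sub>m p - A * A'))) ^ n \<le> exp t ^ n"
    using less_le_trans[OF exp_gt_zero le] by (intro power_mono) auto
  also have "\<dots> = exp (real n * t)" by (simp add: exp_of_nat_mult)
  \<comment> \<open>Replacing n by p matches the scale at which an entry, whose square has order
    1/p, has a bounded exponential moment.\<close>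
  also have "\<dots> \<le> exp (real p * t)" using n t0 by (simp add: mult_right_mono)
  also have "real p * t = (\<Sum>(j, k)\<in>{..<r} \<times> {..<r}. real p * \<epsilon>\<^sup>2 * (m j k)\<^sup>2)"
    by (simp add: t_def sum.cartesian_product[symmetric] sum_distrib_left mult.assoc)
  also have "exp \<dots> \<le> (\<Sum>jk\<in>{..<r} \<times> {..<r}. exp (real (card ({..<r} \<times> {..<r})) * (case jk of (j, k) \<Rightarrow> real p * \<epsilon>\<^sup>2 * (m j k)\<^sup>2)))
      / real (card ({..<r} \<times> {..<r}))"
    using r by (intro exp_weighted_mean_le) auto
  also have "\<dots> = (\<Sum>j<r. \<Sum>k<r. exp (real p * (\<epsilon> * real r)\<^sup>2 * (m j k)\<^sup>2)) / real (r * r)"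
    by (simp add: sum.cartesian_product case_prod_beta power_mult_distrib power2_eq_square mult_ac)
  finally show ?thesis by (simp add: A_def A'_def m_def)
qed

text \<open>The smallness condition serves three ends: \<epsilon>^2 < 1, for integrability of the
  product of two ratios; a trace of at most 1/4, for the determinant bound; and \<tau> = (\<epsilon>
  r)^2 < 1/2, for the exponential moment.\<close>

proposition error_sum_bound:
  assumes \<nu>: "uniform_stiefel p r \<nu>" and D: "D \<in> carrier_mat r r" "pos_semidef D"
    and \<epsilon>: "\<And>v. v \<in> carrier_vec r \<Longrightarrow> (D *\<^sub>v v) \<bullet> (D *\<^sub>v v) \<le> \<epsilon>\<^sup>2 * (v \<bullet> v)"
    and small: "(\<epsilon> * real r)\<^sup>2 \<le> 1 / 4" and r: "0 < r" and n: "n \<le> p"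
    and \<eta>: "0 < \<eta>" "1 / sqrt (1 - 2 * (\<epsilon> * real r)\<^sup>2) \<le> 1 + \<eta>\<^sup>2"
    and \<phi>: "\<phi> \<in> tests n p"
  shows "\<bar>type_I_error (null_law n p) \<phi> + type_II_error (alt_law n p D \<nu>) \<phi> - 1\<bar> \<le> \<eta>"
proof -
  define \<Gamma> :: "real vec measure" where "\<Gamma> = normal_vec (1\<^sub>m p)"
  define M where "M = (\<Pi>\<^sub>M i\<in>{..<n}. \<Gamma>)"
  define l where "l Q x = (\<Prod>i<n. ennreal (spike_ratio p D Q (x i)))" for Q and x :: "nat \<Rightarrow> real vec"
  define K where "K Q = normal_sample n (1\<^sub>m p + Q * D * transpose_mat Q)" for Q
  note sp = uniform_stiefel_sets[OF \<nu>]
  have \<epsilon>1: "\<epsilon>\<^sup>2 < 1"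
  proof -
    have "\<epsilon>\<^sup>2 * 1 \<le> \<epsilon>\<^sup>2 * (real r)\<^sup>2" using r by (intro mult_left_mono) (auto simp: power2_eq_square intro: mult_ge1_I)
    then show ?thesis using small by (simp add: power_mult_distrib)
  qed
  interpret \<nu>: prob_space \<nu> using \<nu> by (simp add: uniform_stiefel_def)
  have \<Gamma>: "prob_space \<Gamma>" unfolding \<Gamma>_def by (rule prob_space_standard_normal)
  then interpret P: product_prob_space "\<lambda>_::nat. \<Gamma>" by (intro product_prob_spaceI)
  have null: "null_law n p = M" by (simp add: null_law_def normal_sample_def M_def \<Gamma>_def)
  have M: "prob_space M" unfolding M_def by (intro prob_space_PiM \<Gamma>)
  have m\<Gamma>: "(\<lambda>x. ennreal (spike_ratio p D Q x)) \<in> borel_measurable \<Gamma>" if "Q \<in> stiefel p r" for Q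
    using measurable_spike_ratio_vec[OF that D] by (simp add: \<Gamma>_def)
  have l_meas: "(\<lambda>(Q, x). l Q x) \<in> borel_measurable (\<nu> \<Otimes>\<^sub>M M)"
    unfolding l_def case_prod_beta'
  proof (intro borel_measurable_prod_ennreal measurable_compose[OF _ measurable_ennreal])
    fix i assume i: "i \<in> {..<n}"
    have id: "(\<lambda>g. g) \<in> \<Gamma> \<rightarrow>\<^sub>M borel_vec p" by (rule measurable_ident_sets) (simp add: \<Gamma>_def)
    have "(\<lambda>x. x i) \<in> M \<rightarrow>\<^sub>M \<Gamma>" unfolding M_def using i by (rule measurable_component_singleton)
    from measurable_compose[OF this id] have "(\<lambda>x. x i) \<in> M \<rightarrow>\<^sub>M borel_vec p" .
    from measurable_compose[OF measurable_snd this] measurable_compose[OF measurable_fst sp(2)]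
    show "(\<lambda>z. spike_ratio p D (fst z) (snd z i)) \<in> borel_measurable (\<nu> \<Otimes>\<^sub>M M)"
      by (intro measurable_spike_ratio[OF _ _ D])
  qed
  have norm1: "(\<integral>\<^sup>+x. ennreal (spike_ratio p D Q x) \<partial>\<Gamma>) = 1" if "Q \<in> stiefel p r" for Q
    unfolding \<Gamma>_def by (rule nn_integral_spike_ratio[OF that D \<epsilon> \<epsilon>1])
  have norm: "(\<integral>\<^sup>+x. l Q x \<partial>M) = 1" if Q: "Q \<in> space \<nu>" for Q
  proof -
    have Q: "Q \<in> stiefel p r" using Q sp by simp
    have "(\<integral>\<^sup>+x. l Q x \<partial>M) = (\<Prod>i<n. \<integral>\<^sup>+x. ennreal (spike_ratio p D Q x) \<partial>\<Gamma>)"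
      unfolding l_def M_def by (rule P.product_nn_integral_prod) (auto intro: m\<Gamma>[OF Q])
    then show ?thesis using norm1[OF Q] by simp
  qed
  have K: "K Q = density M (l Q)" if Q: "Q \<in> space \<nu>" for Q
  proof -
    have Q: "Q \<in> stiefel p r" using Q sp by simp
    have "K Q = (\<Pi>\<^sub>M i\<in>{..<n}. density \<Gamma> (\<lambda>x. ennreal (spike_ratio p D Q x)))"
      unfolding K_def normal_sample_def \<Gamma>_def by (subst spiked_normal_density[OF Q D \<epsilon> \<epsilon>1]) auto
    also have "\<dots> = density M (\<lambda>x. \<Prod>i<n. ennreal (spike_ratio p D Q (x i)))"
      unfolding M_def by (rule PiM_density) (auto intro: m\<Gamma>[OF Q] \<Gamma> simp: norm1[OF Q])
    finally show ?thesis unfolding l_def .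
  qed
  define E where "E j k Q Q' = ennreal (exp (real p * (\<epsilon> * real r)\<^sup>2 * (col Q' k \<bullet> col Q j)\<^sup>2))" for j k Q Q'
  have second: "(\<integral>\<^sup>+Q. \<integral>\<^sup>+Q'. \<integral>\<^sup>+x. l Q x * l Q' x \<partial>M \<partial>\<nu> \<partial>\<nu>) \<le> ennreal (1 + \<eta>\<^sup>2)"
  proof -
    \<comment> \<open>The estimate holds for every fixed Q: its columns are then fixed unit
      directions and only Q' is random.\<close>
    have "(\<integral>\<^sup>+Q'. \<integral>\<^sup>+x. l Q x * l Q' x \<partial>M \<partial>\<nu>) \<le> ennreal (1 + \<eta>\<^sup>2)" if "Q \<in> space \<nu>" for Q
    proof -
      have Q: "Q \<in> stiefel p r" using that sp by simp
      have E_meas: "E j k Q \<in> borel_measurable \<nu>" if "j < r" "k < r" for j k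
      proof -
        have [measurable]: "(\<lambda>Q'. col Q' k \<bullet> col Q j) \<in> borel_measurable \<nu>"
          by (intro measurable_scalar_prod[of _ _ p] measurable_col[OF sp(2)] measurable_const that)
            (use stiefel_col_unit(1)[OF Q that(1)] in simp)
        show ?thesis unfolding E_def by measurable
      qed
      have "(\<integral>\<^sup>+Q'. \<integral>\<^sup>+x. l Q x * l Q' x \<partial>M \<partial>\<nu>) \<le> (\<integral>\<^sup>+Q'. ennreal (1 / real (r * r)) * (\<Sum>j<r. \<Sum>k<r. E j k Q Q') \<partial>\<nu>)"
      proof (rule nn_integral_mono)
        fix Q' assume "Q' \<in> space \<nu>"
        then have Q': "Q' \<in> stiefel p r" using sp by simp
        define J where "J = 1 / sqrt (det (1\<^sub>m p - (Q * D * transpose_mat Q) * (Q' * D * transpose_mat Q')))"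
        have J: "(\<integral>\<^sup>+x. ennreal (spike_ratio p D Q x) * ennreal (spike_ratio p D Q' x) \<partial>\<Gamma>) = ennreal J"
          unfolding J_def \<Gamma>_def by (rule nn_integral_spike_ratio_mult[OF Q Q' D \<epsilon> \<epsilon>1])
        have "(\<integral>\<^sup>+x. l Q x * l Q' x \<partial>M)
          = (\<integral>\<^sup>+x. (\<Prod>i<n. ennreal (spike_ratio p D Q (x i)) * ennreal (spike_ratio p D Q' (x i))) \<partial>M)"
          by (simp add: l_def prod.distrib)
        also have "\<dots> = (\<Prod>i<n. \<integral>\<^sup>+x. ennreal (spike_ratio p D Q x) * ennreal (spike_ratio p D Q' x) \<partial>\<Gamma>)"
          unfolding M_def using m\<Gamma>[OF Q] m\<Gamma>[OF Q'] by (intro P.product_nn_integral_prod) auto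
        also have "\<dots> = ennreal J ^ n" by (simp add: J)
        \<comment> \<open>\<open>ennreal\<close> truncates negative reals, and the sign of J has not
          been recorded here; \<open>max 0 J\<close> allows the power to be taken among the reals.
          For n = 0 both powers are 1.\<close>
        also have "\<dots> \<le> ennreal (max 0 J) ^ n" by (intro power_mono ennreal_leI) auto
        also have "\<dots> = ennreal (max 0 J ^ n)" by (rule ennreal_power) simp
        also have "max 0 J ^ n \<le> (\<Sum>j<r. \<Sum>k<r. exp (real p * (\<epsilon> * real r)\<^sup>2 * (col Q' k \<bullet> col Q j)\<^sup>2)) / real (r * r)"
        proof (cases "J < 0")
          case True
          show ?thesis
          proof (cases "n = 0")
            case True
            then show ?thesis using spike_second_moment_le[OF Q Q' D \<epsilon> small r n] by simp
          next
            case False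
            then show ?thesis using True by (auto simp: max_def zero_power intro!: divide_nonneg_nonneg sum_nonneg)
          qed
        next
          case False
          then show ?thesis using spike_second_moment_le[OF Q Q' D \<epsilon> small r n] by (simp add: J_def max_def)
        qed
        also have "ennreal \<dots> = ennreal (1 / real (r * r)) * (\<Sum>j<r. \<Sum>k<r. E j k Q Q')"
          by (simp add: E_def sum_nonneg ennreal_mult[symmetric])
        finally show "(\<integral>\<^sup>+x. l Q x * l Q' x \<partial>M) \<le> ennreal (1 / real (r * r)) * (\<Sum>j<r. \<Sum>k<r. E j k Q Q')"
          by (simp add: ennreal_leI)
      qed
      also have "\<dots> = ennreal (1 / real (r * r)) * (\<Sum>j<r. \<Sum>k<r. \<integral>\<^sup>+Q'. E j k Q Q' \<partial>\<nu>)"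
      proof -
        have "(\<integral>\<^sup>+Q'. (\<Sum>j<r. \<Sum>k<r. E j k Q Q') \<partial>\<nu>) = (\<Sum>j<r. \<integral>\<^sup>+Q'. (\<Sum>k<r. E j k Q Q') \<partial>\<nu>)"
          by (intro nn_integral_sum borel_measurable_sum E_meas) auto
        also have "\<dots> = (\<Sum>j<r. \<Sum>k<r. \<integral>\<^sup>+Q'. E j k Q Q' \<partial>\<nu>)"
          by (intro sum.cong nn_integral_sum E_meas) auto
        finally show ?thesis
          by (subst nn_integral_cmult) (auto intro!: borel_measurable_sum E_meas)
      qed
      also have "\<dots> \<le> ennreal (1 / real (r * r)) * (\<Sum>j<r. \<Sum>k<r. ennreal (1 + \<eta>\<^sup>2))"
      proof (intro mult_left_mono sum_mono)
        fix j k assume jk: "j \<in> {..<r}" "k \<in> {..<r}"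
        have "(\<integral>\<^sup>+Q'. E j k Q Q' \<partial>\<nu>) \<le> ennreal (1 / sqrt (1 - 2 * (\<epsilon> * real r)\<^sup>2))"
          unfolding E_def using jk small stiefel_col_unit[OF Q] by (intro uniform_stiefel_exp_moment[OF \<nu>]) auto
        also have "\<dots> \<le> ennreal (1 + \<eta>\<^sup>2)" by (intro ennreal_leI \<eta>)
        finally show "(\<integral>\<^sup>+Q'. E j k Q Q' \<partial>\<nu>) \<le> ennreal (1 + \<eta>\<^sup>2)" .
      qed simp
      also have "\<dots> = ennreal (1 / real (r * r)) * ennreal (real (r * r) * (1 + \<eta>\<^sup>2))"
        by (simp add: ennreal_mult ennreal_of_nat_eq_real_of_nat mult.assoc)
      also have "\<dots> = ennreal (1 + \<eta>\<^sup>2)" using r by (simp add: ennreal_mult[symmetric])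
      finally show ?thesis .
    qed
    then have "(\<integral>\<^sup>+Q. \<integral>\<^sup>+Q'. \<integral>\<^sup>+x. l Q x * l Q' x \<partial>M \<partial>\<nu> \<partial>\<nu>) \<le> (\<integral>\<^sup>+Q. ennreal (1 + \<eta>\<^sup>2) \<partial>\<nu>)"
      by (rule nn_integral_mono)
    then show ?thesis by (simp add: \<nu>.emeasure_space_1)
  qed
  have "sets M = sets (\<Pi>\<^sub>M i\<in>{..<n}. borel_vec p)"
    unfolding M_def by (rule sets_PiM_cong) (auto simp: \<Gamma>_def)
  then have \<phi>': "\<phi> \<in> borel_measurable M" "\<And>x. 0 \<le> \<phi> x" "\<And>x. \<phi> x \<le> 1"
    using \<phi> by (auto simp: tests_def cong: measurable_cong_sets)
  have "\<bar>(\<integral>x. \<phi> x \<partial>M) + (\<integral>x. 1 - \<phi> x \<partial>(\<nu> \<bind> K)) - 1\<bar> \<le> \<eta>"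
    by (rule mixture_error_sum[OF M \<nu>.prob_space_axioms l_meas norm K second \<eta>(1)]) (use \<phi>' in auto)
  then show ?thesis
    by (simp add: type_I_error_def type_II_error_def null alt_law_def K_def[abs_def])
qed

text \<open>The uniform estimate bounds the infimum from below; the test that never rejects shows
  that the set of tests is nonempty and bounds the infimum from above.\<close>

lemma inf_error_sum_bound:
  assumes \<nu>: "uniform_stiefel p r \<nu>" and D: "D \<in> carrier_mat r r" "pos_semidef D"
    and \<epsilon>: "spectral_norm D \<le> \<epsilon>"
    and small: "(\<epsilon> * real r)\<^sup>2 \<le> 1 / 4" and r: "0 < r" and n: "n \<le> p"
    and \<eta>: "0 < \<eta>" "1 / sqrt (1 - 2 * (\<epsilon> * real r)\<^sup>2) \<le> 1 + \<eta>\<^sup>2"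
  shows "\<bar>(INF \<phi>\<in>tests n p. type_I_error (null_law n p) \<phi> + type_II_error (alt_law n p D \<nu>) \<phi>) - 1\<bar> \<le> \<eta>"
proof -
  have b: "\<bar>type_I_error (null_law n p) \<phi> + type_II_error (alt_law n p D \<nu>) \<phi> - 1\<bar> \<le> \<eta>"
    if "\<phi> \<in> tests n p" for \<phi>
    by (rule error_sum_bound[OF \<nu> D _ small r n \<eta> that]) (rule spectral_norm_bound[OF D(1) \<epsilon>])
  have zero: "(\<lambda>_. 0) \<in> tests n p" by (simp add: tests_def)
  have "1 - \<eta> \<le> (INF \<phi>\<in>tests n p. type_I_error (null_law n p) \<phi> + type_II_error (alt_law n p D \<nu>) \<phi>)"
    by (rule cINF_greatest) (use zero b in \<open>force+\<close>)
  moreover have "(INF \<phi>\<in>tests n p. type_I_error (null_law n p) \<phi> + type_II_error (alt_law n p D \<nu>) \<phi>)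
    \<le> type_I_error (null_law n p) (\<lambda>_. 0) + type_II_error (alt_law n p D \<nu>) (\<lambda>_. 0)"
    by (rule cINF_lower[OF _ zero], rule bdd_belowI2[of _ "1 - \<eta>"]) (use b in force)
  ultimately show ?thesis using b[OF zero] by linarith
qed

text \<open>At n = 1 the value of \<delta> is 1 and the quotient \<delta>/(1 - \<delta>) divides by
  zero, hence the norm bound from n = 2 on. Each r n may be rounded in either direction,
  independently of the others.\<close>

theorem theorem1p5:
  fixes \<alpha> \<beta> c0 \<gamma> :: real
    and p r :: "nat \<Rightarrow> nat"
    and \<delta> :: "nat \<Rightarrow> real"
    and D :: "nat \<Rightarrow> real mat"
    and \<nu> :: "nat \<Rightarrow> real mat measure"
  assumes "0 < \<alpha>" "\<alpha> < 1" "0 < \<beta>" "\<beta> < 1" "0 < c0" "1 \<le> \<gamma>"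
    and "\<And>n. 1 \<le> n \<Longrightarrow> n \<le> p n"
    and "(\<lambda>n. real (p n) / real n) \<longlonglongrightarrow> \<gamma>"
    and "\<And>n. 1 \<le> n \<Longrightarrow> int (r n) \<in> {\<lfloor>real n powr (1 - \<beta>)\<rfloor>, \<lceil>real n powr (1 - \<beta>)\<rceil>}"
    and "\<And>n. 1 \<le> n \<Longrightarrow> \<delta> n = real n powr (- \<alpha>)"
    and "\<And>n. 1 \<le> n \<Longrightarrow> D n \<in> carrier_mat (r n) (r n)"
    and "\<And>n. 1 \<le> n \<Longrightarrow> pos_semidef (D n)"
    and "\<And>n. 1 \<le> n \<Longrightarrow> uniform_stiefel (p n) (r n) (\<nu> n)"
    and "\<alpha> + \<beta> > 1"
    and "\<And>n. 2 \<le> n \<Longrightarrow> spectral_norm (D n) \<le> c0 * (\<delta> n / (1 - \<delta> n))"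
  shows "(\<lambda>n. INF \<phi>\<in>tests n (p n).
            type_I_error (null_law n (p n)) \<phi> +
            type_II_error (alt_law n (p n) (D n) (\<nu> n)) \<phi>) \<longlonglongrightarrow> 1"
proof -
  define \<epsilon> where "\<epsilon> n = c0 * (\<delta> n / (1 - \<delta> n))" for n
  define \<kappa> where "\<kappa> n = \<epsilon> n * real (r n)" for n
  have \<delta>: "0 < \<delta> n" "\<delta> n < 1" if "2 \<le> n" for n
  proof -
    show "0 < \<delta> n" using assms(10)[of n] that by simp
    have "real n powr (- \<alpha>) < real n powr 0" using that assms(1) by (intro powr_less_mono) auto
    then show "\<delta> n < 1" using assms(10)[of n] that by simp
  qed
  have r_le: "real (r n) \<le> real n powr (1 - \<beta>) + 1" if "1 \<le> n" for n
  proof -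
    have "int (r n) \<le> \<lceil>real n powr (1 - \<beta>)\<rceil>" using assms(9)[OF that] by (auto simp: floor_le_ceiling)
    then have "real (r n) \<le> real_of_int \<lceil>real n powr (1 - \<beta>)\<rceil>" by linarith
    then show ?thesis by linarith
  qed
  \<comment> \<open>Both roundings are at least 1 because the exponent 1 - \<beta> is positive; the
    mean over r^2 entries needs r > 0.\<close>
  have r_pos: "0 < r n" if "1 \<le> n" for n
  proof -
    have "1 \<le> real n powr (1 - \<beta>)" using that assms(4) by (intro ge_one_powr_ge_zero) auto
    then have "1 \<le> \<lfloor>real n powr (1 - \<beta>)\<rfloor>" "1 \<le> \<lceil>real n powr (1 - \<beta>)\<rceil>" by linarith+
    then have "1 \<le> int (r n)" using assms(9)[OF that] by (auto simp del: one_le_floor one_le_ceiling)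
    then show ?thesis by simp
  qed
  have neg: "(\<lambda>n. real n powr (- \<alpha>)) \<longlonglongrightarrow> 0"
    using assms(1) by (intro tendsto_neg_powr filterlim_real_sequentially) auto
  have neg': "(\<lambda>n. real n powr (1 - \<alpha> - \<beta>)) \<longlonglongrightarrow> 0"
    using assms(14) by (intro tendsto_neg_powr filterlim_real_sequentially) auto
  have "\<kappa> \<longlonglongrightarrow> 0"
  proof (rule tendsto_sandwich)
    show "\<forall>\<^sub>F n in sequentially. 0 \<le> \<kappa> n"
      using eventually_ge_at_top[of 2]
    proof eventually_elim
      case (elim n)
      then show ?case using \<delta>[of n] assms(5) by (simp add: \<kappa>_def \<epsilon>_def)
    qed
    show "\<forall>\<^sub>F n in sequentially. \<kappa> n \<le> c0 * ((real n powr (1 - \<alpha> - \<beta>) + real n powr (- \<alpha>)) / (1 - real n powr (- \<alpha>)))"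
      using eventually_ge_at_top[of 2]
    proof eventually_elim
      case (elim n)
      have "\<kappa> n \<le> \<epsilon> n * (real n powr (1 - \<beta>) + 1)"
        unfolding \<kappa>_def using \<delta>[OF elim] assms(5) r_le[of n] elim by (intro mult_left_mono) (auto simp: \<epsilon>_def)
      also have "\<dots> = c0 * (real n powr (- \<alpha>) * (real n powr (1 - \<beta>) + 1) / (1 - real n powr (- \<alpha>)))"
        using assms(10)[of n] elim by (simp add: \<epsilon>_def)
      \<comment> \<open>The first exponent is negative by the hypothesis on \<alpha> + \<beta>. The
        second term is the cost of rounding.\<close>
      also have "real n powr (- \<alpha>) * (real n powr (1 - \<beta>) + 1) = real n powr (1 - \<alpha> - \<beta>) + real n powr (- \<alpha>)"
        using elim by (simp add: distrib_left powr_add[symmetric] algebra_simps)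
      finally show ?case .
    qed
    show "(\<lambda>n. c0 * ((real n powr (1 - \<alpha> - \<beta>) + real n powr (- \<alpha>)) / (1 - real n powr (- \<alpha>)))) \<longlonglongrightarrow> 0"
      by (rule tendsto_eq_intros neg neg' refl | simp)+
  qed simp
  then have \<kappa>: "(\<lambda>n. (\<kappa> n)\<^sup>2) \<longlonglongrightarrow> 0" by (rule tendsto_null_power) simp
  then have lim: "(\<lambda>n. 1 / sqrt (1 - 2 * (\<kappa> n)\<^sup>2)) \<longlonglongrightarrow> 1"
    by (auto intro!: tendsto_eq_intros)
  show ?thesis
  proof (rule LIMSEQ_I)
    fix e :: real assume e: "0 < e"
    define \<eta> where "\<eta> = e / 2"
    have \<eta>: "0 < \<eta>" "\<eta> < e" using e by (auto simp: \<eta>_def)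
    have "\<forall>\<^sub>F n in sequentially. (\<kappa> n)\<^sup>2 < 1 / 4" using order_tendstoD(2)[OF \<kappa>, of "1 / 4"] by simp
    moreover have "\<forall>\<^sub>F n in sequentially. 1 / sqrt (1 - 2 * (\<kappa> n)\<^sup>2) < 1 + \<eta>\<^sup>2"
      using order_tendstoD(2)[OF lim, of "1 + \<eta>\<^sup>2"] \<eta> by simp
    ultimately have "\<forall>\<^sub>F n in sequentially. norm ((INF \<phi>\<in>tests n (p n). type_I_error (null_law n (p n)) \<phi> +
        type_II_error (alt_law n (p n) (D n) (\<nu> n)) \<phi>) - 1) < e"
      using eventually_ge_at_top[of 2]
    proof eventually_elim
      case (elim n)
      then have n: "1 \<le> n" by simp
      have "\<bar>(INF \<phi>\<in>tests n (p n). type_I_error (null_law n (p n)) \<phi> +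
        type_II_error (alt_law n (p n) (D n) (\<nu> n)) \<phi>) - 1\<bar> \<le> \<eta>"
        using elim assms(15)[of n] \<eta>(1)
        by (intro inf_error_sum_bound[OF assms(13)[OF n] assms(11)[OF n] assms(12)[OF n] _ _ r_pos[OF n] assms(7)[OF n], of "\<epsilon> n"])
          (auto simp: \<kappa>_def \<epsilon>_def)
      then show ?case using \<eta> by simp
    qed
    then show "\<exists>N. \<forall>n\<ge>N. norm ((INF \<phi>\<in>tests n (p n). type_I_error (null_law n (p n)) \<phi> +
        type_II_error (alt_law n (p n) (D n) (\<nu> n)) \<phi>) - 1) < e"
      unfolding eventually_sequentially .
  qed
qed

end
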